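(* For every integer $k\ge 1$, the Kontsevich integral $W_{2k}$ of the wheel with $2k$ peripheral vertices is zero: $W_{2k}=0$.
   Context: Let $\mathcal H=\{z\in\mathbb C:\operatorname{Im} z>0\}$ be the upper half-plane. For distinct $p,q\in\mathcal H$ the harmonic angle function is $$\varphi(p,q)=\arg\frac{q-p}{q-\bar p}=\frac{1}{2i}\log\frac{(q-p)(\bar q-p)}{(q-\bar p)(\bar q-\bar p)},$$ well defined modulo $2\pi$; thus $d\varphi(p,q)$ is a well-defined smooth closed $1$-form on the space of pairs of distinct points of $\mathcal H$. The wheel with $2k$ peripheral vertices is the oriented graph with a central vertex $z_0$ and peripheral vertices $z_1,\dots,z_{2k}$ (indices of peripheral vertices are taken modulo $2k$), and with $4k$ oriented edges: for each $i=1,\dots,2k$ an edge from $z_i$ to $z_0$ (all central edges point toward the center) and an edge from $z_i$ to $z_{i+1}$. Let $C_{2k+1,0}$ be the quotient of the space of configurations of $2k+1$ pairwise distinct points $(z_0,z_1,\dots,z_{2k})$ in $\mathcal H$ by the group of transformations $z\mapsto az+b$, $a>0$, $b\in\mathbb R$. It has dimension $4k$, and it is identified with the set of $(z_1,\dots,z_{2k})$ of pairwise distinct points of $\mathcal H\setminus\{i\}$ by normalizing $z_0=i$. The Kontsevich integral of the wheel is $$W_{2k}=c_{2k}\int_{C_{2k+1,0}}\ \bigwedge_{j=1}^{2k}\Big(d\varphi(z_j,z_0)\wedge d\varphi(z_j,z_{j+1})\Big),$$ where $C_{2k+1,0}$ is oriented by its complex coordinates $z_1,\dots,z_{2k}$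 (after setting $z_0=i$), and $c_{2k}\neq 0$ is a fixed normalization constant depending only on $k$ (coming from the normalization of weights in Kontsevich's formality theorem); its nonzero value is immaterial for the vanishing. The integral converges absolutely. *)

theory Defs
  imports "HOL-Analysis.Analysis"
begin

definition upper_half_plane :: "complex set" where
  "upper_half_plane = {z. Im z > 0}"

text \<open>The harmonic angle is only defined modulo \<open>2\<pi>\<close>, so it is a relation:
  \<open>t\<close> is one of the values of \<open>\<phi>(p,q)\<close>.\<close>

definition is_harmonic_angle :: "complex \<Rightarrow> complex \<Rightarrow> real \<Rightarrow> bool" where
  "is_harmonic_angle p q t \<longleftrightarrow> is_Arg ((q - p) / (q - cnj p)) t"

text \<open>The \<open>1\<close>-form \<open>d\<phi>\<close> at \<open>(p,q)\<close>, as a real-linear functional of a tangent vector \<open>(u,v)\<close>,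
  is the derivative of any differentiable local branch of \<open>\<phi>\<close>.  It is well defined for distinct
  points of the half-plane, see \<open>d_harmonic_angle_eq\<close> below.\<close>

definition d_harmonic_angle :: "complex \<Rightarrow> complex \<Rightarrow> complex \<times> complex \<Rightarrow> real" where
  "d_harmonic_angle p q =
    (THE D. \<exists>\<theta>. (\<forall>\<^sub>F x in nhds (p, q). is_harmonic_angle (fst x) (snd x) (\<theta> x)) \<and>
                 (\<theta> has_derivative D) (at (p, q)))"

lemma d_harmonic_angle_eq:
  assumes "p \<in> upper_half_plane" "q \<in> upper_half_plane" "p \<noteq> q"
  shows "d_harmonic_angle p q = (\<lambda>(u, v). Im ((v - u) / (q - p) - (v - cnj u) / (q - cnj p)))"
    (is "_ = ?D")
proof -
  define f :: "complex \<times> complex \<Rightarrow> complex"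
    where "f = (\<lambda>x. (snd x - fst x) / (snd x - cnj (fst x)))"
  define a where "a = f (p, q)"
  define \<theta>0 where "\<theta>0 = (\<lambda>x. Arg a + Im (Ln (f x / a)))"
  have "Im (q - cnj p) > 0"
    using assms by (simp add: upper_half_plane_def)
  then have nz: "q - p \<noteq> 0" "q - cnj p \<noteq> 0"
    using assms(3) by auto
  then have a0: "a \<noteq> 0"
    by (simp add: a_def f_def)
  define f' :: "complex \<times> complex \<Rightarrow> complex"
    where "f' = (\<lambda>h. ((snd h - fst h) * (q - cnj p) - (q - p) * (snd h - cnj (fst h)))
                 / ((q - cnj p) * (q - cnj p)))"
  have f': "(f has_derivative f') (at (p, q))"
  proof -
    have 1: "((\<lambda>x. snd x - fst x) has_derivative (\<lambda>h. snd h - fst h)) (at (p, q))"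
      by (intro has_derivative_diff has_derivative_fst has_derivative_snd has_derivative_ident)
    have 2: "((\<lambda>x. snd x - cnj (fst x)) has_derivative (\<lambda>h. snd h - cnj (fst h))) (at (p, q))"
      by (intro has_derivative_diff has_derivative_fst has_derivative_snd has_derivative_ident
          bounded_linear.has_derivative[OF bounded_linear_cnj])
    show ?thesis
      using has_derivative_divide'[OF 1 2] nz unfolding f_def f'_def by simp
  qed
  have "isCont f (p, q)"
    using f' by (rule has_derivative_continuous)
  then have "(f \<longlongrightarrow> a) (nhds (p, q))"
    unfolding a_def using tendsto_at_iff_tendsto_nhds continuous_at by blast
  then have ev0: "\<forall>\<^sub>F x in nhds (p, q). f x \<noteq> 0"
    using a0 by (rule tendsto_imp_eventually_ne)
  have lift0: "\<forall>\<^sub>F x in nhds (p, q). is_Arg (f x) (\<theta>0 x)"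
    using ev0
  proof eventually_elim
    case (elim x)
    have "is_Arg (f x / a) (Im (Ln (f x / a)))"
      using elim a0 is_Arg_Arg[of "f x / a"] by (simp add: Arg_def)
    moreover have "is_Arg a (Arg a)"
      using a0 by (rule is_Arg_Arg)
    ultimately have "f x / a * a = of_real (norm (f x / a)) * exp (\<i> * of_real (Im (Ln (f x / a))))
        * (of_real (norm a) * exp (\<i> * of_real (Arg a)))"
      unfolding is_Arg_def by metis
    then show ?case
      using a0 by (simp add: is_Arg_def \<theta>0_def norm_divide exp_add algebra_simps)
  qed
  have "((\<lambda>x. Ln (f x / a)) has_derivative (\<lambda>h. f' h / a)) (at (p, q))"
  proof -
    have "((\<lambda>x. f x / a) has_derivative (\<lambda>h. f' h / a)) (at (p, q))"
      using f' by (rule bounded_linear.has_derivative[OF bounded_linear_divide])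
    moreover have "(Ln has_derivative (\<lambda>h. h)) (at (f (p, q) / a))"
    proof -
      have "(*) (1::complex) = (\<lambda>h. h)"
        by auto
      then show ?thesis
        using a0 has_field_derivative_Ln[of 1]
        by (simp only: a_def[symmetric] has_field_derivative_def) simp
    qed
    ultimately show ?thesis
      by (rule has_derivative_compose)
  qed
  then have "(\<theta>0 has_derivative (\<lambda>h. Im (f' h / a))) (at (p, q))"
    unfolding \<theta>0_def
    using has_derivative_add[OF has_derivative_const bounded_linear.has_derivative[OF bounded_linear_Im]]
    by fastforce
  moreover have "(\<lambda>h. Im (f' h / a)) = ?D"
  proof
    fix h :: "complex \<times> complex"
    have "f' h / a = (snd h - fst h) / (q - p) - (snd h - cnj (fst h)) / (q - cnj p)"
      using nz by (simp add: f'_def a_def f_def divide_simps)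
    then show "Im (f' h / a) = ?D h"
      by (simp add: case_prod_beta)
  qed
  ultimately have d0: "(\<theta>0 has_derivative ?D) (at (p, q))"
    by simp
  have uniq: "D = ?D" if lift: "\<forall>\<^sub>F x in nhds (p, q). is_Arg (f x) (\<theta> x)"
    and der: "(\<theta> has_derivative D) (at (p, q))" for \<theta> D
  proof -
    define c where "c = \<theta> (p, q) - \<theta>0 (p, q)"
    have "is_Arg a (\<theta> (p, q))" "is_Arg a (\<theta>0 (p, q))"
      using eventually_nhds_x_imp_x[OF lift] eventually_nhds_x_imp_x[OF lift0]
      by (simp_all add: a_def)
    then have "exp (\<i> * of_real (\<theta> (p, q))) = exp (\<i> * of_real (\<theta>0 (p, q)))"
      using a0 unfolding is_Arg_def by (metis mult_cancel_left mult_eq_0_iff)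
    then have ec: "exp (\<i> * of_real c) = 1"
      by (simp add: c_def algebra_simps exp_diff)
    have "((\<lambda>x. \<theta> x - (\<theta>0 x + c)) has_derivative (\<lambda>h. D h - ?D h)) (at (p, q))"
      using der d0 by (auto intro!: derivative_eq_intros)
    then have "isCont (\<lambda>x. \<theta> x - (\<theta>0 x + c)) (p, q)"
      by (rule has_derivative_continuous)
    then have "((\<lambda>x. \<theta> x - (\<theta>0 x + c)) \<longlongrightarrow> 0) (nhds (p, q))"
      using tendsto_at_iff_tendsto_nhds[of "\<lambda>x. \<theta> x - (\<theta>0 x + c)" "(p, q)"]
      by (simp add: continuous_at c_def)
    then have "\<forall>\<^sub>F x in nhds (p, q). dist (\<theta> x - (\<theta>0 x + c)) 0 < 2 * pi"
      by (rule tendstoD) simp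
    then have eq: "\<forall>\<^sub>F x in nhds (p, q). \<theta> x = \<theta>0 x + c"
      using lift lift0 ev0
    proof eventually_elim
      case (elim x)
      have "is_Arg (f x) (\<theta>0 x + c)"
        using elim(3) ec by (simp add: is_Arg_def distrib_left exp_add)
      then show ?case
        using is_Arg_eqI[OF elim(2) _ _ elim(4)] elim(1) by (simp add: dist_real_def)
    qed
    have "((\<lambda>x. \<theta>0 x + c) has_derivative ?D) (at (p, q))"
      using d0 by (auto intro!: derivative_eq_intros)
    then have "(\<theta> has_derivative ?D) (at (p, q))"
    proof (rule has_derivative_transform_eventually)
      show "\<forall>\<^sub>F x in at (p, q). \<theta>0 x + c = \<theta> x"
        using eq unfolding eventually_at_filter by (rule eventually_mono) simp
    qed (simp_all add: c_def)
    then show ?thesis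
      using der has_derivative_unique by blast
  qed
  have harm: "is_harmonic_angle (fst x) (snd x) t \<longleftrightarrow> is_Arg (f x) t" for x t
    by (simp add: is_harmonic_angle_def f_def)
  show ?thesis
    unfolding d_harmonic_angle_def harm
  proof (rule the_equality)
    show "\<exists>\<theta>. (\<forall>\<^sub>F x in nhds (p, q). is_Arg (f x) (\<theta> x)) \<and> (\<theta> has_derivative ?D) (at (p, q))"
      using lift0 d0 by blast
  qed (use uniq in blast)
qed

text \<open>Vertex \<open>0\<close> is the centre, vertices \<open>1, \<dots>, 2k\<close> are peripheral.  The edges are listed in the
  order in which their forms are multiplied.\<close>

definition rim_next :: "nat \<Rightarrow> nat \<Rightarrow> nat" where
  "rim_next k j = (if j = 2 * k then 1 else j + 1)"

definition wheel_edges :: "nat \<Rightarrow> (nat \<times> nat) list" where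
  "wheel_edges k = concat (map (\<lambda>j. [(j, 0), (j, rim_next k j)]) [1..<2 * k + 1])"

text \<open>Pullback of \<open>d\<phi>\<close> along \<open>z \<mapsto> (z\<^sub>a, z\<^sub>b)\<close>, evaluated at the configuration \<open>z\<close> on the
  tangent vector \<open>v\<close>.\<close>

definition edge_form :: "nat \<times> nat \<Rightarrow> (nat \<Rightarrow> complex) \<Rightarrow> (nat \<Rightarrow> complex) \<Rightarrow> real" where
  "edge_form e z v = d_harmonic_angle (z (fst e)) (z (snd e)) (v (fst e), v (snd e))"

text \<open>\<open>(\<omega>\<^sub>0 \<and> \<dots> \<and> \<omega>\<^sub>n\<^sub>-\<^sub>1)(v\<^sub>0, \<dots>, v\<^sub>n\<^sub>-\<^sub>1) = det (\<omega>\<^sub>a(v\<^sub>b))\<close>, normalized so that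
  \<open>dx\<^sub>0 \<and> \<dots> \<and> dx\<^sub>n\<^sub>-\<^sub>1\<close> takes the value \<open>1\<close> on the standard basis.\<close>

definition wedge :: "('v \<Rightarrow> real) list \<Rightarrow> (nat \<Rightarrow> 'v) \<Rightarrow> real" where
  "wedge \<omega> v = (\<Sum>\<sigma> | \<sigma> permutes {..<length \<omega>}.
     of_int (sign \<sigma>) * (\<Prod>a<length \<omega>. (\<omega> ! a) (v (\<sigma> a))))"

text \<open>The frame \<open>\<partial>x\<^sub>1, \<partial>y\<^sub>1, \<partial>x\<^sub>2, \<partial>y\<^sub>2, \<dots>\<close> given by \<open>z\<^sub>j = x\<^sub>j + iy\<^sub>j\<close>, in the order defining the
  complex orientation.  Its members have zero component at the centre, which stays fixed.\<close>

definition coord_frame :: "nat \<Rightarrow> nat \<Rightarrow> complex" where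
  "coord_frame b = (\<lambda>l. if l = b div 2 + 1 then (if even b then 1 else \<i>) else 0)"

text \<open>The slice \<open>z\<^sub>0 = i\<close> of \<open>C\<^sub>n\<^sub>+\<^sub>1\<^sub>,\<^sub>0\<close>.  The centre is not stored: configurations are
  extensional functions on \<open>{1..n}\<close>, as required by the product measure.\<close>

definition config_space :: "nat \<Rightarrow> (nat \<Rightarrow> complex) set" where
  "config_space n = {z \<in> {1..n} \<rightarrow>\<^sub>E upper_half_plane - {\<i>}. inj_on z {1..n}}"

text \<open>Coefficient of the wheel form with respect to
  \<open>dx\<^sub>1 \<and> dy\<^sub>1 \<and> \<dots> \<and> dx\<^sub>2\<^sub>k \<and> dy\<^sub>2\<^sub>k\<close>.\<close>

definition wheel_density :: "nat \<Rightarrow> (nat \<Rightarrow> complex) \<Rightarrow> real" where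
  "wheel_density k z =
     wedge (map (\<lambda>e. edge_form e (z(0 := \<i>))) (wheel_edges k)) coord_frame"

definition wheel_integral :: "real \<Rightarrow> nat \<Rightarrow> real" where
  "wheel_integral c k =
     c * (LINT z:config_space (2 * k) | (\<Pi>\<^sub>M j\<in>{1..2 * k}. lborel). wheel_density k z)"

end

theory Submission
  imports Defs "HOL-Number_Theory.Cong" "Jordan_Normal_Form.Determinant"
begin

text \<open>
  The centre of the wheel is fixed at \<open>\<i>\<close>, and modulo constants \<open>\<phi>(z, \<i>) = arg (1 + z\<^sup>2)\<close>.  In the
  coordinate \<open>B + \<i>A = log (1 + z\<^sup>2)\<close> the half-plane becomes the cylinder \<open>\<real> \<times> \<real>/2\<pi>\<close> slit along the
  half-line \<open>A = 0, B \<ge> 0\<close>; the tip of the slit is \<open>z = 0\<close> and the centre is the end \<open>B = -\<infinity>\<close>.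
  The form of the central edge at \<open>z\<^sub>j\<close> is \<open>dA\<^sub>j\<close>, so only the derivatives of the rim forms
  along the curves of constant \<open>A\<^sub>j\<close> contribute.  They form a cyclic bidiagonal matrix, whose
  determinant has two terms.  As \<open>\<phi>(p,q)\<close> is a harmonic conjugate of the Neumann Green function in
  \<open>p\<close> and of the Dirichlet Green function in \<open>q\<close>, the Cauchy--Riemann equations turn the integral
  over configurations of \<open>n = 2k\<close> points, formally, into \<open>tr K\<^sub>N\<^sup>n - tr K\<^sub>D\<^sup>n\<close>, where, up to a common constant, \<open>K\<^sub>N\<close>
  is \<open>\<partial>\<^sub>A\<close> after the inverse Neumann Laplacian and \<open>K\<^sub>D\<close> is the inverse Dirichlet Laplacian
  after \<open>\<partial>\<^sub>A\<close> (\<open>wheel_density_eq\<close>).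

  Since \<open>\<partial>\<^sub>A\<close> is the normal derivative on the slit, it takes Neumann to Dirichlet conditions, and
  the two operators agree apart from a defect at the tip, which has rank one:
  \<open>K\<^sub>N(p,q) - K\<^sub>D(p,q) = h(p) g(q)\<close> with \<open>h(p) = Im (1/p)\<close> and \<open>g(q) = Re (1/q)\<close>
  (\<open>kerN_neumann\<close>).  Telescoping the difference of the cyclic products reduces the claim to the vanishing of
  the moments \<open>c\<^sub>m = \<langle>g, K\<^sub>D\<^sup>m h\<rangle>\<close> (\<open>cyclic_trace_difference\<close>).

  Let \<open>\<delta>\<close> be minus the Dirichlet Green function with pole at \<open>\<i>\<close>, so that \<open>\<partial>\<^sub>B \<delta> = h\<close> and \<open>\<partial>\<^sub>A \<delta> = g\<close>,
  put \<open>\<eta> = \<partial>\<^sub>A h = \<partial>\<^sub>B g\<close>, and let \<open>d\<^sub>m = \<langle>\<eta>, K\<^sub>D\<^sup>m \<delta>\<rangle>\<close>.  Three symmetries determine the moments.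
  The reflection \<open>A \<mapsto> -A\<close> gives \<open>c\<^sub>m = 0\<close> for even \<open>m\<close> (\<open>moment_even\<close>).  Integrating by parts in \<open>A\<close>
  gives \<open>d\<^sub>m = -(-1)\<^sup>m c\<^sub>m\<close> (\<open>tipD'_moment\<close>).  Translation in \<open>B\<close> moves the tip, and
  \<open>(\<partial>\<^sub>B\<^sub>,\<^sub>p + \<partial>\<^sub>B\<^sub>,\<^sub>q) K\<^sub>D(p,q) = -h(p) \<eta>(q)\<close>; integrating the total \<open>B\<close>-derivative of the
  integrand of \<open>\<langle>g, K\<^sub>D\<^sup>m \<delta>\<rangle>\<close> gives \<open>c\<^sub>m + d\<^sub>m = \<Sum> c\<^sub>i d\<^sub>j\<close>, summed over \<open>i + j = m - 1\<close>.
  If the earlier moments vanish and \<open>m\<close> is odd, then \<open>d\<^sub>m = c\<^sub>m\<close> and \<open>2 c\<^sub>m = 0\<close> (\<open>moment_eq_0\<close>).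

  Absolute convergence of the iterated integrals comes from one Schur estimate with the weights \<open>wV\<close>
  and \<open>wW\<close>, which rests on the scale-invariant bound \<open>riesz_const_bound\<close>.
\<close>

section \<open>Change of variables for injective holomorphic maps\<close>

definition complex_of_vec :: "real^2 \<Rightarrow> complex" where
  "complex_of_vec v = Complex (v $ 1) (v $ 2)"

definition vec_of_complex :: "complex \<Rightarrow> real^2" where
  "vec_of_complex z = vector [Re z, Im z]"

lemma complex_of_vec_inverse [simp]: "vec_of_complex (complex_of_vec v) = v"
  and vec_of_complex_inverse [simp]: "complex_of_vec (vec_of_complex z) = z"
  by (simp_all add: complex_of_vec_def vec_of_complex_def Finite_Cartesian_Product.vec_eq_iff forall_2)

lemma bounded_linear_complex_of_vec: "bounded_linear complex_of_vec"
proof -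
  have "linear complex_of_vec"
    by (rule linearI) (simp_all add: complex_of_vec_def complex_eq_iff)
  then show ?thesis by (rule linear_conv_bounded_linear[THEN iffD1])
qed

lemma bounded_linear_vec_of_complex: "bounded_linear vec_of_complex"
proof -
  have "linear vec_of_complex"
    by (rule linearI) (simp_all add: vec_of_complex_def Finite_Cartesian_Product.vec_eq_iff forall_2)
  then show ?thesis by (rule linear_conv_bounded_linear[THEN iffD1])
qed

lemma measurable_complex_of_vec [measurable]: "complex_of_vec \<in> borel_measurable borel"
  and measurable_vec_of_complex [measurable]: "vec_of_complex \<in> borel_measurable borel"
  using bounded_linear_complex_of_vec bounded_linear_vec_of_complex
  by (auto intro!: borel_measurable_continuous_onI linear_continuous_on)

lemma distr_complex_of_vec: "distr lborel borel complex_of_vec = lborel"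
proof (rule lborel_eqI[symmetric])
  fix l u :: complex
  assume le: "\<And>b. b \<in> Basis \<Longrightarrow> l \<bullet> b \<le> u \<bullet> b"
  have "complex_of_vec -` box l u = box (vec_of_complex l) (vec_of_complex u)"
    by (auto simp: box_def complex_of_vec_def vec_of_complex_def Basis_complex_def
        Basis_vec_def inner_axis exhaust_2 forall_2)
  moreover have "(\<Prod>b\<in>(Basis::(real^2) set). (vec_of_complex u - vec_of_complex l) \<bullet> b)
      = (\<Prod>b\<in>Basis. (u - l) \<bullet> b)"
  proof -
    have "(\<Prod>b\<in>(Basis::(real^2) set). (vec_of_complex u - vec_of_complex l) \<bullet> b)
      = (\<Prod>i\<in>(UNIV::2 set). (vec_of_complex u - vec_of_complex l) $ i)"
    proof -
      have B: "Basis = (\<lambda>i::2. axis i (1::real)) ` UNIV"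
        by (auto simp: Basis_vec_def)
      have I: "inj (\<lambda>i::2. axis i (1::real))"
        by (auto simp: inj_on_def axis_eq_axis)
      show ?thesis
        unfolding B prod.reindex[OF I] by (simp add: inner_axis)
    qed
    then show ?thesis
      by (simp add: UNIV_2 vec_of_complex_def Basis_complex_def)
  qed
  moreover have "\<And>b. b \<in> (Basis::(real^2) set) \<Longrightarrow> vec_of_complex l \<bullet> b \<le> vec_of_complex u \<bullet> b"
    using le[of 1] le[of \<i>]
    by (auto simp: Basis_vec_def inner_axis vec_of_complex_def Basis_complex_def forall_2[where P="\<lambda>i. vector [Re l, Im l] $ i \<le> vector [Re u, Im u] $ i", THEN iffD2, rule_format])
  ultimately show "emeasure (distr lborel borel complex_of_vec) (box l u) = (\<Prod>b\<in>Basis. (u - l) \<bullet> b)"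
    by (subst emeasure_distr) (auto simp: emeasure_lborel_box_eq)
qed simp

text \<open>The Jacobian of a holomorphic map is \<open>|f'|\<^sup>2\<close>.  The finiteness of either side has to be settled
  first, because the change-of-variables theorem for \<open>real^2\<close> speaks of finite measures.\<close>

lemma emeasure_conformal_image:
  assumes S: "S \<in> sets borel" and fS: "f ` S \<in> sets borel"
    and der: "\<And>z. z \<in> S \<Longrightarrow> (f has_field_derivative f' z) (at z)"
    and inj: "inj_on f S" and f': "f' \<in> borel_measurable borel"
  shows "emeasure lborel (f ` S) = (\<integral>\<^sup>+z\<in>S. ennreal ((cmod (f' z))\<^sup>2) \<partial>lborel)"
proof -
  define T where "T = complex_of_vec -` S"
  define F where "F = vec_of_complex \<circ> f \<circ> complex_of_vec"
  define D where "D x h = vec_of_complex (f' (complex_of_vec x) * complex_of_vec h)" for x h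
  have T: "T \<in> sets borel"
    unfolding T_def using S by (metis measurable_complex_of_vec measurable_sets_borel)
  have FT: "F ` T = complex_of_vec -` (f ` S)"
  proof (intro equalityI subsetI)
    fix x assume "x \<in> complex_of_vec -` (f ` S)"
    then obtain z where z: "z \<in> S" "complex_of_vec x = f z" by auto
    then have "x = F (vec_of_complex z)" "vec_of_complex z \<in> T"
      by (simp_all add: F_def T_def flip: z(2))
    then show "x \<in> F ` T" by blast
  qed (auto simp: F_def T_def)
  have FTb: "F ` T \<in> sets borel"
    unfolding FT using fS by (metis measurable_complex_of_vec measurable_sets_borel)
  have "(F has_derivative D x) (at x within T)" if "x \<in> T" for x
  proof -
    have 1: "(complex_of_vec has_derivative complex_of_vec) (at x within T)"
      using bounded_linear_complex_of_vec by (rule bounded_linear_imp_has_derivative)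
    have 2: "(f has_derivative (\<lambda>h. f' (complex_of_vec x) * h)) (at (complex_of_vec x))"
      using der[of "complex_of_vec x"] that by (simp add: T_def has_field_derivative_def)
    show ?thesis
      using bounded_linear.has_derivative[OF bounded_linear_vec_of_complex has_derivative_compose[OF 1 2]]
      by (simp add: F_def D_def[abs_def] o_def)
  qed
  moreover have "inj_on F T"
    using inj unfolding inj_on_def F_def T_def
    by (metis comp_apply complex_of_vec_inverse vec_of_complex_inverse vimageE)
  moreover have "T \<in> sets lebesgue" using T by auto
  ultimately have meas: "F ` T \<in> lmeasurable \<and> Sigma_Algebra.measure lebesgue (F ` T) = m
     \<longleftrightarrow> ((\<lambda>x. \<bar>Determinants.det (matrix (D x))\<bar>) has_integral m) T" for m
    using has_measure_differentiable_image[of T F D m] by blast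
  have det: "\<bar>Determinants.det (matrix (D x))\<bar> = (cmod (f' (complex_of_vec x)))\<^sup>2" for x
    by (simp add: Determinants.det_2 matrix_def D_def vec_of_complex_def complex_of_vec_def axis_def
        cmod_def power2_eq_square)
  have "emeasure lborel (f ` S) = emeasure lborel (F ` T)"
    unfolding FT by (subst distr_complex_of_vec[symmetric], subst emeasure_distr) (use fS in auto)
  also have "\<dots> = (\<integral>\<^sup>+x\<in>T. ennreal ((cmod (f' (complex_of_vec x)))\<^sup>2) \<partial>lborel)" (is "_ = ?N")
  proof (cases "emeasure lborel (F ` T) = \<infinity> \<and> ?N = \<infinity>")
    case False
    have ind: "(\<lambda>x. (cmod (f' (complex_of_vec x)))\<^sup>2 * indicator T x)
       = (\<lambda>x. if x \<in> T then (cmod (f' (complex_of_vec x)))\<^sup>2 else 0)"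
      by (auto simp: indicator_def)
    have meas1: "(\<lambda>x. (cmod (f' (complex_of_vec x)))\<^sup>2 * indicator T x) \<in> borel_measurable borel"
      using T f' by measurable
    have "((\<lambda>x. (cmod (f' (complex_of_vec x)))\<^sup>2) has_integral Sigma_Algebra.measure lebesgue (F ` T)) T"
    proof (cases "?N = \<infinity>")
      case True
      with False have "emeasure lborel (F ` T) < \<infinity>" by (simp add: less_top)
      then have "F ` T \<in> lmeasurable"
        using FTb by (simp add: fmeasurable_def)
      then show ?thesis using meas[of "Sigma_Algebra.measure lebesgue (F ` T)"] det by simp
    next
      case fin: False
      have "integrable lborel (\<lambda>x. (cmod (f' (complex_of_vec x)))\<^sup>2 * indicator T x)"
        using fin meas1 by (intro integrableI_nonneg) (auto simp: less_top ennreal_mult' ennreal_indicator)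
      then have "(\<lambda>x. (cmod (f' (complex_of_vec x)))\<^sup>2 * indicator T x) integrable_on UNIV"
        using integrable_on_lborel by blast
      then have "(\<lambda>x. (cmod (f' (complex_of_vec x)))\<^sup>2) integrable_on T"
        unfolding ind by (simp add: integrable_restrict_UNIV)
      then show ?thesis using meas det by (auto simp: integrable_on_def)
    qed
    then have hi: "((\<lambda>x. (cmod (f' (complex_of_vec x)))\<^sup>2 * indicator T x) has_integral Sigma_Algebra.measure lebesgue (F ` T)) UNIV"
      unfolding ind by (simp add: has_integral_restrict_UNIV)
    have N: "?N = ennreal (Sigma_Algebra.measure lebesgue (F ` T))"
      using nn_integral_has_integral_lborel[OF _ _ hi] meas1 by (simp add: ennreal_mult' ennreal_indicator)
    moreover have "F ` T \<in> lmeasurable"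
    proof -
      have "((\<lambda>x. \<bar>Determinants.det (matrix (D x))\<bar>) has_integral Sigma_Algebra.measure lebesgue (F ` T)) T"
        using hi det unfolding ind by (simp add: has_integral_restrict_UNIV)
      then show ?thesis using meas by blast
    qed
    then have "emeasure lborel (F ` T) = ennreal (Sigma_Algebra.measure lebesgue (F ` T))"
      using FTb emeasure_eq_measure2 by force
    ultimately show ?thesis by simp
  qed simp
  also have "\<dots> = (\<integral>\<^sup>+z\<in>S. ennreal ((cmod (f' z))\<^sup>2) \<partial>lborel)"
    unfolding T_def
    by (subst distr_complex_of_vec[symmetric], subst nn_integral_distr) (use S f' in \<open>auto simp: indicator_def\<close>)
  finally show ?thesis .
qed

lemma distr_Complex: "distr (lborel \<Otimes>\<^sub>M lborel) borel (\<lambda>(x, y). Complex x y) = lborel"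
proof (rule lborel_eqI[symmetric])
  have [measurable]: "(\<lambda>(x, y). Complex x y) \<in> borel_measurable (borel \<Otimes>\<^sub>M borel)"
    by (auto intro!: borel_measurable_continuous_onI continuous_intros simp: borel_prod split_beta)
  fix l u :: complex
  assume le: "\<And>b. b \<in> Basis \<Longrightarrow> l \<bullet> b \<le> u \<bullet> b"
  have "(\<lambda>(x, y). Complex x y) -` box l u = box (Re l) (Re u) \<times> box (Im l) (Im u)"
    by (auto simp: box_def Basis_complex_def)
  then have "emeasure (distr (lborel \<Otimes>\<^sub>M lborel) borel (\<lambda>(x, y). Complex x y)) (box l u)
      = emeasure (lborel \<Otimes>\<^sub>M lborel) (box (Re l) (Re u) \<times> box (Im l) (Im u))"
    by (subst emeasure_distr) (auto simp: space_pair_measure)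
  also have "\<dots> = emeasure lborel (box (Re l) (Re u)) * emeasure lborel (box (Im l) (Im u))"
    by (rule lborel.emeasure_pair_measure_Times) auto
  finally show "emeasure (distr (lborel \<Otimes>\<^sub>M lborel) borel (\<lambda>(x, y). Complex x y)) (box l u)
      = (\<Prod>b\<in>Basis. (u - l) \<bullet> b)"
    using le[of 1] le[of \<i>] by (simp add: Basis_complex_def ennreal_mult' emeasure_lborel_box_eq)
qed simp

lemma AE_lborel_not_in_negligible:
  fixes N :: "'a::euclidean_space set"
  assumes "negligible N" "N \<in> sets borel"
  shows "AE z in lborel. z \<notin> N"
proof (rule AE_not_in)
  show "N \<in> null_sets lborel"
    using assms by (subst null_sets_completion_iff[symmetric]) (simp_all add: negligible_iff_null_sets)
qed

section \<open>Strip coordinates on the half-plane\<close>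

text \<open>The derivative \<open>dz/ds\<close> for \<open>s = log (1 + z\<^sup>2)\<close>: this is the holomorphic vector field of translations
  in \<open>B = Re s\<close>, and \<open>\<i>\<close> times it generates the rotations in \<open>A = Im s\<close>.\<close>

definition vfield :: "complex \<Rightarrow> complex" where
  "vfield z = (z + 1 / z) / 2"

text \<open>The area form \<open>dA dB\<close> in the coordinate \<open>s = B + \<i>A\<close>, written in terms of \<open>z\<close>.\<close>

definition hmeasure :: "complex measure" where
  "hmeasure = density lborel (\<lambda>z. ennreal (indicator {z. Im z > 0} z / (cmod (vfield z))\<^sup>2))"

definition strip :: "complex set" where
  "strip = {s. 0 < Im s \<and> Im s < 2 * pi}"

text \<open>The inverse \<open>s \<mapsto> z\<close> of \<open>z \<mapsto> log (1 + z\<^sup>2)\<close>.  As \<open>csqrt\<close> has nonnegative real part, the factor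
  \<open>\<i>\<close> selects the root in the closed upper half-plane.\<close>

definition uniformizer :: "complex \<Rightarrow> complex" where
  "uniformizer s = \<i> * csqrt (1 - exp s)"

definition strip_coord :: "complex \<Rightarrow> complex" where
  "strip_coord z = Ln (- (1 + z\<^sup>2)) + \<i> * of_real pi"

lemma uniformizer_squared: "(uniformizer s)\<^sup>2 = exp s - 1"
  by (simp add: uniformizer_def power_mult_distrib)

lemma measurable_vfield [measurable]: "vfield \<in> borel_measurable borel"
  unfolding vfield_def by measurable

lemma measurable_csqrt [measurable]: "csqrt \<in> borel_measurable borel"
proof -
  have "csqrt z = complex_of_real (sqrt ((cmod z + Re z) / 2))
      + \<i> * complex_of_real ((if Im z < 0 then - 1 else 1) * sqrt ((cmod z - Re z) / 2))" for z
    by (rule complex_eqI) (simp_all add: sgn_if)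
  then have *: "csqrt = (\<lambda>z. complex_of_real (sqrt ((cmod z + Re z) / 2))
      + \<i> * complex_of_real ((if Im z < 0 then - 1 else 1) * sqrt ((cmod z - Re z) / 2)))" ..
  show ?thesis unfolding * by measurable
qed

declare csqrt.simps [simp del]

lemma measurable_uniformizer [measurable]: "uniformizer \<in> borel_measurable borel"
  unfolding uniformizer_def by measurable

lemma sets_strip [measurable]: "strip \<in> sets borel"
  unfolding strip_def by measurable

text \<open>Removing the slit \<open>A = 0\<close> keeps \<open>1 + z\<^sup>2\<close> away from the branch cut of the square root.\<close>

lemma exp_strip_notin_nonneg:
  assumes "s \<in> strip" shows "exp s \<notin> \<real>\<^sub>\<ge>\<^sub>0"
proof
  assume "exp s \<in> \<real>\<^sub>\<ge>\<^sub>0"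
  then have s0: "sin (Im s) = 0" and c0: "cos (Im s) \<ge> 0"
    by (auto simp: complex_nonneg_Reals_iff Re_exp Im_exp zero_le_mult_iff)
  have "Im s = pi"
    using s0 assms by (metis (mono_tags, lifting) strip_def mem_Collect_eq sin_eq_0_pi sin_gt_zero sin_lt_zero linorder_less_linear less_irrefl)
  then show False using c0 by simp
qed

lemma uniformizer_strip:
  assumes "s \<in> strip"
  shows "Im (uniformizer s) > 0" and "uniformizer s \<noteq> \<i>"
    and "(uniformizer has_field_derivative vfield (uniformizer s)) (at s)"
proof -
  have n: "1 - exp s \<notin> \<real>\<^sub>\<le>\<^sub>0"
    using exp_strip_notin_nonneg[OF assms]
    by (auto simp: complex_nonpos_Reals_iff complex_nonneg_Reals_iff)
  then have c: "csqrt (1 - exp s) \<noteq> 0" by auto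
  have sq: "w\<^sup>2 \<in> \<real>\<^sub>\<le>\<^sub>0" if "Re w = 0" for w :: complex
    using that by (simp add: complex_nonpos_Reals_iff power2_eq_square)
  have "Re (csqrt (1 - exp s)) \<noteq> 0"
    using sq[of "csqrt (1 - exp s)"] n unfolding power2_csqrt by blast
  then have "Re (csqrt (1 - exp s)) > 0"
    using Re_csqrt[of "1 - exp s"] by linarith
  then show "Im (uniformizer s) > 0" by (simp add: uniformizer_def)
  show "uniformizer s \<noteq> \<i>"
    using uniformizer_squared[of s] by (auto simp: power2_eq_square)
  have "(uniformizer has_field_derivative \<i> * (- exp s / (2 * csqrt (1 - exp s)))) (at s)"
    unfolding uniformizer_def using n by (auto intro!: derivative_eq_intros simp: field_simps)
  moreover have "\<i> * (- exp s / (2 * csqrt (1 - exp s))) = vfield (uniformizer s)"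
  proof -
    have "vfield (uniformizer s) = ((uniformizer s)\<^sup>2 + 1) / (2 * uniformizer s)"
      using c by (simp add: vfield_def field_simps power2_eq_square uniformizer_def)
    also have "\<dots> = \<i> * (- exp s / (2 * csqrt (1 - exp s)))"
      unfolding uniformizer_squared using c by (simp add: uniformizer_def field_simps)
    finally show ?thesis by simp
  qed
  ultimately show "(uniformizer has_field_derivative vfield (uniformizer s)) (at s)" by simp
qed

text \<open>The points excluded here are those of the segment from \<open>0\<close> to \<open>\<i>\<close>.  It corresponds to the
  half-line \<open>A = 0, B < 0\<close>, which lies in the cylinder but not in the open strip.\<close>

lemma strip_coord:
  assumes "Im z > 0" "Re z \<noteq> 0 \<or> Im z > 1"
  shows "strip_coord z \<in> strip" "uniformizer (strip_coord z) = z"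
    "(strip_coord has_field_derivative 1 / vfield z) (at z)"
proof -
  have n: "- (1 + z\<^sup>2) \<notin> \<real>\<^sub>\<le>\<^sub>0"
  proof
    assume "- (1 + z\<^sup>2) \<in> \<real>\<^sub>\<le>\<^sub>0"
    then have "Re z * Im z = 0" "1 + (Re z)\<^sup>2 - (Im z)\<^sup>2 \<ge> 0"
      by (auto simp: complex_nonpos_Reals_iff power2_eq_square)
    then show False using assms by (auto simp: power2_le_iff_abs_le abs_square_le_1)
  qed
  then have nz: "- (1 + z\<^sup>2) \<noteq> 0" by auto
  have "- pi < Im (Ln (- (1 + z\<^sup>2)))" "Im (Ln (- (1 + z\<^sup>2))) < pi"
    using mpi_less_Im_Ln[OF nz] n Im_Ln_less_pi[of "- (1 + z\<^sup>2)"] by (auto simp: complex_nonpos_Reals_iff not_less)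
  then show "strip_coord z \<in> strip" by (simp add: strip_coord_def strip_def)
  have "exp (strip_coord z) = 1 + z\<^sup>2"
    using nz by (simp add: strip_coord_def exp_add exp_Ln)
  then have "uniformizer (strip_coord z) = \<i> * csqrt ((- \<i> * z)\<^sup>2)"
    by (simp add: uniformizer_def power_mult_distrib)
  also have "csqrt ((- \<i> * z)\<^sup>2) = - \<i> * z"
    using assms(1) by (intro csqrt_square) auto
  finally show "uniformizer (strip_coord z) = z" by simp
  have "z \<noteq> 0" using assms by auto
  then have "vfield z = (1 + z\<^sup>2) / (2 * z)"
    by (simp add: vfield_def field_simps power2_eq_square)
  then have "1 / vfield z = inverse (- (1 + z\<^sup>2)) * - (2 * z)"
    by (metis inverse_eq_divide inverse_minus_eq minus_mult_minus divide_inverse inverse_divide mult.commute)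
  moreover have "(strip_coord has_field_derivative inverse (- (1 + z\<^sup>2)) * - (2 * z)) (at z)"
    unfolding strip_coord_def using n by (auto intro!: derivative_eq_intros)
  ultimately show "(strip_coord has_field_derivative 1 / vfield z) (at z)" by simp
qed

lemma inj_on_uniformizer: "inj_on uniformizer strip"
proof (rule inj_onI)
  fix s t assume st: "s \<in> strip" "t \<in> strip" "uniformizer s = uniformizer t"
  then have "exp s - 1 = exp t - 1"
    by (metis uniformizer_squared)
  then have "exp s = exp t" by simp
  moreover have "\<bar>Im s - Im t\<bar> < 2 * pi"
    using st(1,2) by (simp add: strip_def abs_less_iff)
  ultimately show "s = t" by (rule exp_complex_eqI[rotated])
qed

lemma AE_lborel_Re_ne_0: "AE z in lborel. Re z \<noteq> 0"
proof -
  have "negligible {z. (1::complex) \<bullet> z = 0}"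
    by (rule negligible_hyperplane) simp
  moreover have "{z. (1::complex) \<bullet> z = 0} \<in> sets borel" by measurable
  ultimately have "AE z in lborel. z \<notin> {z. (1::complex) \<bullet> z = 0}"
    by (rule AE_lborel_not_in_negligible)
  then show ?thesis by (rule eventually_mono) (auto simp: inner_complex_def)
qed

text \<open>The strip covers the half-plane up to a null set, so Lebesgue measure on the strip describes
  \<open>hmeasure\<close> completely.  The invariance and the integration by parts below are read off from this.\<close>

lemma distr_uniformizer: "distr (density lborel (indicator strip)) borel uniformizer = hmeasure"
proof (rule measure_eqI)
  \<comment> \<open>the image of the strip\<close>
  define Q where "Q = {z. Im z > 0 \<and> (Re z \<noteq> 0 \<or> Im z > 1)}"
  have [measurable]: "Q \<in> sets borel" unfolding Q_def by measurable
  have Z_in: "uniformizer s \<in> Q" if "s \<in> strip" for s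
  proof (rule ccontr)
    define z where "z = uniformizer s"
    assume "uniformizer s \<notin> Q"
    then have "Re z = 0" "Im z > 0" "Im z \<le> 1"
      using uniformizer_strip(1)[OF that] by (auto simp: Q_def z_def)
    then have "1 + z\<^sup>2 \<in> \<real>\<^sub>\<ge>\<^sub>0"
      by (simp add: complex_nonneg_Reals_iff power2_eq_square mult_le_one)
    then show False
      using uniformizer_squared[of s] exp_strip_notin_nonneg[OF that] by (simp add: z_def)
  qed
  have coord_Z: "strip_coord (uniformizer s) = s" if "s \<in> strip" for s
    using strip_coord[of "uniformizer s"] Z_in[OF that] inj_on_uniformizer that
    by (auto simp: Q_def inj_on_def)
  fix X assume "X \<in> sets (distr (density lborel (indicator strip)) borel uniformizer)"
  then have X [measurable]: "X \<in> sets borel" by simp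
  have im: "strip_coord ` (X \<inter> Q) = strip \<inter> uniformizer -` X"
  proof (intro equalityI subsetI)
    fix s assume s: "s \<in> strip \<inter> uniformizer -` X"
    then have "s = strip_coord (uniformizer s)" "uniformizer s \<in> X \<inter> Q"
      using coord_Z Z_in by auto
    then show "s \<in> strip_coord ` (X \<inter> Q)" by blast
  qed (use strip_coord in \<open>auto simp: Q_def\<close>)
  have meas: "strip \<inter> uniformizer -` X \<in> sets borel"
    using measurable_sets_borel[OF measurable_uniformizer X] by auto
  have "emeasure (distr (density lborel (indicator strip)) borel uniformizer) X
      = emeasure lborel (strip \<inter> uniformizer -` X)"
    using measurable_sets_borel[OF measurable_uniformizer X] meas
    by (simp add: emeasure_distr emeasure_density flip: indicator_inter_arith)
  also have "\<dots> = (\<integral>\<^sup>+z\<in>X \<inter> Q. ennreal ((cmod (1 / vfield z))\<^sup>2) \<partial>lborel)"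
    unfolding im[symmetric]
  proof (rule emeasure_conformal_image)
    show "inj_on strip_coord (X \<inter> Q)"
      by (rule inj_on_inverseI[of _ uniformizer]) (use strip_coord in \<open>auto simp: Q_def\<close>)
  qed (use strip_coord(3) meas im in \<open>auto simp: Q_def\<close>)
  also have "\<dots> = (\<integral>\<^sup>+z\<in>X. ennreal (indicator {z. Im z > 0} z / (cmod (vfield z))\<^sup>2) \<partial>lborel)"
    using AE_lborel_Re_ne_0
    by (intro nn_integral_cong_AE) (auto elim!: eventually_mono simp: indicator_def Q_def norm_divide power_divide)
  also have "\<dots> = emeasure hmeasure X"
    by (simp add: hmeasure_def emeasure_density)
  finally show "emeasure (distr (density lborel (indicator strip)) borel uniformizer) X
      = emeasure hmeasure X" .
qed (simp add: hmeasure_def)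

text \<open>Translation by \<open>t\<close> in \<open>B\<close>, that is, multiplication of \<open>1 + z\<^sup>2\<close> by \<open>e\<^sup>t\<close>.\<close>

definition flow :: "real \<Rightarrow> complex \<Rightarrow> complex" where
  "flow t z = \<i> * csqrt (1 - exp (of_real t) * (1 + z\<^sup>2))"

lemma measurable_flow [measurable]:
  "(\<lambda>x. flow (fst x) (snd x)) \<in> borel_measurable (borel \<Otimes>\<^sub>M borel)"
  unfolding flow_def by measurable

lemma flow_uniformizer: "flow t (uniformizer s) = uniformizer (s + of_real t)"
  unfolding flow_def uniformizer_squared by (simp add: uniformizer_def exp_add mult.commute)

lemma distr_hmeasure_flow: "distr hmeasure borel (flow t) = hmeasure"
proof -
  have [measurable]: "flow t \<in> borel_measurable borel"
    unfolding flow_def by measurable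
  let ?L = "density lborel (indicator strip) :: complex measure"
  have L: "distr ?L borel (\<lambda>s. s + of_real t) = ?L"
  proof -
    have "?L = density (distr lborel borel (\<lambda>s. s + of_real t)) (indicator strip)"
      using lborel_distr_plus[of "of_real t :: complex"]
      by (simp add: add.commute[of _ "of_real t"])
    also have "\<dots> = distr (density lborel (\<lambda>s. indicator strip (s + of_real t))) borel (\<lambda>s. s + of_real t)"
      by (rule density_distr) auto
    also have "(\<lambda>s. indicator strip (s + of_real t)) = (indicator strip :: complex \<Rightarrow> ennreal)"
      by (auto simp: fun_eq_iff indicator_def strip_def)
    finally show ?thesis by simp
  qed
  have "distr hmeasure borel (flow t) = distr ?L borel (\<lambda>s. uniformizer (s + of_real t))"
    unfolding distr_uniformizer[symmetric] by (subst distr_distr) (auto simp: o_def flow_uniformizer)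
  also have "\<dots> = distr (distr ?L borel (\<lambda>s. s + of_real t)) borel uniformizer"
    by (subst distr_distr) (auto simp: o_def)
  finally show ?thesis unfolding L distr_uniformizer .
qed

text \<open>Off the imaginary axis the whole line \<open>A = const\<close> avoids the slit and its tip, so almost every
  trajectory exists for all times.  Hence translations can be integrated with no boundary term.\<close>

lemma flow_eq:
  assumes "Im z > 0" "Re z \<noteq> 0"
  shows "Im (flow t z) > 0" "flow t z \<noteq> 0" "flow t z \<noteq> \<i>"
    and "((\<lambda>t. flow t z) has_vector_derivative vfield (flow t z)) (at t)"
    and "flow 0 z = z"
proof -
  define s where "s = strip_coord z"
  have s: "s \<in> strip" "uniformizer s = z" using strip_coord[of z] assms by (auto simp: s_def)
  then have st: "s + of_real t \<in> strip" for t by (simp add: strip_def)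
  have eq: "flow t z = uniformizer (s + of_real t)" for t
    using flow_uniformizer[of t s] s by simp
  show "Im (flow t z) > 0" "flow t z \<noteq> \<i>" unfolding eq using uniformizer_strip st by blast+
  then show "flow t z \<noteq> 0" by auto
  have "((\<lambda>t. uniformizer (s + of_real t)) has_vector_derivative 1 * vfield (uniformizer (s + of_real t))) (at t)"
    using uniformizer_strip(3)[OF st[of t]]
    by (intro field_vector_diff_chain_at[where f="\<lambda>t. s + of_real t", unfolded o_def])
       (auto intro!: derivative_eq_intros)
  then show "((\<lambda>t. flow t z) has_vector_derivative vfield (flow t z)) (at t)"
    unfolding eq by simp
  show "flow 0 z = z" using s unfolding eq by simp
qed

lemma flow_inj:
  assumes "Im z > 0" "Re z \<noteq> 0" "Im w > 0" "Re w \<noteq> 0" "z \<noteq> w"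
  shows "flow t z \<noteq> flow t w"
proof
  assume "flow t z = flow t w"
  then have "(flow t z)\<^sup>2 = (flow t w)\<^sup>2" by simp
  then have "z\<^sup>2 = w\<^sup>2" by (simp add: flow_def power_mult_distrib)
  then have "z = - w" using assms(5) by (simp add: power2_eq_iff)
  then show False using assms by simp
qed

lemma hmeasure_reflect: "distr hmeasure borel (\<lambda>z. - cnj z) = hmeasure"
proof -
  have eq: "(\<lambda>x. Im x *\<^sub>R \<i> - Re x *\<^sub>R 1) = (\<lambda>z. - cnj z)"
    by (auto simp: complex_eq_iff)
  have "lborel = density (distr lborel borel (\<lambda>z. - cnj z)) (\<lambda>_. 1)"
    using lborel_affine_euclidean[of "\<lambda>j. if j = 1 then - 1 else 1" "0::complex"]
    by (simp add: Basis_complex_def eq)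
  then have L: "distr lborel borel (\<lambda>z. - cnj z) = lborel" by (simp add: density_1)
  have [measurable]: "cnj \<in> borel_measurable borel"
    by (intro borel_measurable_continuous_onI continuous_intros)
  let ?f = "\<lambda>z. ennreal (indicator {z. Im z > 0} z / (cmod (vfield z))\<^sup>2)"
  have "hmeasure = density (distr lborel borel (\<lambda>z. - cnj z)) ?f"
    unfolding L hmeasure_def ..
  also have "\<dots> = distr (density lborel (\<lambda>z. ?f (- cnj z))) borel (\<lambda>z. - cnj z)"
    by (rule density_distr) auto
  also have "(\<lambda>z. ?f (- cnj z)) = ?f"
  proof
    fix z
    have "vfield (- cnj z) = - cnj (vfield z)" by (simp add: vfield_def add_divide_distrib diff_divide_distrib)
    then show "?f (- cnj z) = ?f z" by (simp add: indicator_def)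
  qed
  finally show ?thesis by (simp add: hmeasure_def)
qed

section \<open>Integration by parts in the angular direction\<close>

text \<open>Functions on the slit cylinder that vanish on both sides of the slit, with finitely many possible
  singularities \<open>P\<close>.  The second function is \<open>\<partial>\<^sub>A f\<close>.\<close>

definition dirichlet :: "complex set \<Rightarrow> (complex \<Rightarrow> real) \<Rightarrow> (complex \<Rightarrow> real) \<Rightarrow> bool" where
  "dirichlet P f f' \<longleftrightarrow> finite P \<and> (\<forall>z. Im z = 0 \<longrightarrow> z \<notin> P \<longrightarrow> isCont f z \<and> f z = 0) \<and>
     (\<forall>z. Im z > 0 \<longrightarrow> z \<notin> P \<longrightarrow> (\<exists>D. (f has_derivative D) (at z) \<and> f' z = D (\<i> * vfield z)))"

lemma dirichlet_mult:
  assumes "dirichlet P f f'" "dirichlet Q g g'"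
  shows "dirichlet (P \<union> Q) (\<lambda>z. f z * g z) (\<lambda>z. f' z * g z + f z * g' z)"
  unfolding dirichlet_def
proof (intro conjI allI impI)
  show "finite (P \<union> Q)" using assms by (simp add: dirichlet_def)
next
  fix z assume "Im z = 0" "z \<notin> P \<union> Q"
  then show "isCont (\<lambda>z. f z * g z) z" "f z * g z = 0"
    using assms by (auto simp: dirichlet_def)
next
  fix z assume z: "Im z > 0" "z \<notin> P \<union> Q"
  obtain D where D: "(f has_derivative D) (at z)" "f' z = D (\<i> * vfield z)"
    using assms(1) z unfolding dirichlet_def by blast
  obtain E where E: "(g has_derivative E) (at z)" "g' z = E (\<i> * vfield z)"
    using assms(2) z unfolding dirichlet_def by blast
  show "\<exists>D. ((\<lambda>z. f z * g z) has_derivative D) (at z) \<and> f' z * g z + f z * g' z = D (\<i> * vfield z)"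
    using has_derivative_mult[OF D(1) E(1)] D(2) E(2)
    by (intro exI[of _ "\<lambda>h. f z * E h + D h * g z"]) simp
qed

lemma dirichlet_derivative:
  assumes "dirichlet P f f'" "Im z > 0" "z \<notin> P"
  obtains D where "(f has_derivative D) (at z)" "f' z = D (\<i> * vfield z)"
  using assms unfolding dirichlet_def by blast

text \<open>The boundary point \<open>x\<close> may be approached as \<open>x\<close> or as \<open>-x\<close> from the two sides of the slit.  Since
  \<open>f\<close> vanishes at both, it is continuous across the slit: if \<open>|z - x| |z + x| = |z\<^sup>2 - x\<^sup>2|\<close> is small,
  one of the factors is small.\<close>

lemma isCont_dirichlet_uniformizer_slit:
  assumes f: "dirichlet P f f'" and x: "uniformizer s = x" "Im x = 0" "x \<notin> P" "- x \<notin> P"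
  shows "isCont (\<lambda>s. f (uniformizer s)) s"
proof -
  have cont: "isCont f x" "f x = 0" "isCont f (- x)" "f (- x) = 0"
    using f x unfolding dirichlet_def by auto
  show ?thesis
    unfolding continuous_at_eps_delta
  proof (intro allI impI)
    fix e :: real assume e: "e > 0"
    obtain d1 where d1: "d1 > 0" "\<And>z. dist z x < d1 \<Longrightarrow> dist (f z) 0 < e"
      using cont(1,2) e unfolding continuous_at_eps_delta by metis
    obtain d2 where d2: "d2 > 0" "\<And>z. dist z (- x) < d2 \<Longrightarrow> dist (f z) 0 < e"
      using cont(3,4) e unfolding continuous_at_eps_delta by metis
    have "isCont exp s" by simp
    moreover have "d1 * d2 > 0" using d1 d2 by simp
    ultimately obtain d where d: "d > 0" "\<And>t. dist t s < d \<Longrightarrow> dist (exp t) (exp s) < d1 * d2"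
      unfolding continuous_at_eps_delta by metis
    have "dist (f (uniformizer t)) (f (uniformizer s)) < e" if "dist t s < d" for t
    proof -
      define z where "z = uniformizer t"
      have "(z - x) * (z + x) = z\<^sup>2 - x\<^sup>2" by (simp add: power2_eq_square algebra_simps)
      also have "\<dots> = exp t - exp s"
        using uniformizer_squared[of t] uniformizer_squared[of s] x by (simp add: z_def)
      finally have "dist z x * dist z (- x) = dist (exp t) (exp s)"
        by (simp add: dist_norm flip: norm_mult)
      then have "dist z x * dist z (- x) < d1 * d2" using d(2)[OF that] by simp
      then have "dist z x < d1 \<or> dist z (- x) < d2"
        using d1(1) d2(1) by (meson mult_mono' not_less order_less_imp_le)
      then have "dist (f z) 0 < e" using d1 d2 by blast
      then show ?thesis using cont x by (simp add: z_def)
    qed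
    then show "\<exists>d>0. \<forall>t. dist t s < d \<longrightarrow> dist (f (uniformizer t)) (f (uniformizer s)) < e"
      using d(1) by blast
  qed
qed

text \<open>The circle \<open>B = const\<close> closes up, so the integral of a derivative along it vanishes.  For \<open>B > 0\<close> the
  boundary values on the slit are zero, for \<open>B < 0\<close> the circle does not meet the slit.\<close>

lemma has_integral_dirichlet_line:
  assumes f: "dirichlet P f f'"
    and P: "\<And>z. z \<in> insert 0 (P \<union> uminus ` P) \<Longrightarrow> exp B \<noteq> cmod (1 + z\<^sup>2)"
  shows "((\<lambda>A. f' (uniformizer (Complex B A))) has_integral 0) {0..2 * pi}"
proof -
  define u where "u A = f (uniformizer (Complex B A))" for A
  have notP: "uniformizer (Complex B A) \<notin> insert 0 (P \<union> uminus ` P)" for A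
  proof
    assume "uniformizer (Complex B A) \<in> insert 0 (P \<union> uminus ` P)"
    from P[OF this] have "exp B \<noteq> cmod (exp (Complex B A))"
      unfolding uniformizer_squared by simp
    then show False by simp
  qed
  have der: "(u has_vector_derivative f' (uniformizer (Complex B A))) (at A)" if "A \<in> {0<..<2*pi}" for A
  proof -
    define s where "s = Complex B A"
    have s: "s \<in> strip" using that by (simp add: s_def strip_def)
    obtain D where D: "(f has_derivative D) (at (uniformizer s))"
        "f' (uniformizer s) = D (\<i> * vfield (uniformizer s))"
      using dirichlet_derivative[OF f uniformizer_strip(1)[OF s]] notP[of A] by (auto simp only: s_def insert_iff Un_iff)
    have "((\<lambda>A. uniformizer (Complex B A)) has_vector_derivative \<i> * vfield (uniformizer s)) (at A)"
    proof -
      have "((\<lambda>A. Complex B A) has_vector_derivative \<i>) (at A)"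
        unfolding Complex_eq by (auto intro!: derivative_eq_intros)
      then show ?thesis
        using field_vector_diff_chain_at[of "\<lambda>A. Complex B A" \<i> A uniformizer] uniformizer_strip(3)[OF s]
        by (simp add: o_def s_def)
    qed
    then have "(u has_derivative (\<lambda>h. D (h *\<^sub>R (\<i> * vfield (uniformizer s))))) (at A)"
      using D(1) unfolding has_vector_derivative_def u_def s_def by (rule has_derivative_compose)
    then show ?thesis
      using D(2) has_derivative_bounded_linear[OF D(1)]
      by (simp add: has_vector_derivative_def s_def linear_simps(5))
  qed
  have "continuous_on {0..2*pi} u"
  proof (intro continuous_at_imp_continuous_on ballI)
    fix A assume A: "A \<in> {0..2 * pi}"
    have cC: "isCont (\<lambda>A. Complex B A) A"
      unfolding Complex_eq by (intro continuous_intros)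
    show "isCont u A"
    proof (cases "A \<in> {0<..<2*pi}")
      case True
      then show ?thesis using der has_vector_derivative_continuous by blast
    next
      case False
      then have "A = 0 \<or> A = 2 * pi" using A by auto
      then have e: "exp (Complex B A) = of_real (exp B)"
        by (auto simp: complex_eq_iff Re_exp Im_exp)
      define x where "x = uniformizer (Complex B A)"
      have nP: "x \<notin> P" "- x \<notin> P"
        using notP[of A] unfolding x_def by force+
      show ?thesis
      proof (cases "B > 0")
        case True
        have "Im x = 0"
          using True by (simp add: x_def uniformizer_def e)
        then have "isCont (\<lambda>s. f (uniformizer s)) (Complex B A)"
          using nP by (intro isCont_dirichlet_uniformizer_slit[OF f]) (simp_all add: x_def)
        then show ?thesis unfolding u_def using cC by (rule isCont_o2[rotated])
      next
        case False
        have "B \<noteq> 0" using P[of 0] by auto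
        then have "B < 0" using False by simp
        then have n: "1 - exp (Complex B A) \<notin> \<real>\<^sub>\<le>\<^sub>0"
          by (simp add: e complex_nonpos_Reals_iff)
        then have "isCont uniformizer (Complex B A)"
          unfolding uniformizer_def
          by (intro continuous_mult continuous_const isCont_o2[OF _ continuous_at_csqrt]) (auto intro!: continuous_intros)
        moreover have "Im x > 0"
          using \<open>B < 0\<close> by (simp add: x_def uniformizer_def e)
        then have "isCont f x"
          using dirichlet_derivative[OF f _ nP(1)] has_derivative_continuous by metis
        ultimately have "isCont (\<lambda>s. f (uniformizer s)) (Complex B A)"
          unfolding x_def by (rule isCont_o2)
        then show ?thesis unfolding u_def using cC by (rule isCont_o2[rotated])
      qed
    qed
  qed
  then have "((\<lambda>A. f' (uniformizer (Complex B A))) has_integral u (2*pi) - u 0) {0..2 * pi}"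
    using der by (intro fundamental_theorem_of_calculus_interior) auto
  moreover have "exp (Complex B (2 * pi)) = exp (Complex B 0)"
    by (simp add: complex_eq_iff Re_exp Im_exp)
  then have "u (2 * pi) = u 0" by (simp add: u_def uniformizer_def)
  ultimately show ?thesis by simp
qed

text \<open>Almost every circle \<open>B = const\<close> avoids the singularities, in particular the tip, so
  Fubini reduces the claim to a single circle.\<close>

lemma integral_dirichlet_derivative:
  assumes f: "dirichlet P f f'" and int: "integrable hmeasure f'"
  shows "(LINT z|hmeasure. f' z) = 0"
proof -
  have f'm [measurable]: "f' \<in> borel_measurable borel"
    using borel_measurable_integrable[OF int] by (simp add: hmeasure_def)
  define F where "F = (\<lambda>(B, A). indicator {0<..<2*pi} A * f' (uniformizer (Complex B A)))"
  have mC [measurable]: "(\<lambda>(x, y). Complex x y) \<in> borel_measurable (borel \<Otimes>\<^sub>M borel)"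
    by (auto intro!: borel_measurable_continuous_onI continuous_intros simp: borel_prod split_beta)
  have F_eq: "F = (\<lambda>x. (\<lambda>s. indicator strip s *\<^sub>R f' (uniformizer s)) ((\<lambda>(x, y). Complex x y) x))"
    by (auto simp: F_def fun_eq_iff indicator_def strip_def)
  have "integrable (density lborel (indicator strip)) (\<lambda>s. f' (uniformizer s))"
    using int unfolding distr_uniformizer[symmetric] by (subst (asm) integrable_distr_eq) auto
  then have int1: "integrable lborel (\<lambda>s. indicator strip s *\<^sub>R f' (uniformizer s))"
    by (subst (asm) integrable_density[where g = "indicator strip" and M = lborel, unfolded ennreal_indicator]) auto
  then have intF: "integrable (lborel \<Otimes>\<^sub>M lborel) F"
    unfolding F_eq distr_Complex[symmetric] by (subst (asm) integrable_distr_eq) auto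
  have "(LINT z|hmeasure. f' z) = (LINT s|lborel. indicator strip s *\<^sub>R f' (uniformizer s))"
    unfolding distr_uniformizer[symmetric]
    using integral_density[where g = "indicator strip" and M = lborel and f = "\<lambda>s. f' (uniformizer s)", unfolded ennreal_indicator]
    by (subst integral_distr) auto
  also have "\<dots> = integral\<^sup>L (lborel \<Otimes>\<^sub>M lborel) F"
    unfolding F_eq distr_Complex[symmetric] by (subst integral_distr) auto
  also have "\<dots> = (LINT B|lborel. LINT A|lborel. F (B, A))"
    using lborel_pair.integral_fst'[OF intF] by simp
  finally have eq: "(LINT z|hmeasure. f' z) = (LINT B|lborel. LINT A|lborel. F (B, A))" .
  have "AE B in lborel. (LINT A|lborel. F (B, A)) = 0"
  proof -
    have "finite P" using f by (simp add: dirichlet_def)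
    then have fin: "finite ((\<lambda>z. ln (cmod (1 + z\<^sup>2))) ` insert 0 (P \<union> uminus ` P))"
      by (intro finite_imageI finite.insertI finite_UnI) simp_all
    then have "AE B in lborel. B \<notin> (\<lambda>z. ln (cmod (1 + z\<^sup>2))) ` insert 0 (P \<union> uminus ` P)"
      by (intro AE_lborel_not_in_negligible negligible_finite finite_imp_closed[THEN borel_closed])
    moreover have "AE B in lborel. integrable lborel (\<lambda>A. F (B, A))"
      using lborel_pair.AE_integrable_fst'[OF intF] by simp
    ultimately show ?thesis
    proof eventually_elim
      case (elim B)
      have "((\<lambda>A. f' (uniformizer (Complex B A))) has_integral 0) {0..2 * pi}"
      proof (rule has_integral_dirichlet_line[OF f])
        fix z assume "z \<in> insert 0 (P \<union> uminus ` P)"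
        then have "B \<noteq> ln (cmod (1 + z\<^sup>2))" using elim(1) by blast
        then show "exp B \<noteq> cmod (1 + z\<^sup>2)" using ln_exp by metis
      qed
      then have "((\<lambda>A. f' (uniformizer (Complex B A))) has_integral 0) {0<..<2 * pi}"
        by (simp add: has_integral_interior[where S="cbox 0 (2*pi)", simplified] has_integral_Icc_iff_Ioo)
      then have "((\<lambda>A. F (B, A)) has_integral 0) UNIV"
        by (subst (asm) has_integral_restrict_UNIV[symmetric])
           (auto simp: F_def indicator_def intro: has_integral_eq_rhs elim!: has_integral_eq[rotated])
      then show ?case
        using has_integral_integral_lborel[OF elim(2)] has_integral_unique by blast
    qed
  qed
  then have "(LINT B|lborel. LINT A|lborel. F (B, A)) = 0" by (rule integral_eq_zero_AE)
  then show ?thesis using eq by simp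
qed

section \<open>Product measures and chains of kernels\<close>

lemma distr_PiM_reindex_bij:
  assumes "sigma_finite_measure M" "finite I" "bij_betw \<pi> I J"
  shows "distr (PiM J (\<lambda>_. M)) (PiM I (\<lambda>_. M)) (\<lambda>x. \<lambda>i\<in>I. x (\<pi> i)) = PiM I (\<lambda>_. M)"
proof -
  interpret product_sigma_finite "\<lambda>_. M" using assms(1) by (simp add: product_sigma_finite_def)
  have J: "finite J" "J = \<pi> ` I" "inj_on \<pi> I"
    using assms(2,3) by (auto simp: bij_betw_def)
  have meas: "(\<lambda>x. \<lambda>i\<in>I. x (\<pi> i)) \<in> PiM J (\<lambda>_. M) \<rightarrow>\<^sub>M PiM I (\<lambda>_. M)"
    using J by (intro measurable_restrict measurable_component_singleton) auto
  show ?thesis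
  proof (rule PiM_eqI)
    fix A assume A: "\<And>i. i \<in> I \<Longrightarrow> A i \<in> sets M"
    define A' where "A' = (\<lambda>j. A (the_inv_into I \<pi> j))"
    have A'\<pi>: "A' (\<pi> i) = A i" if "i \<in> I" for i
      using that J(3) by (simp add: A'_def the_inv_into_f_f)
    have eq: "(\<lambda>x. \<lambda>i\<in>I. x (\<pi> i)) -` Pi\<^sub>E I A \<inter> space (PiM J (\<lambda>_. M)) = Pi\<^sub>E J A'"
    proof (intro equalityI subsetI)
      fix x assume "x \<in> Pi\<^sub>E J A'"
      then show "x \<in> (\<lambda>x. \<lambda>i\<in>I. x (\<pi> i)) -` Pi\<^sub>E I A \<inter> space (PiM J (\<lambda>_. M))"
        using A sets.sets_into_space A'\<pi> by (fastforce simp: J(2) space_PiM PiE_iff)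
    qed (auto simp: J(2) space_PiM PiE_iff A'\<pi>)
    have "emeasure (distr (PiM J (\<lambda>_. M)) (PiM I (\<lambda>_. M)) (\<lambda>x. \<lambda>i\<in>I. x (\<pi> i))) (Pi\<^sub>E I A)
        = emeasure (PiM J (\<lambda>_. M)) (Pi\<^sub>E J A')"
      using A assms(2) meas by (subst emeasure_distr) (auto simp: eq intro!: sets_PiM_I_finite)
    also have "\<dots> = (\<Prod>j\<in>J. emeasure M (A' j))"
      using A J A'\<pi> by (subst emeasure_PiM) auto
    also have "\<dots> = (\<Prod>i\<in>I. emeasure M (A i))"
      unfolding J(2) by (subst prod.reindex[OF J(3)]) (simp add: A'\<pi>)
    finally show "emeasure (distr (PiM J (\<lambda>_. M)) (PiM I (\<lambda>_. M)) (\<lambda>x. \<lambda>i\<in>I. x (\<pi> i))) (Pi\<^sub>E I A)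
        = (\<Prod>i\<in>I. emeasure M (A i))" .
  qed (use assms in auto)
qed

lemma distr_PiM_componentwise:
  assumes "sigma_finite_measure M" "finite I" and T: "T \<in> M \<rightarrow>\<^sub>M M" "distr M M T = M"
  shows "distr (PiM I (\<lambda>_. M)) (PiM I (\<lambda>_. M)) (\<lambda>x. \<lambda>i\<in>I. T (x i)) = PiM I (\<lambda>_. M)"
proof -
  interpret product_sigma_finite "\<lambda>_. M" using assms(1) by (simp add: product_sigma_finite_def)
  have meas: "(\<lambda>x. \<lambda>i\<in>I. T (x i)) \<in> PiM I (\<lambda>_. M) \<rightarrow>\<^sub>M PiM I (\<lambda>_. M)"
    using T(1) by measurable
  show ?thesis
  proof (rule PiM_eqI)
    fix A assume A: "\<And>i. i \<in> I \<Longrightarrow> A i \<in> sets M"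
    have eq: "(\<lambda>x. \<lambda>i\<in>I. T (x i)) -` Pi\<^sub>E I A \<inter> space (PiM I (\<lambda>_. M)) = Pi\<^sub>E I (\<lambda>i. T -` A i \<inter> space M)"
      by (auto simp: space_PiM PiE_iff)
    have "emeasure (distr (PiM I (\<lambda>_. M)) (PiM I (\<lambda>_. M)) (\<lambda>x. \<lambda>i\<in>I. T (x i))) (Pi\<^sub>E I A)
        = emeasure (PiM I (\<lambda>_. M)) (Pi\<^sub>E I (\<lambda>i. T -` A i \<inter> space M))"
      using A assms(2) meas by (subst emeasure_distr) (auto simp: eq intro!: sets_PiM_I_finite)
    also have "\<dots> = (\<Prod>i\<in>I. emeasure M (T -` A i \<inter> space M))"
      using A T assms(2) by (subst emeasure_PiM) auto
    also have "\<dots> = (\<Prod>i\<in>I. emeasure M (A i))"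
    proof (intro prod.cong refl)
      fix i assume "i \<in> I"
      then show "emeasure M (T -` A i \<inter> space M) = emeasure M (A i)"
        using emeasure_distr[OF T(1), of "A i"] A T(2) by simp
    qed
    finally show "emeasure (distr (PiM I (\<lambda>_. M)) (PiM I (\<lambda>_. M)) (\<lambda>x. \<lambda>i\<in>I. T (x i))) (Pi\<^sub>E I A)
        = (\<Prod>i\<in>I. emeasure M (A i))" .
  qed (use assms in auto)
qed

lemma PiM_density:
  assumes M: "sigma_finite_measure M" "sigma_finite_measure (density M f)" and "finite I"
    and f: "f \<in> borel_measurable M"
  shows "PiM I (\<lambda>_. density M f) = density (PiM I (\<lambda>_. M)) (\<lambda>x. \<Prod>i\<in>I. f (x i))"
proof -
  interpret M: product_sigma_finite "\<lambda>_. M" using M by (simp add: product_sigma_finite_def)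
  interpret D: product_sigma_finite "\<lambda>_. density M f" using M by (simp add: product_sigma_finite_def)
  have fi: "(\<lambda>x. f (x i)) \<in> borel_measurable (PiM I (\<lambda>_. M))" if "i \<in> I" for i
    using measurable_compose[OF measurable_component_singleton[OF that] f] .
  have "density (PiM I (\<lambda>_. M)) (\<lambda>x. \<Prod>i\<in>I. f (x i)) = PiM I (\<lambda>_. density M f)"
  proof (rule D.PiM_eqI)
    fix A assume A: "\<And>i. i \<in> I \<Longrightarrow> A i \<in> sets (density M f)"
    then have A': "\<And>i. i \<in> I \<Longrightarrow> A i \<in> sets M" by simp
    have "emeasure (density (PiM I (\<lambda>_. M)) (\<lambda>x. \<Prod>i\<in>I. f (x i))) (Pi\<^sub>E I A)
        = (\<integral>\<^sup>+x. (\<Prod>i\<in>I. f (x i)) * indicator (Pi\<^sub>E I A) x \<partial>PiM I (\<lambda>_. M))"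
      using A' fi assms(3) by (subst emeasure_density) (auto intro!: sets_PiM_I_finite borel_measurable_prod_ennreal)
    also have "\<dots> = (\<integral>\<^sup>+x. (\<Prod>i\<in>I. f (x i) * indicator (A i) (x i)) \<partial>PiM I (\<lambda>_. M))"
    proof (rule nn_integral_cong)
      fix x assume x: "x \<in> space (PiM I (\<lambda>_. M))"
      show "(\<Prod>i\<in>I. f (x i)) * indicator (Pi\<^sub>E I A) x = (\<Prod>i\<in>I. f (x i) * indicator (A i) (x i))"
      proof (cases "x \<in> Pi\<^sub>E I A")
        case True
        then show ?thesis by (auto simp: PiE_iff intro!: prod.cong)
      next
        case False
        then obtain i where "i \<in> I" "x i \<notin> A i" using x by (auto simp: space_PiM PiE_iff)
        then have "(\<Prod>i\<in>I. f (x i) * indicator (A i) (x i)) = 0"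
          using assms(3) by (intro prod_zero bexI[of _ i]) auto
        then show ?thesis using False by simp
      qed
    qed
    also have "\<dots> = (\<Prod>i\<in>I. \<integral>\<^sup>+y. f y * indicator (A i) y \<partial>M)"
      using A' f assms(3) by (subst M.product_nn_integral_prod) auto
    also have "\<dots> = (\<Prod>i\<in>I. emeasure (density M f) (A i))"
      using A' f by (intro prod.cong refl) (simp add: emeasure_density)
    finally show "emeasure (density (PiM I (\<lambda>_. M)) (\<lambda>x. \<Prod>i\<in>I. f (x i))) (Pi\<^sub>E I A)
        = (\<Prod>i\<in>I. emeasure (density M f) (A i))" .
  qed (use assms in \<open>auto intro!: sets_PiM_cong\<close>)
  then show ?thesis ..
qed

lemma AE_PiM_coordinate:
  assumes M: "sigma_finite_measure M" and "finite I" "i \<in> I" and P: "AE y in M. P y"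
  shows "AE x in PiM I (\<lambda>_. M). P (x i)"
proof -
  interpret product_sigma_finite "\<lambda>_. M" using M by (simp add: product_sigma_finite_def)
  obtain N where N: "{y \<in> space M. \<not> P y} \<subseteq> N" "N \<in> sets M" "emeasure M N = 0"
    using P by (rule AE_E)
  define A where "A j = (if j = i then N else space M)" for j
  show ?thesis
  proof (rule AE_I)
    show "{x \<in> space (PiM I (\<lambda>_. M)). \<not> P (x i)} \<subseteq> Pi\<^sub>E I A"
      using N(1) assms(3) by (auto simp: space_PiM PiE_iff A_def extensional_def)
    show "Pi\<^sub>E I A \<in> sets (PiM I (\<lambda>_. M))"
      using N assms by (intro sets_PiM_I_finite) (auto simp: A_def)
    have "(\<Prod>j\<in>I. emeasure M (A j)) = 0"
      using N(3) assms(2,3) by (intro prod_zero bexI[of _ i]) (auto simp: A_def)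
    then show "emeasure (PiM I (\<lambda>_. M)) (Pi\<^sub>E I A) = 0"
      using N(2) assms(2) by (subst emeasure_PiM) (auto simp: A_def)
  qed
qed

lemma AE_PiM_distinct:
  fixes M :: "'a::{second_countable_topology, t2_space} measure"
  assumes M: "sigma_finite_measure M" "sets M = sets borel" and "finite I" "i \<in> I" "j \<in> I" "i \<noteq> j"
    and P: "\<And>c. AE y in M. y \<noteq> c"
  shows "AE x in PiM I (\<lambda>_. M). x i \<noteq> x j"
proof -
  interpret product_sigma_finite "\<lambda>_. M" using M by (simp add: product_sigma_finite_def)
  define I' where "I' = I - {i}"
  have I: "I = insert i I'" "finite I'" "i \<notin> I'" "j \<in> I'" using assms by (auto simp: I'_def)
  note M(2)[measurable_cong]
  have [measurable]: "(\<lambda>x. x i) \<in> borel_measurable (PiM (insert i I') (\<lambda>_. M))"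
      "(\<lambda>x. x j) \<in> borel_measurable (PiM (insert i I') (\<lambda>_. M))"
    using I measurable_component_singleton[of _ "insert i I'" "\<lambda>_. M"] measurable_cong_sets[OF refl M(2)] by auto
  let ?D = "{x \<in> space (PiM (insert i I') (\<lambda>_. M)). x i = x j}"
  have D: "?D \<in> sets (PiM (insert i I') (\<lambda>_. M))" by measurable
  have "emeasure (PiM (insert i I') (\<lambda>_. M)) ?D = (\<integral>\<^sup>+x. indicator ?D x \<partial>PiM (insert i I') (\<lambda>_. M))"
    using D by simp
  also have "\<dots> = (\<integral>\<^sup>+x. \<integral>\<^sup>+y. indicator ?D (x(i := y)) \<partial>M \<partial>PiM I' (\<lambda>_. M))"
    using I D by (intro product_nn_integral_insert) auto
  also have "\<dots> = (\<integral>\<^sup>+x. 0 \<partial>PiM I' (\<lambda>_. M))"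
  proof (rule nn_integral_cong)
    fix x
    have "AE y in M. indicator ?D (x(i := y)) = (0::ennreal)"
      using P[of "x j"] by (rule eventually_mono) (use assms(6) in \<open>auto simp: indicator_def\<close>)
    then show "(\<integral>\<^sup>+y. indicator ?D (x(i := y)) \<partial>M) = 0"
      by (subst nn_integral_cong_AE[where v = "\<lambda>_. 0"]) auto
  qed
  finally have "emeasure (PiM I (\<lambda>_. M)) ?D = 0" using I by simp
  then show ?thesis using D I by (intro AE_I[where N = ?D]) auto
qed

definition kernel_op :: "'a measure \<Rightarrow> ('a \<Rightarrow> 'a \<Rightarrow> real) \<Rightarrow> ('a \<Rightarrow> real) \<Rightarrow> 'a \<Rightarrow> real" where
  "kernel_op M k b p = (LINT q|M. k p q * b q)"

text \<open>\<open>k\<^sub>0 (k\<^sub>1 (\<dots> (k\<^sub>m\<^sub>-\<^sub>1 b)))\<close> for a sequence of integral operators.\<close>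

primrec kernel_iter :: "'a measure \<Rightarrow> (nat \<Rightarrow> 'a \<Rightarrow> 'a \<Rightarrow> real) \<Rightarrow> nat \<Rightarrow> ('a \<Rightarrow> real) \<Rightarrow> 'a \<Rightarrow> real" where
  "kernel_iter M k 0 b = b"
| "kernel_iter M k (Suc m) b = kernel_iter M k m (kernel_op M (k m) b)"

definition chain :: "('a \<Rightarrow> real) \<Rightarrow> (nat \<Rightarrow> 'a \<Rightarrow> 'a \<Rightarrow> real) \<Rightarrow> nat \<Rightarrow> ('a \<Rightarrow> real) \<Rightarrow> (nat \<Rightarrow> 'a) \<Rightarrow> real" where
  "chain a k m b x = a (x 0) * (\<Prod>j<m. k j (x j) (x (Suc j))) * b (x m)"

lemma measurable_pair_component:
  assumes "case_prod k \<in> borel_measurable (M \<Otimes>\<^sub>M M)" "i \<in> I" "j \<in> I"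
  shows "(\<lambda>x. k (x i) (x j)) \<in> borel_measurable (PiM I (\<lambda>_. M))"
proof -
  have "(\<lambda>x. (x i, x j)) \<in> PiM I (\<lambda>_. M) \<rightarrow>\<^sub>M M \<Otimes>\<^sub>M M"
    using assms(2,3) by measurable
  from measurable_compose[OF this assms(1)] show ?thesis by simp
qed

lemma measurable_chain:
  assumes "a \<in> borel_measurable M" "b \<in> borel_measurable M"
    and "\<And>j. j < m \<Longrightarrow> case_prod (k j) \<in> borel_measurable (M \<Otimes>\<^sub>M M)"
  shows "chain a k m b \<in> borel_measurable (PiM {..m} (\<lambda>_. M))"
  unfolding chain_def
  using assms by (intro borel_measurable_times borel_measurable_prod measurable_pair_component
     measurable_compose[OF measurable_component_singleton]) auto

text \<open>Schur's test along a chain: each kernel takes a multiple of the next weight to the previous one.\<close>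

lemma nn_integral_chain_le:
  fixes a :: "'a \<Rightarrow> ennreal"
  assumes M: "sigma_finite_measure M"
    and a [measurable]: "a \<in> borel_measurable M" and b: "b \<in> borel_measurable M"
    and k: "\<And>j. j < m \<Longrightarrow> case_prod (k j) \<in> borel_measurable (M \<Otimes>\<^sub>M M)"
    and kw: "\<And>j. j < m \<Longrightarrow> AE p in M. (\<integral>\<^sup>+q. k j p q * w (Suc j) q \<partial>M) \<le> w j p"
    and bw: "AE q in M. b q \<le> w m q"
  shows "(\<integral>\<^sup>+x. a (x 0) * (\<Prod>j<m. k j (x j) (x (Suc j))) * b (x m) \<partial>PiM {..m} (\<lambda>_. M)) \<le> (\<integral>\<^sup>+p. a p * w 0 p \<partial>M)"
  using b k kw bw
proof (induction m arbitrary: b)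
  case 0
  interpret product_sigma_finite "\<lambda>_. M" using M by (simp add: product_sigma_finite_def)
  have "(\<integral>\<^sup>+x. a (x 0) * b (x 0) \<partial>PiM {0::nat} (\<lambda>_. M)) = (\<integral>\<^sup>+p. a p * b p \<partial>M)"
    using 0 product_nn_integral_singleton[of "\<lambda>p. a p * b p" "0::nat"] by simp
  also have "\<dots> \<le> (\<integral>\<^sup>+p. a p * w 0 p \<partial>M)"
    using 0(4) by (intro nn_integral_mono_AE) (auto elim!: eventually_mono intro!: mult_left_mono)
  finally show ?case by (simp add: atMost_0)
next
  case (Suc m)
  interpret product_sigma_finite "\<lambda>_. M" using M by (simp add: product_sigma_finite_def)
  interpret M: sigma_finite_measure M by fact
  note [measurable] = Suc.prems(1) Suc.prems(2)[of m, simplified]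
  let ?b = "\<lambda>p. \<integral>\<^sup>+q. k m p q * b q \<partial>M"
  have at: "{..Suc m} = insert (Suc m) {..m}" by auto
  have [measurable]: "?b \<in> borel_measurable M" by measurable
  have meas: "(\<lambda>x. a (x 0) * (\<Prod>j<Suc m. k j (x j) (x (Suc j))) * b (x (Suc m))) \<in> borel_measurable (PiM (insert (Suc m) {..m}) (\<lambda>_. M))"
    using Suc.prems by (intro borel_measurable_times_ennreal borel_measurable_prod_ennreal measurable_pair_component
       measurable_compose[OF measurable_component_singleton]) auto
  have "(\<integral>\<^sup>+x. a (x 0) * (\<Prod>j<Suc m. k j (x j) (x (Suc j))) * b (x (Suc m)) \<partial>PiM {..Suc m} (\<lambda>_. M))
     = (\<integral>\<^sup>+x. \<integral>\<^sup>+y. a (x 0) * (\<Prod>j<m. k j (x j) (x (Suc j))) * (k m (x m) y * b y) \<partial>M \<partial>PiM {..m} (\<lambda>_. M))"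
    unfolding at using meas by (subst product_nn_integral_insert) (auto simp: mult.assoc)
  also have "\<dots> = (\<integral>\<^sup>+x. a (x 0) * (\<Prod>j<m. k j (x j) (x (Suc j))) * ?b (x m) \<partial>PiM {..m} (\<lambda>_. M))"
  proof (intro nn_integral_cong nn_integral_cmult)
    fix x assume "x \<in> space (PiM {..m} (\<lambda>_. M))"
    then have "x m \<in> space M" by (auto simp: space_PiM)
    then have [measurable]: "k m (x m) \<in> borel_measurable M"
      using measurable_Pair2[OF Suc.prems(2)[of m]] by simp
    show "(\<lambda>y. k m (x m) y * b y) \<in> borel_measurable M" by measurable
  qed
  also have "\<dots> \<le> (\<integral>\<^sup>+p. a p * w 0 p \<partial>M)"
  proof (rule Suc.IH)
    show "AE q in M. ?b q \<le> w m q"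
      using Suc.prems(3)[of m, simplified]
    proof eventually_elim
      case (elim p)
      have "?b p \<le> (\<integral>\<^sup>+q. k m p q * w (Suc m) q \<partial>M)"
        using Suc.prems(4) by (intro nn_integral_mono_AE) (auto elim!: eventually_mono intro!: mult_left_mono)
      then show ?case using elim by (rule order_trans)
    qed
  qed (use Suc.prems in auto)
  finally show ?case .
qed

lemma abs_kernel_op_le: "ennreal \<bar>kernel_op M k b p\<bar> \<le> (\<integral>\<^sup>+q. ennreal \<bar>k p q\<bar> * ennreal \<bar>b q\<bar> \<partial>M)"
  unfolding kernel_op_def using integral_norm_bound_ennreal[of M "\<lambda>q. k p q * b q"]
  by (cases "integrable M (\<lambda>q. k p q * b q)") (auto simp: abs_mult ennreal_mult' not_integrable_integral_eq)

lemma measurable_kernel_op [measurable]: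
  assumes "sigma_finite_measure M" "case_prod k \<in> borel_measurable (M \<Otimes>\<^sub>M M)" "b \<in> borel_measurable M"
  shows "kernel_op M k b \<in> borel_measurable M"
proof -
  interpret sigma_finite_measure M by fact
  note assms(2,3)[measurable]
  show ?thesis unfolding kernel_op_def[abs_def] by measurable
qed

text \<open>Integrating out the last variable replaces \<open>b\<close> by the image of \<open>b\<close> under the last operator.  The
  weights, which may be infinite somewhere, only serve to justify Fubini's theorem.\<close>

lemma integral_chain:
  fixes a b :: "'a \<Rightarrow> real"
  assumes M: "sigma_finite_measure M"
    and a [measurable]: "a \<in> borel_measurable M" and b: "b \<in> borel_measurable M"
    and k: "\<And>j. j < m \<Longrightarrow> case_prod (k j) \<in> borel_measurable (M \<Otimes>\<^sub>M M)"
    and kw: "\<And>j. j < m \<Longrightarrow> AE p in M. (\<integral>\<^sup>+q. ennreal \<bar>k j p q\<bar> * w (Suc j) q \<partial>M) \<le> w j p"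
    and bw: "AE q in M. ennreal \<bar>b q\<bar> \<le> w m q"
    and aw: "(\<integral>\<^sup>+p. ennreal \<bar>a p\<bar> * w 0 p \<partial>M) < \<infinity>"
  shows "integrable (PiM {..m} (\<lambda>_. M)) (chain a k m b) \<and>
    integral\<^sup>L (PiM {..m} (\<lambda>_. M)) (chain a k m b) = (LINT p|M. a p * kernel_iter M k m b p)"
  using b k kw bw
proof (induction m arbitrary: b)
  case 0
  interpret product_sigma_finite "\<lambda>_. M" using M by (simp add: product_sigma_finite_def)
  note [measurable] = 0(1)
  have "integrable (PiM {..0} (\<lambda>_. M)) (chain a k 0 b)"
  proof (rule integrableI_bounded)
    have "(\<integral>\<^sup>+x. ennreal (norm (chain a k 0 b x)) \<partial>PiM {..0} (\<lambda>_. M))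
       = (\<integral>\<^sup>+x. ennreal \<bar>a (x 0)\<bar> * (\<Prod>j<0. ennreal \<bar>k j (x j) (x (Suc j))\<bar>) * ennreal \<bar>b (x 0)\<bar> \<partial>PiM {..0} (\<lambda>_. M))"
      by (simp add: chain_def abs_mult ennreal_mult')
    also have "\<dots> \<le> (\<integral>\<^sup>+p. ennreal \<bar>a p\<bar> * w 0 p \<partial>M)"
      using 0 M by (intro nn_integral_chain_le[where k = "\<lambda>j p q. ennreal \<bar>k j p q\<bar>"]) auto
    finally show "(\<integral>\<^sup>+x. ennreal (norm (chain a k 0 b x)) \<partial>PiM {..0} (\<lambda>_. M)) < \<infinity>"
      using aw by (rule order.strict_trans1)
  qed (rule measurable_chain; use 0 in auto)
  moreover have "integral\<^sup>L (PiM {..0} (\<lambda>_. M)) (chain a k 0 b) = (LINT p|M. a p * b p)"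
    using product_integral_singleton[of "\<lambda>p. a p * b p" "0::nat"] by (simp add: atMost_0 chain_def[abs_def])
  ultimately show ?case by simp
next
  case (Suc m)
  interpret product_sigma_finite "\<lambda>_. M" using M by (simp add: product_sigma_finite_def)
  interpret M: sigma_finite_measure M by fact
  note [measurable] = Suc.prems(1) Suc.prems(2)[of m, simplified]
  have at: "{..Suc m} = insert (Suc m) {..m}" by auto
  have int: "integrable (PiM {..Suc m} (\<lambda>_. M)) (chain a k (Suc m) b)"
  proof (rule integrableI_bounded)
    have "(\<integral>\<^sup>+x. ennreal (norm (chain a k (Suc m) b x)) \<partial>PiM {..Suc m} (\<lambda>_. M))
       = (\<integral>\<^sup>+x. ennreal \<bar>a (x 0)\<bar> * (\<Prod>j<Suc m. ennreal \<bar>k j (x j) (x (Suc j))\<bar>) * ennreal \<bar>b (x (Suc m))\<bar> \<partial>PiM {..Suc m} (\<lambda>_. M))"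
      by (simp add: chain_def abs_mult ennreal_mult' abs_prod prod_ennreal prod_nonneg del: prod.lessThan_Suc)
    also have "\<dots> \<le> (\<integral>\<^sup>+p. ennreal \<bar>a p\<bar> * w 0 p \<partial>M)"
    proof (rule nn_integral_chain_le[where k = "\<lambda>j p q. ennreal \<bar>k j p q\<bar>"])
      fix j assume "j < Suc m"
      then have [measurable]: "case_prod (k j) \<in> borel_measurable (M \<Otimes>\<^sub>M M)" by (rule Suc.prems)
      have "(\<lambda>x. ennreal \<bar>case_prod (k j) x\<bar>) \<in> borel_measurable (M \<Otimes>\<^sub>M M)" by measurable
      then show "case_prod (\<lambda>p q. ennreal \<bar>k j p q\<bar>) \<in> borel_measurable (M \<Otimes>\<^sub>M M)" by (simp add: split_beta')
    qed (use Suc.prems M in auto)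
    finally show "(\<integral>\<^sup>+x. ennreal (norm (chain a k (Suc m) b x)) \<partial>PiM {..Suc m} (\<lambda>_. M)) < \<infinity>"
      using aw by (rule order.strict_trans1)
  qed (rule measurable_chain; use Suc.prems in auto)
  have "integral\<^sup>L (PiM {..Suc m} (\<lambda>_. M)) (chain a k (Suc m) b)
     = (LINT x|PiM {..m} (\<lambda>_. M). LINT y|M. chain a k (Suc m) b (x(Suc m := y)))"
    using int unfolding at by (intro product_integral_insert) auto
  also have "\<dots> = integral\<^sup>L (PiM {..m} (\<lambda>_. M)) (chain a k m (kernel_op M (k m) b))"
    by (intro Bochner_Integration.integral_cong refl) (simp add: chain_def kernel_op_def mult.assoc)
  finally have eq: "integral\<^sup>L (PiM {..Suc m} (\<lambda>_. M)) (chain a k (Suc m) b)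
     = integral\<^sup>L (PiM {..m} (\<lambda>_. M)) (chain a k m (kernel_op M (k m) b))" .
  have "AE q in M. ennreal \<bar>kernel_op M (k m) b q\<bar> \<le> w m q"
    using Suc.prems(3)[of m, simplified]
  proof eventually_elim
    case (elim p)
    have "ennreal \<bar>kernel_op M (k m) b p\<bar> \<le> (\<integral>\<^sup>+q. ennreal \<bar>k m p q\<bar> * ennreal \<bar>b q\<bar> \<partial>M)"
      by (rule abs_kernel_op_le)
    also have "\<dots> \<le> (\<integral>\<^sup>+q. ennreal \<bar>k m p q\<bar> * w (Suc m) q \<partial>M)"
      using Suc.prems(4) by (intro nn_integral_mono_AE) (auto elim!: eventually_mono intro!: mult_left_mono)
    finally show ?case using elim by (rule order_trans)
  qed
  then have "integral\<^sup>L (PiM {..m} (\<lambda>_. M)) (chain a k m (kernel_op M (k m) b))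
      = (LINT p|M. a p * kernel_iter M k m (kernel_op M (k m) b) p)"
    using Suc.prems M by (intro Suc.IH[THEN conjunct2]) auto
  then show ?case using int eq by simp
qed

section \<open>A Riesz potential bound in the plane\<close>

lemma has_integral_indicator_UNIV:
  fixes f :: "'a::euclidean_space \<Rightarrow> real"
  shows "((\<lambda>x. f x * indicator S x) has_integral I) UNIV \<longleftrightarrow> (f has_integral I) S"
proof -
  have "(\<lambda>x. f x * indicator S x) = (\<lambda>x. if x \<in> S then f x else 0)" by auto
  then show ?thesis by (simp add: has_integral_restrict_UNIV)
qed

lemma nn_integral_powr_near_0:
  assumes "a < 1" "d > 0"
  shows "(\<integral>\<^sup>+x. ennreal (x powr (- a) * indicator {0..d} x) \<partial>lborel) = ennreal (d powr (1 - a) / (1 - a))"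
proof -
  have "((\<lambda>x. x powr (- a)) has_integral d powr (- a + 1) / (- a + 1)) {0..d}"
    using assms by (intro has_integral_powr_from_0) auto
  then have "((\<lambda>x. x powr (- a)) has_integral d powr (1 - a) / (1 - a)) {0..d}" by simp
  then have "((\<lambda>x. x powr (- a) * indicator {0..d} x) has_integral d powr (1 - a) / (1 - a)) UNIV"
    by (simp only: has_integral_indicator_UNIV)
  then show ?thesis
    by (intro nn_integral_has_integral_lborel) auto
qed

lemma nn_integral_powr_to_infinity:
  assumes "a > 1" "d > 0"
  shows "(\<integral>\<^sup>+x. ennreal (x powr (- a) * indicator {d..} x) \<partial>lborel) = ennreal (d powr (1 - a) / (a - 1))"
proof -
  have "((\<lambda>x. x powr (- a)) has_integral - (d powr (- a + 1)) / (- a + 1)) {d..}"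
    using assms by (intro has_integral_powr_to_inf) auto
  moreover have "- (d powr (- a + 1)) / (- a + 1) = d powr (1 - a) / (a - 1)"
    using assms by (simp add: divide_simps) (simp add: algebra_simps)
  ultimately have "((\<lambda>x. x powr (- a)) has_integral d powr (1 - a) / (a - 1)) {d..}" by simp
  then have "((\<lambda>x. x powr (- a) * indicator {d..} x) has_integral d powr (1 - a) / (a - 1)) UNIV"
    by (simp only: has_integral_indicator_UNIV)
  then show ?thesis
    by (intro nn_integral_has_integral_lborel) (use assms in auto)
qed

lemma nn_integral_even:
  fixes h :: "real \<Rightarrow> ennreal"
  assumes [measurable]: "h \<in> borel_measurable borel"
  shows "(\<integral>\<^sup>+x. h \<bar>x\<bar> \<partial>lborel) = 2 * (\<integral>\<^sup>+x\<in>{0<..}. h x \<partial>lborel)"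
proof -
  have "AE x in lborel. x \<noteq> (0::real)" by (rule AE_lborel_singleton)
  then have "(\<integral>\<^sup>+x. h \<bar>x\<bar> \<partial>lborel) = (\<integral>\<^sup>+x. h x * indicator {0<..} x + h (- x) * indicator {0<..} (- x) \<partial>lborel)"
    by (intro nn_integral_cong_AE) (auto elim!: eventually_mono simp: indicator_def abs_if)
  also have "\<dots> = (\<integral>\<^sup>+x\<in>{0<..}. h x \<partial>lborel) + (\<integral>\<^sup>+x. h (- x) * indicator {0<..} (- x) \<partial>lborel)"
    by (rule nn_integral_add) auto
  also have "(\<integral>\<^sup>+x. h (- x) * indicator {0<..} (- x) \<partial>lborel) = (\<integral>\<^sup>+x\<in>{0<..}. h x \<partial>lborel)"
    by (subst lborel_distr_uminus[symmetric], subst nn_integral_distr) auto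
  finally show ?thesis by (simp add: mult_2)
qed

lemma nn_integral_majorant_1d:
  assumes a: "a < 1" "b \<ge> 0" "a + b > 1" and d: "d > 0"
  shows "(\<integral>\<^sup>+x. ennreal (\<bar>x\<bar> powr (- a) * (\<bar>x\<bar> + d) powr (- b)) \<partial>lborel)
     \<le> ennreal (2 * (1 / (1 - a) + 1 / (a + b - 1)) * d powr (1 - a - b))"
proof -
  have "(\<integral>\<^sup>+x\<in>{0<..}. ennreal (x powr (- a) * (x + d) powr (- b)) \<partial>lborel)
     \<le> (\<integral>\<^sup>+x. ennreal (d powr (- b)) * ennreal (x powr (- a) * indicator {0..d} x)
           + ennreal (x powr (- (a + b)) * indicator {d..} x) \<partial>lborel)"
  proof (rule nn_integral_mono)
    fix x :: real
    consider "x \<le> 0" | "0 < x" "x \<le> d" | "x > d" by linarith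
    then show "ennreal (x powr (- a) * (x + d) powr (- b)) * indicator {0<..} x
       \<le> ennreal (d powr (- b)) * ennreal (x powr (- a) * indicator {0..d} x)
           + ennreal (x powr (- (a + b)) * indicator {d..} x)"
    proof cases
      case 2
      then have "x powr (- a) * (x + d) powr (- b) \<le> d powr (- b) * x powr (- a)"
        using d a by (subst mult.commute) (intro mult_right_mono powr_mono2', auto)
      then have "ennreal (x powr (- a) * (x + d) powr (- b)) \<le> ennreal (d powr (- b)) * ennreal (x powr (- a))"
        by (simp flip: ennreal_mult')
      then show ?thesis using 2 by (simp add: add_increasing2)
    next
      case 3
      then have "x powr (- a) * (x + d) powr (- b) \<le> x powr (- a) * x powr (- b)"
        using d a by (intro mult_left_mono powr_mono2') auto
      also have "\<dots> = x powr (- (a + b))" by (simp flip: powr_add)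
      finally show ?thesis using 3 d by (simp add: ennreal_leI)
    qed simp
  qed
  also have "\<dots> = ennreal (d powr (- b)) * ennreal (d powr (1 - a) / (1 - a)) + ennreal (d powr (1 - (a + b)) / (a + b - 1))"
    using nn_integral_powr_near_0[OF a(1) d] nn_integral_powr_to_infinity[OF a(3) d]
    by (subst nn_integral_add) (auto simp: nn_integral_cmult)
  also have "\<dots> = ennreal ((1 / (1 - a) + 1 / (a + b - 1)) * d powr (1 - a - b))"
    using a d by (simp add: ennreal_mult'[symmetric] ennreal_plus[symmetric] algebra_simps powr_add[symmetric]
       del: ennreal_plus)
  finally have "(\<integral>\<^sup>+x\<in>{0<..}. ennreal (x powr (- a) * (x + d) powr (- b)) \<partial>lborel)
     \<le> ennreal ((1 / (1 - a) + 1 / (a + b - 1)) * d powr (1 - a - b))" .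
  then have "2 * (\<integral>\<^sup>+x\<in>{0<..}. ennreal (x powr (- a) * (x + d) powr (- b)) \<partial>lborel)
     \<le> 2 * ennreal ((1 / (1 - a) + 1 / (a + b - 1)) * d powr (1 - a - b))" by (rule mult_left_mono) simp
  also have "\<dots> = ennreal (2 * (1 / (1 - a) + 1 / (a + b - 1)) * d powr (1 - a - b))"
    by (simp only: mult.assoc) (simp add: ennreal_mult'[of 2])
  finally show ?thesis
    by (subst nn_integral_even[where h = "\<lambda>x. ennreal (x powr (- a) * (x + d) powr (- b))"]) auto
qed

lemma nn_integral_product_complex:
  fixes f g :: "real \<Rightarrow> ennreal"
  assumes [measurable]: "f \<in> borel_measurable borel" "g \<in> borel_measurable borel"
  shows "(\<integral>\<^sup>+z. f (Re z) * g (Im z) \<partial>lborel) = (\<integral>\<^sup>+x. f x \<partial>lborel) * (\<integral>\<^sup>+x. g x \<partial>lborel)"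
proof -
  have [measurable]: "(\<lambda>(x, y). Complex x y) \<in> borel_measurable (borel \<Otimes>\<^sub>M borel)"
    by (auto intro!: borel_measurable_continuous_onI continuous_intros simp: borel_prod split_beta)
  have "(\<integral>\<^sup>+z. f (Re z) * g (Im z) \<partial>lborel) = (\<integral>\<^sup>+x. f (fst x) * g (snd x) \<partial>(lborel \<Otimes>\<^sub>M lborel))"
    by (subst distr_Complex[symmetric], subst nn_integral_distr) (auto simp: split_beta)
  also have "\<dots> = (\<integral>\<^sup>+x. \<integral>\<^sup>+y. f x * g y \<partial>lborel \<partial>lborel)"
    by (subst lborel.nn_integral_fst[symmetric]) auto
  finally show ?thesis by (simp add: nn_integral_cmult nn_integral_multc)
qed

lemma nn_integral_translate_complex:
  fixes f :: "complex \<Rightarrow> ennreal"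
  assumes [measurable]: "f \<in> borel_measurable borel"
  shows "(\<integral>\<^sup>+z. f (z - c) \<partial>lborel) = (\<integral>\<^sup>+z. f z \<partial>lborel)"
proof -
  have "(\<integral>\<^sup>+z. f z \<partial>lborel) = (\<integral>\<^sup>+z. f z \<partial>distr lborel borel ((+) (- c)))"
    by (simp add: lborel_distr_plus)
  then show ?thesis by (subst (asm) nn_integral_distr) auto
qed

text \<open>No polar coordinates are needed, because \<open>|z|\<close> dominates both \<open>|Re z|\<close> and \<open>|Im z|\<close>: half of each
  exponent can be given to each coordinate, and the integral is bounded by a square of a
  one-dimensional one.\<close>

lemma nn_integral_majorant_2d:
  assumes a: "0 \<le> a" "a < 2" "b \<ge> 0" "a + b > 2" and d: "d > 0"
  shows "(\<integral>\<^sup>+z. ennreal (cmod (z - c) powr (- a) * (cmod (z - c) + d) powr (- b)) \<partial>lborel)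
     \<le> ennreal ((2 * (1 / (1 - a/2) + 1 / (a/2 + b/2 - 1)))\<^sup>2 * d powr (2 - a - b))"
proof -
  let ?f = "\<lambda>x. ennreal (\<bar>x\<bar> powr (- (a/2)) * (\<bar>x\<bar> + d) powr (- (b/2)))"
  let ?K = "2 * (1 / (1 - a/2) + 1 / (a/2 + b/2 - 1))"
  have ae: "AE z in lborel. Re z \<noteq> 0 \<and> Im z \<noteq> 0"
  proof -
    have N: "negligible {z. b \<bullet> z = 0}" if "b \<noteq> 0" for b :: complex
      using that by (intro negligible_hyperplane) simp
    have B: "{z. b \<bullet> z = 0} \<in> sets borel" for b :: complex by measurable
    have "AE z in lborel. z \<notin> {z. (1::complex) \<bullet> z = 0} \<and> z \<notin> {z. \<i> \<bullet> z = 0}"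
      by (intro AE_conjI AE_lborel_not_in_negligible N B) auto
    then show ?thesis by (rule eventually_mono) (auto simp: inner_complex_def)
  qed
  have "(\<integral>\<^sup>+z. ennreal (cmod (z - c) powr (- a) * (cmod (z - c) + d) powr (- b)) \<partial>lborel)
     = (\<integral>\<^sup>+z. ennreal (cmod z powr (- a) * (cmod z + d) powr (- b)) \<partial>lborel)"
    by (rule nn_integral_translate_complex) measurable
  also have "\<dots> \<le> (\<integral>\<^sup>+z. ?f (Re z) * ?f (Im z) \<partial>lborel)"
  proof (rule nn_integral_mono_AE, rule AE_mp[OF ae], rule AE_I2, rule impI)
    fix z assume z: "Re z \<noteq> 0 \<and> Im z \<noteq> 0"
    have half: "cmod z powr (- (a/2)) \<le> t powr (- (a/2))" "(cmod z + d) powr (- (b/2)) \<le> (t + d) powr (- (b/2))"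
      if "0 < t" "t \<le> cmod z" for t
      using that a d by (auto intro!: powr_mono2')
    have "cmod z powr (- a) * (cmod z + d) powr (- b)
       = (cmod z powr (- (a/2)) * (cmod z + d) powr (- (b/2))) * (cmod z powr (- (a/2)) * (cmod z + d) powr (- (b/2)))"
      by (simp add: powr_add[symmetric] mult_ac flip: mult.assoc)
    also have "\<dots> \<le> (\<bar>Re z\<bar> powr (- (a/2)) * (\<bar>Re z\<bar> + d) powr (- (b/2))) * (\<bar>Im z\<bar> powr (- (a/2)) * (\<bar>Im z\<bar> + d) powr (- (b/2)))"
      using z half[of "\<bar>Re z\<bar>"] half[of "\<bar>Im z\<bar>"] abs_Re_le_cmod abs_Im_le_cmod
      by (intro mult_mono) auto
    finally show "ennreal (cmod z powr (- a) * (cmod z + d) powr (- b)) \<le> ?f (Re z) * ?f (Im z)"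
      by (simp add: ennreal_leI flip: ennreal_mult')
  qed
  also have "\<dots> = (\<integral>\<^sup>+x. ?f x \<partial>lborel) * (\<integral>\<^sup>+x. ?f x \<partial>lborel)"
    by (rule nn_integral_product_complex) auto
  also have "\<dots> \<le> ennreal (?K * d powr (1 - a/2 - b/2)) * ennreal (?K * d powr (1 - a/2 - b/2))"
    using a d by (intro mult_mono nn_integral_majorant_1d) auto
  also have "\<dots> = ennreal (?K\<^sup>2 * d powr (2 - a - b))"
  proof -
    have "d powr (1 - a/2 - b/2) * d powr (1 - a/2 - b/2) = d powr (2 - a - b)"
      by (subst powr_add[symmetric]) (rule arg_cong[where f = "(powr) d"], simp)
    moreover have "?K \<ge> 0" using a by simp
    then have "ennreal (k * e) * ennreal (k * e) = ennreal (k\<^sup>2 * (e * e))"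
      if "k = ?K" "e \<ge> 0" for k e
      unfolding that(1)[symmetric] using that by (simp add: power2_eq_square mult_ac flip: ennreal_mult')
    ultimately show ?thesis by simp
  qed
  finally show ?thesis .
qed

text \<open>A convenient admissible value in the next bound, not the best one.\<close>

definition riesz_const :: real where "riesz_const = 3200"

lemma riesz_const_pos: "riesz_const > 0"
  by (simp add: riesz_const_def)

text \<open>The exponents \<open>3/2\<close> and \<open>1\<close> are both below the dimension \<open>2\<close>, and their sum is above it, so
  the integral converges; scaling forces the power \<open>-1/2\<close>.  The nearer of the two singularities is
  kept, the other factor is replaced by its distance plus \<open>d\<close>.\<close>

lemma riesz_const_bound:
  fixes c p :: complex
  assumes "p \<noteq> c"
  shows "(\<integral>\<^sup>+q. ennreal (1 / (cmod (q - c) * sqrt (cmod (q - c)) * cmod (q - p))) \<partial>lborel)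
      \<le> ennreal (riesz_const / sqrt (cmod (p - c)))"
proof -
  define K where "K = (2 * (1 / (1 - (3/2)/2) + 1 / ((3/2)/2 + 1/2 - 1)) :: real)\<^sup>2"
  define L where "L = (2 * (1 / (1 - 1/2) + 1 / (1/2 + (3/2)/2 - 1)) :: real)\<^sup>2"
  have KL: "K > 0" "L > 0" by (simp_all add: K_def L_def)
  have "(\<integral>\<^sup>+q. ennreal (1 / (cmod (q - c) * sqrt (cmod (q - c)) * cmod (q - p))) \<partial>lborel)
      \<le> ennreal ((8 * K + 8 * L) / sqrt (cmod (p - c)))"
  proof -
    \<comment> \<open>By the triangle inequality, every point has distance at least \<open>d\<close> from \<open>c\<close> or from \<open>p\<close>.\<close>
    define d where "d = cmod (p - c) / 2"
    have d: "d > 0" using assms by (simp add: d_def)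
    have p32: "1 / (r * sqrt r) = r powr (- (3/2))" if "r > 0" for r :: real
    proof -
      have "r * sqrt r = r powr 1 * r powr (1/2)" using that by (simp add: powr_half_sqrt)
      also have "\<dots> = r powr (3/2)" by (subst powr_add[symmetric]) simp
      finally show ?thesis by (simp add: powr_minus_divide)
    qed
    have split: "ennreal (2 * X + 4 * Y) = 2 * ennreal X + 4 * ennreal Y" if "X \<ge> 0" "Y \<ge> 0" for X Y
      using that by (simp add: ennreal_mult')
    have ae: "AE q in lborel. q \<noteq> c \<and> q \<noteq> p"
      by (intro AE_conjI AE_lborel_singleton)
    have "(\<integral>\<^sup>+q. ennreal (1 / (cmod (q - c) * sqrt (cmod (q - c)) * cmod (q - p))) \<partial>lborel)
      \<le> (\<integral>\<^sup>+q. 2 * ennreal (cmod (q - c) powr (- (3/2)) * (cmod (q - c) + d) powr (- 1))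
           + 4 * ennreal (cmod (q - p) powr (- 1) * (cmod (q - p) + d) powr (- (3/2))) \<partial>lborel)"
    proof (rule nn_integral_mono_AE, rule AE_mp[OF ae], rule AE_I2, rule impI)
      fix q assume q: "q \<noteq> c \<and> q \<noteq> p"
      define a b where "a = cmod (q - c)" and "b = cmod (q - p)"
      have ab: "a > 0" "b > 0" using q by (auto simp: a_def b_def)
      have tri: "2 * d \<le> a + b" unfolding a_def b_def d_def
        using norm_triangle_ineq4[of "q - c" "q - p"] by simp
      have lhs: "1 / (a * sqrt a * b) = a powr (- (3/2)) * b powr (- 1)"
        using ab p32[of a] by (simp add: powr_minus_divide field_simps)
      have "a powr (- (3/2)) * b powr (- 1) \<le> 2 * (a powr (- (3/2)) * (a + d) powr (- 1)) + 4 * (b powr (- 1) * (b + d) powr (- (3/2)))"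
      proof (cases "a \<le> b")
        case True
        then have "a + d \<le> 2 * b" using tri by simp
        then have "b powr (- 1) \<le> 2 * (a + d) powr (- 1)"
          using ab d by (simp add: powr_minus_divide field_simps)
        then have "a powr (- (3/2)) * b powr (- 1) \<le> a powr (- (3/2)) * (2 * (a + d) powr (- 1))"
          by (rule mult_left_mono) simp
        moreover have "0 \<le> 4 * (b powr (- 1) * (b + d) powr (- (3/2)))" by simp
        ultimately show ?thesis by (simp only: mult.left_commute[of _ 2])
      next
        case False
        then have "(b + d) / 2 \<le> a" using tri by simp
        then have "a powr (- (3/2)) \<le> ((b + d) / 2) powr (- (3/2))"
          using ab d by (intro powr_mono2') auto
        also have "\<dots> = 2 powr (3/2) * (b + d) powr (- (3/2))"
          using ab d by (simp add: powr_divide powr_minus_divide)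
        also have "\<dots> \<le> 4 * (b + d) powr (- (3/2))"
        proof -
          have "2 powr (3/2) \<le> (2::real) powr 2" by (rule powr_mono) auto
          then show ?thesis by (intro mult_right_mono) auto
        qed
        finally have "a powr (- (3/2)) * b powr (- 1) \<le> (4 * (b + d) powr (- (3/2))) * b powr (- 1)"
          by (rule mult_right_mono) simp
        moreover have "0 \<le> 2 * (a powr (- (3/2)) * (a + d) powr (- 1))" by simp
        ultimately show ?thesis by (simp only: mult.assoc mult.commute[of "b powr - 1"])
      qed
      then have "ennreal (1 / (a * sqrt a * b)) \<le> ennreal (2 * (a powr (- (3/2)) * (a + d) powr (- 1)) + 4 * (b powr (- 1) * (b + d) powr (- (3/2))))"
        unfolding lhs by (rule ennreal_leI)
      also have "\<dots> = 2 * ennreal (a powr (- (3/2)) * (a + d) powr (- 1)) + 4 * ennreal (b powr (- 1) * (b + d) powr (- (3/2)))"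
        by (rule split) simp_all
      finally show "ennreal (1 / (cmod (q - c) * sqrt (cmod (q - c)) * cmod (q - p)))
        \<le> 2 * ennreal (cmod (q - c) powr (- (3/2)) * (cmod (q - c) + d) powr (- 1))
           + 4 * ennreal (cmod (q - p) powr (- 1) * (cmod (q - p) + d) powr (- (3/2)))"
        unfolding a_def b_def .
    qed
    also have "\<dots> = 2 * (\<integral>\<^sup>+q. ennreal (cmod (q - c) powr (- (3/2)) * (cmod (q - c) + d) powr (- 1)) \<partial>lborel)
           + 4 * (\<integral>\<^sup>+q. ennreal (cmod (q - p) powr (- 1) * (cmod (q - p) + d) powr (- (3/2))) \<partial>lborel)"
      by (subst nn_integral_add) (auto simp: nn_integral_cmult)
    also have "\<dots> \<le> 2 * ennreal (K * d powr (2 - 3/2 - 1)) + 4 * ennreal (L * d powr (2 - 1 - 3/2))"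
      unfolding K_def L_def using d by (intro add_mono mult_left_mono nn_integral_majorant_2d) auto
    also have "\<dots> = ennreal ((2 * K + 4 * L) * d powr (- (1/2)))"
      using KL by (simp add: ennreal_mult' algebra_simps)
    also have "\<dots> \<le> ennreal ((8 * K + 8 * L) / sqrt (cmod (p - c)))"
    proof (rule ennreal_leI)
      have "d powr (- (1/2)) = sqrt 2 / sqrt (cmod (p - c))"
        using assms by (simp add: d_def powr_minus_divide powr_half_sqrt real_sqrt_divide)
      also have "\<dots> \<le> 2 / sqrt (cmod (p - c))"
        using sqrt2_less_2 by (intro divide_right_mono) auto
      finally have "(2 * K + 4 * L) * d powr (- (1/2)) \<le> (2 * K + 4 * L) * (2 / sqrt (cmod (p - c)))"
        using KL by (intro mult_left_mono) auto
      also have "\<dots> \<le> (8 * K + 8 * L) / sqrt (cmod (p - c))"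
        using KL by (simp add: divide_right_mono)
      finally show "(2 * K + 4 * L) * d powr (- (1/2)) \<le> (8 * K + 8 * L) / sqrt (cmod (p - c))" .
    qed
    finally show ?thesis .
  qed
  moreover have "8 * K + 8 * L = riesz_const"
    by (simp add: K_def L_def riesz_const_def power2_eq_square)
  ultimately show ?thesis by simp
qed

section \<open>The Dirichlet Green function of the slit cylinder and weighted estimates\<close>

text \<open>The harmonic function with Dirichlet condition on the slit that is singular at the tip.\<close>

definition tipD :: "complex \<Rightarrow> real" where "tipD p = Im (1 / p)"
text \<open>The harmonic function with Neumann condition on the slit that is singular at the tip.\<close>

definition tipN :: "complex \<Rightarrow> real" where "tipN p = Re (1 / p)"
text \<open>The common value of \<open>\<partial>\<^sub>A tipD\<close> and \<open>\<partial>\<^sub>B tipN\<close>.\<close>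

definition tipD' :: "complex \<Rightarrow> real" where "tipD' p = - Re (vfield p / p\<^sup>2)"
definition green :: "complex \<Rightarrow> complex \<Rightarrow> real" where
  "green p q = ln (cmod (q - p)) - ln (cmod (q - cnj p))"
definition pole :: "complex \<Rightarrow> real" where "pole q = - green \<i> q"
text \<open>The kernel \<open>-\<partial>\<^sub>A\<^sub>,\<^sub>q green p q\<close>, that is, Green's operator after \<open>\<partial>\<^sub>A\<close>.\<close>

definition kerD :: "complex \<Rightarrow> complex \<Rightarrow> real" where
  "kerD p q = Im (vfield q * (1 / (q - p) - 1 / (q - cnj p)))"

text \<open>The weights come in pairs: \<open>kerD\<close> takes \<open>wW\<close> to a multiple of the smaller \<open>wV\<close>, which is bounded at
  the tip.  This gain is used where \<open>tipD'\<close> appears, since \<open>tipD' * wW\<close> is not integrable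
  there.  The transposed kernel preserves \<open>wU\<close>.\<close>

definition wV :: "complex \<Rightarrow> real" where "wV q = 1 / sqrt (cmod (q - \<i>))"
definition wW :: "complex \<Rightarrow> real" where "wW q = cmod (q + \<i>) / (cmod q * sqrt (cmod (q - \<i>)))"
definition wU :: "complex \<Rightarrow> real" where "wU q = cmod (vfield q) * wW q"

lemma measurable_cnj [measurable]: "cnj \<in> borel_measurable borel"
  by (intro borel_measurable_continuous_onI continuous_intros)

lemma sets_hmeasure [simp, measurable_cong]: "sets hmeasure = sets borel"
  and space_hmeasure [simp]: "space hmeasure = UNIV"
  by (simp_all add: hmeasure_def)

lemma measurable_functions [measurable]:
  "tipD \<in> borel_measurable borel" "tipN \<in> borel_measurable borel" "tipD' \<in> borel_measurable borel"
  "pole \<in> borel_measurable borel" "wV \<in> borel_measurable borel" "wW \<in> borel_measurable borel"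
  unfolding tipD_def[abs_def] tipN_def[abs_def] tipD'_def[abs_def] pole_def[abs_def] wV_def[abs_def]
    wW_def[abs_def] green_def
  by measurable

lemma measurable_wU [measurable]: "wU \<in> borel_measurable borel"
  unfolding wU_def[abs_def] by measurable

lemma measurable_kernels [measurable]:
  "case_prod kerD \<in> borel_measurable (borel \<Otimes>\<^sub>M borel)"
  "case_prod green \<in> borel_measurable (borel \<Otimes>\<^sub>M borel)"
  unfolding kerD_def green_def split_beta'
  by measurable

lemma sigma_finite_hmeasure: "sigma_finite_measure hmeasure"
  unfolding hmeasure_def by (subst sigma_finite_measure.sigma_finite_iff_density_finite[OF sigma_finite_lborel]) auto

lemma AE_hmeasure:
  assumes "AE q in lborel. Im q > 0 \<longrightarrow> P q"
  shows "AE q in hmeasure. P q"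
  unfolding hmeasure_def using assms
  by (subst AE_density) (auto elim!: eventually_mono simp: indicator_def split: if_splits)

lemma AE_hmeasure_conj: "AE q in lborel. P q \<Longrightarrow> AE q in hmeasure. Im q > 0 \<and> P q"
  by (rule AE_hmeasure) (auto elim!: eventually_mono)

lemma AE_hmeasure_generic: "AE q in hmeasure. Im q > 0 \<and> q \<noteq> \<i> \<and> q \<noteq> p"
  by (rule AE_hmeasure) (intro AE_I2 AE_conjI eventually_mono[OF AE_conjI[OF AE_lborel_singleton[of \<i>] AE_lborel_singleton[of p]]], simp)

text \<open>The centre and one further point may be ignored; estimates of kernels fail there because division
  by zero is zero.\<close>

lemma nn_integral_hmeasure_le:
  fixes f g :: "complex \<Rightarrow> real"
  assumes [measurable]: "f \<in> borel_measurable borel"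
    and le: "\<And>q. Im q > 0 \<Longrightarrow> q \<noteq> \<i> \<Longrightarrow> q \<noteq> p \<Longrightarrow> f q / (cmod (vfield q))\<^sup>2 \<le> g q"
    and g: "\<And>q. g q \<ge> 0"
  shows "(\<integral>\<^sup>+q. ennreal (f q) \<partial>hmeasure) \<le> (\<integral>\<^sup>+q. ennreal (g q) \<partial>lborel)"
proof -
  have "(\<integral>\<^sup>+q. ennreal (f q) \<partial>hmeasure)
    = (\<integral>\<^sup>+q. ennreal (indicator {z. Im z > 0} q / (cmod (vfield q))\<^sup>2) * ennreal (f q) \<partial>lborel)"
    unfolding hmeasure_def by (subst nn_integral_density) auto
  also have "\<dots> \<le> (\<integral>\<^sup>+q. ennreal (g q) \<partial>lborel)"
  proof (rule nn_integral_mono_AE, rule AE_mp[OF AE_conjI[OF AE_lborel_singleton[of \<i>] AE_lborel_singleton[of p]]],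
      rule AE_I2, rule impI)
    fix q assume q: "q \<noteq> \<i> \<and> q \<noteq> p"
    show "ennreal (indicator {z. Im z > 0} q / (cmod (vfield q))\<^sup>2) * ennreal (f q) \<le> ennreal (g q)"
    proof (cases "Im q > 0")
      case True
      then show ?thesis using le[of q] q by (simp add: ennreal_leI flip: ennreal_mult')
    qed simp
  qed
  finally show ?thesis .
qed

lemma nn_integral_riesz_le:
  fixes f :: "complex \<Rightarrow> real"
  assumes f: "f \<in> borel_measurable borel" and p: "p \<noteq> \<i>" and K: "K \<ge> 0"
    and le: "\<And>q. Im q > 0 \<Longrightarrow> q \<noteq> \<i> \<Longrightarrow> q \<noteq> p \<Longrightarrow> f q / (cmod (vfield q))\<^sup>2
        \<le> K / (cmod (q - \<i>) * sqrt (cmod (q - \<i>)) * cmod (q - p))"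
  shows "(\<integral>\<^sup>+q. ennreal (f q) \<partial>hmeasure) \<le> ennreal (K * riesz_const * wV p)"
proof -
  have "(\<integral>\<^sup>+q. ennreal (f q) \<partial>hmeasure)
      \<le> (\<integral>\<^sup>+q. ennreal (K / (cmod (q - \<i>) * sqrt (cmod (q - \<i>)) * cmod (q - p))) \<partial>lborel)"
    using K by (intro nn_integral_hmeasure_le[OF f le]) auto
  also have "\<dots> = ennreal K * (\<integral>\<^sup>+q. ennreal (1 / (cmod (q - \<i>) * sqrt (cmod (q - \<i>)) * cmod (q - p))) \<partial>lborel)"
    using K by (subst nn_integral_cmult[symmetric]) (auto simp flip: ennreal_mult')
  also have "\<dots> \<le> ennreal K * ennreal (riesz_const / sqrt (cmod (p - \<i>)))"
    by (intro mult_left_mono riesz_const_bound p) simp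
  also have "\<dots> = ennreal (K * riesz_const * wV p)"
    using K by (simp add: wV_def flip: ennreal_mult')
  finally show ?thesis .
qed

lemma cmod_vfield: "q \<noteq> 0 \<Longrightarrow> cmod (vfield q) = cmod (q - \<i>) * cmod (q + \<i>) / (2 * cmod q)"
proof -
  assume "q \<noteq> 0"
  then have "vfield q = (q - \<i>) * (q + \<i>) / (2 * q)"
    by (simp add: vfield_def field_simps power2_eq_square)
  then show ?thesis by (simp add: norm_mult norm_divide)
qed

lemma upper_bounds:
  assumes "Im q > 0"
  shows "q \<noteq> 0" "q + \<i> \<noteq> 0" "cmod (q + \<i>) \<ge> 1" "cmod (q + \<i>) \<ge> cmod q" "cmod (q + \<i>) \<ge> cmod (q - \<i>)"
    "cmod (q + \<i>) \<ge> Im q"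
proof -
  show "q \<noteq> 0" "q + \<i> \<noteq> 0" using assms by (auto simp: complex_eq_iff)
  have "Im (q + \<i>) \<ge> 1" "Im (q + \<i>) \<ge> Im q" using assms by simp_all
  then show "cmod (q + \<i>) \<ge> 1" "cmod (q + \<i>) \<ge> Im q" using abs_Im_le_cmod[of "q + \<i>"] by linarith+
  have "(cmod (q + \<i>))\<^sup>2 \<ge> (cmod q)\<^sup>2" "(cmod (q + \<i>))\<^sup>2 \<ge> (cmod (q - \<i>))\<^sup>2"
    unfolding cmod_power2 using assms by (simp_all add: power2_eq_square algebra_simps)
  then show "cmod (q + \<i>) \<ge> cmod q" "cmod (q + \<i>) \<ge> cmod (q - \<i>)"
    by (auto intro: power2_le_imp_le)
qed

lemma vfield_nonzero: "Im q > 0 \<Longrightarrow> q \<noteq> \<i> \<Longrightarrow> cmod (vfield q) > 0"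
  using upper_bounds[of q] by (simp add: cmod_vfield)

text \<open>The weights are chosen so that this quotient is a pure power of the distance to the centre.\<close>

lemma wW_over_vfield:
  assumes "Im q > 0" "q \<noteq> \<i>"
  shows "wW q / cmod (vfield q) = 2 / (cmod (q - \<i>) * sqrt (cmod (q - \<i>)))"
  using assms upper_bounds[of q] by (simp add: wW_def cmod_vfield)

lemma wU_over_vfield:
  assumes "Im q > 0" "q \<noteq> \<i>"
  shows "wU q / (cmod (vfield q))\<^sup>2 = 2 / (cmod (q - \<i>) * sqrt (cmod (q - \<i>)))"
  using wW_over_vfield[OF assms] vfield_nonzero[OF assms] by (simp add: wU_def power2_eq_square)

lemma weights_nonneg [simp]: "wV q \<ge> 0" "wW q \<ge> 0" "wU q \<ge> 0"
  by (simp_all add: wV_def wW_def wU_def)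

lemma wV_le_wW:
  assumes "Im q > 0" shows "wV q \<le> wW q"
proof -
  have "wV q * 1 \<le> wV q * (cmod (q + \<i>) / cmod q)"
    using upper_bounds[OF assms] by (intro mult_left_mono) auto
  then show ?thesis by (simp add: wV_def wW_def mult.commute)
qed

lemma inverse_le_wW:
  assumes "Im q > 0" "q \<noteq> \<i>" shows "1 / cmod q \<le> wW q"
proof -
  have "sqrt (cmod (q - \<i>)) \<le> sqrt (cmod (q + \<i>))" using upper_bounds[OF assms(1)] by simp
  also have "\<dots> \<le> cmod (q + \<i>)" using upper_bounds[OF assms(1)] sqrt_le_D
    by (intro real_le_lsqrt) (auto simp: power2_eq_square intro: mult_left_mono[of 1, simplified])
  finally have "1 \<le> cmod (q + \<i>) / sqrt (cmod (q - \<i>))" using assms(2) by simp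
  then have "1 / cmod q * 1 \<le> 1 / cmod q * (cmod (q + \<i>) / sqrt (cmod (q - \<i>)))"
    by (rule mult_left_mono) simp
  then show ?thesis by (simp add: wW_def)
qed

lemma abs_tipD: "\<bar>tipD q\<bar> \<le> 1 / cmod q"
  using abs_Im_le_cmod[of "1 / q"] by (simp add: tipD_def norm_divide)

lemma abs_tipD_le: "Im q > 0 \<Longrightarrow> q \<noteq> \<i> \<Longrightarrow> \<bar>tipD q\<bar> \<le> wW q"
  using abs_tipD[of q] inverse_le_wW[of q] by linarith

lemma abs_tipD'_le: "\<bar>tipD' q\<bar> \<le> cmod (vfield q) / (cmod q)\<^sup>2"
  using abs_Re_le_cmod[of "vfield q / q\<^sup>2"] by (simp add: tipD'_def norm_divide norm_power)

lemma abs_tipN_le_vfield: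
  assumes "Im q > 0" "q \<noteq> \<i>"
  shows "\<bar>tipN q\<bar> \<le> 2 * cmod (vfield q) / cmod q"
proof -
  have "\<bar>tipN q\<bar> = \<bar>Re q\<bar> / (cmod q)\<^sup>2"
    by (simp add: tipN_def Re_divide cmod_power2)
  also have "\<dots> \<le> cmod (q - \<i>) * cmod (q + \<i>) / (cmod q)\<^sup>2"
  proof (rule divide_right_mono)
    have "\<bar>Re q\<bar> * 1 \<le> cmod (q - \<i>) * cmod (q + \<i>)"
      using abs_Re_le_cmod[of "q - \<i>"] upper_bounds[OF assms(1)] by (intro mult_mono) auto
    then show "\<bar>Re q\<bar> \<le> cmod (q - \<i>) * cmod (q + \<i>)" by simp
  qed simp
  also have "\<dots> = 2 * cmod (vfield q) / cmod q"
    using upper_bounds[OF assms(1)] by (simp add: cmod_vfield power2_eq_square)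
  finally show ?thesis .
qed

lemma abs_tipN_le:
  assumes "Im q > 0" "q \<noteq> \<i>"
  shows "\<bar>tipN q\<bar> \<le> 2 * wU q"
proof -
  have "2 * cmod (vfield q) * (1 / cmod q) \<le> 2 * cmod (vfield q) * wW q"
    using inverse_le_wW[OF assms] by (intro mult_left_mono) auto
  then show ?thesis using abs_tipN_le_vfield[OF assms] by (simp add: wU_def)
qed

text \<open>With \<open>x = 2 Im p / |q - p|\<close> the absolute value is at most \<open>ln (1 + x)\<close>, which is bounded both by \<open>x\<close> and
  by \<open>2 sqrt x\<close>; the second form is needed near the pole.\<close>

lemma green_bound:
  assumes "Im p > 0" "Im q > 0" "q \<noteq> p"
  shows "\<bar>green p q\<bar> \<le> 2 * Im p / cmod (q - p)" "green p q \<le> 0"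
    "\<bar>green p q\<bar> \<le> 3 * sqrt (Im p) / sqrt (cmod (q - p))"
proof -
  have ne: "q - cnj p \<noteq> 0" using assms by (auto simp: complex_eq_iff)
  have "(cmod (q - cnj p))\<^sup>2 \<ge> (cmod (q - p))\<^sup>2"
    unfolding cmod_power2 using assms by (simp add: power2_eq_square algebra_simps)
  then have le: "cmod (q - p) \<le> cmod (q - cnj p)" by (auto intro: power2_le_imp_le)
  then show "green p q \<le> 0" using assms ne by (simp add: green_def)
  define x where "x = 2 * Im p / cmod (q - p)"
  have x: "x > 0" using assms by (simp add: x_def)
  have "cmod (q - cnj p) \<le> cmod (q - p) + cmod (p - cnj p)"
    using norm_triangle_ineq[of "q - p" "p - cnj p"] by simp
  also have "cmod (p - cnj p) = 2 * Im p" using assms by (simp add: complex_diff_cnj norm_mult)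
  finally have "cmod (q - cnj p) / cmod (q - p) \<le> 1 + x"
    using assms by (simp add: x_def field_simps)
  then have ln: "\<bar>green p q\<bar> \<le> ln (1 + x)"
  proof -
    have "\<bar>green p q\<bar> = ln (cmod (q - cnj p) / cmod (q - p))"
      using \<open>green p q \<le> 0\<close> assms ne by (simp add: green_def ln_div)
    also have "\<dots> \<le> ln (1 + x)"
      using \<open>_ \<le> 1 + x\<close> assms ne x by (subst ln_le_cancel_iff) auto
    finally show ?thesis .
  qed
  then show "\<bar>green p q\<bar> \<le> 2 * Im p / cmod (q - p)"
    using ln_add_one_self_le_self[of x] x by (simp add: x_def)
  have "ln (1 + x) \<le> ln ((1 + sqrt x)\<^sup>2)"
    using x by (subst ln_le_cancel_iff) (auto simp: power2_sum add_pos_pos)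
  also have "\<dots> = 2 * ln (1 + sqrt x)" using x by (simp add: ln_realpow)
  also have "\<dots> \<le> 2 * sqrt x" using ln_add_one_self_le_self[of "sqrt x"] x by simp
  also have "\<dots> \<le> 3 * sqrt (Im p) / sqrt (cmod (q - p))"
  proof -
    have "2 * sqrt 2 \<le> (3::real)" by (rule power2_le_imp_le) (auto simp: power_mult_distrib)
    then have "(2 * sqrt 2) * (sqrt (Im p) / sqrt (cmod (q - p))) \<le> 3 * (sqrt (Im p) / sqrt (cmod (q - p)))"
      using assms by (intro mult_right_mono) auto
    then show ?thesis by (simp add: x_def real_sqrt_divide real_sqrt_mult)
  qed
  finally show "\<bar>green p q\<bar> \<le> 3 * sqrt (Im p) / sqrt (cmod (q - p))" using ln by linarith
qed

lemma abs_pole_le: "Im q > 0 \<Longrightarrow> q \<noteq> \<i> \<Longrightarrow> \<bar>pole q\<bar> \<le> 3 * wV q"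
  using green_bound(3)[of \<i> q] by (simp add: pole_def wV_def)

lemma kerD_bound:
  assumes "Im p > 0" "Im q > 0" "q \<noteq> p"
  shows "\<bar>kerD p q\<bar> \<le> cmod (vfield q) * (2 * Im p / (cmod (q - p) * cmod (q - cnj p)))"
proof -
  have ne: "q - cnj p \<noteq> 0" using assms by (auto simp: complex_eq_iff)
  have "1 / (q - p) - 1 / (q - cnj p) = (p - cnj p) / ((q - p) * (q - cnj p))"
    using ne assms by (simp add: field_simps)
  also have "cmod \<dots> = 2 * Im p / (cmod (q - p) * cmod (q - cnj p))"
    using assms by (simp add: norm_divide norm_mult complex_diff_cnj)
  finally have "cmod (vfield q * (1 / (q - p) - 1 / (q - cnj p))) = cmod (vfield q) * (2 * Im p / (cmod (q - p) * cmod (q - cnj p)))"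
    by (simp add: norm_mult)
  then show ?thesis using abs_Im_le_cmod[of "vfield q * (1 / (q - p) - 1 / (q - cnj p))"] by (simp add: kerD_def)
qed

lemma Im_le_cmod_cnj:
  assumes "Im p > 0" "Im q > 0"
  shows "Im p \<le> cmod (q - cnj p)" "Im q \<le> cmod (q - cnj p)" "cmod (q - cnj p) > 0"
  using abs_Im_le_cmod[of "q - cnj p"] assms by (auto simp: complex_eq_iff)

text \<open>For the kernels, one of \<open>Im p\<close> and \<open>Im q\<close> absorbs the factor \<open>|q - cnj p|\<close>; for \<open>green\<close> the linear bound
  suffices.  The weight cancels the density, and the Riesz bound applies.\<close>

lemma kerD_kernel_bound:
  assumes "Im p > 0" "p \<noteq> \<i>"
  shows "(\<integral>\<^sup>+q. ennreal (\<bar>kerD p q\<bar> * wW q) \<partial>hmeasure) \<le> ennreal (4 * riesz_const * wV p)"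
    and "(\<integral>\<^sup>+q. ennreal (\<bar>kerD p q\<bar> * (Im q * wV q)) \<partial>hmeasure) \<le> ennreal (4 * riesz_const * (Im p * wV p))"
    and "(\<integral>\<^sup>+q. ennreal (\<bar>green p q\<bar> * wU q) \<partial>hmeasure) \<le> ennreal (4 * riesz_const * (Im p * wV p))"
    and "(\<integral>\<^sup>+q. ennreal (\<bar>kerD q p\<bar> * wU q) \<partial>hmeasure) \<le> ennreal (4 * riesz_const * wU p)"
proof -
  have [measurable]: "kerD p \<in> borel_measurable borel" "(\<lambda>q. kerD q p) \<in> borel_measurable borel" "green p \<in> borel_measurable borel"
    unfolding kerD_def[abs_def] green_def[abs_def] by measurable
  have *: "\<bar>kerD p q\<bar> / (cmod (vfield q))\<^sup>2 * X
     \<le> 2 * Im p / (cmod (q - p) * cmod (q - cnj p)) * (X / cmod (vfield q))" if "Im q > 0" "q \<noteq> \<i>" "q \<noteq> p" "X \<ge> 0" for q X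
  proof -
    have "\<bar>kerD p q\<bar> * (X / (cmod (vfield q))\<^sup>2)
      \<le> (cmod (vfield q) * (2 * Im p / (cmod (q - p) * cmod (q - cnj p)))) * (X / (cmod (vfield q))\<^sup>2)"
      using that assms by (intro mult_right_mono kerD_bound) auto
    then show ?thesis using vfield_nonzero[of q] that by (simp add: power2_eq_square)
  qed
  show "(\<integral>\<^sup>+q. ennreal (\<bar>kerD p q\<bar> * wW q) \<partial>hmeasure) \<le> ennreal (4 * riesz_const * wV p)"
  proof (rule nn_integral_riesz_le[OF _ assms(2)])
    fix q assume q: "Im q > 0" "q \<noteq> \<i>" "q \<noteq> p"
    have "\<bar>kerD p q\<bar> * wW q / (cmod (vfield q))\<^sup>2
        \<le> 2 * Im p / (cmod (q - p) * cmod (q - cnj p)) * (2 / (cmod (q - \<i>) * sqrt (cmod (q - \<i>))))"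
      using *[OF q, of "wW q"] wW_over_vfield[OF q(1,2)] by simp
    also have "\<dots> = 4 / (cmod (q - \<i>) * sqrt (cmod (q - \<i>)) * cmod (q - p)) * (Im p / cmod (q - cnj p))"
      by simp
    also have "\<dots> \<le> 4 / (cmod (q - \<i>) * sqrt (cmod (q - \<i>)) * cmod (q - p)) * 1"
      using Im_le_cmod_cnj[OF assms(1) q(1)] by (intro mult_left_mono) auto
    finally show "\<bar>kerD p q\<bar> * wW q / (cmod (vfield q))\<^sup>2 \<le> 4 / (cmod (q - \<i>) * sqrt (cmod (q - \<i>)) * cmod (q - p))"
      by simp
  qed auto
  have "(\<integral>\<^sup>+q. ennreal (\<bar>kerD p q\<bar> * (Im q * wV q)) \<partial>hmeasure) \<le> ennreal ((4 * Im p) * riesz_const * wV p)"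
  proof (rule nn_integral_riesz_le[OF _ assms(2)])
    fix q assume q: "Im q > 0" "q \<noteq> \<i>" "q \<noteq> p"
    have "\<bar>kerD p q\<bar> * (Im q * wV q) / (cmod (vfield q))\<^sup>2 \<le> \<bar>kerD p q\<bar> * (Im q * wW q) / (cmod (vfield q))\<^sup>2"
      using wV_le_wW[OF q(1)] q by (intro divide_right_mono mult_left_mono) auto
    also have "\<dots> \<le> 2 * Im p / (cmod (q - p) * cmod (q - cnj p)) * (Im q * (2 / (cmod (q - \<i>) * sqrt (cmod (q - \<i>)))))"
      using *[OF q, of "Im q * wW q"] q(1) unfolding wW_over_vfield[OF q(1,2), symmetric] by simp
    also have "\<dots> = 4 * Im p / (cmod (q - \<i>) * sqrt (cmod (q - \<i>)) * cmod (q - p)) * (Im q / cmod (q - cnj p))"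
      by (simp add: mult_ac)
    also have "\<dots> \<le> 4 * Im p / (cmod (q - \<i>) * sqrt (cmod (q - \<i>)) * cmod (q - p)) * 1"
      using Im_le_cmod_cnj[OF assms(1) q(1)] assms by (intro mult_left_mono) auto
    finally show "\<bar>kerD p q\<bar> * (Im q * wV q) / (cmod (vfield q))\<^sup>2 \<le> 4 * Im p / (cmod (q - \<i>) * sqrt (cmod (q - \<i>)) * cmod (q - p))"
      by simp
  qed (use assms in auto)
  then show "(\<integral>\<^sup>+q. ennreal (\<bar>kerD p q\<bar> * (Im q * wV q)) \<partial>hmeasure) \<le> ennreal (4 * riesz_const * (Im p * wV p))"
    by (simp add: mult_ac)
  have "(\<integral>\<^sup>+q. ennreal (\<bar>green p q\<bar> * wU q) \<partial>hmeasure) \<le> ennreal ((4 * Im p) * riesz_const * wV p)"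
  proof (rule nn_integral_riesz_le[OF _ assms(2)])
    fix q assume q: "Im q > 0" "q \<noteq> \<i>" "q \<noteq> p"
    have "\<bar>green p q\<bar> * (wU q / (cmod (vfield q))\<^sup>2) \<le> 2 * Im p / cmod (q - p) * (2 / (cmod (q - \<i>) * sqrt (cmod (q - \<i>))))"
      using green_bound(1)[OF assms(1) q(1,3)] unfolding wU_over_vfield[OF q(1,2)] by (intro mult_right_mono) auto
    then show "\<bar>green p q\<bar> * wU q / (cmod (vfield q))\<^sup>2 \<le> 4 * Im p / (cmod (q - \<i>) * sqrt (cmod (q - \<i>)) * cmod (q - p))"
      by (simp add: mult_ac)
  qed (use assms in auto)
  then show "(\<integral>\<^sup>+q. ennreal (\<bar>green p q\<bar> * wU q) \<partial>hmeasure) \<le> ennreal (4 * riesz_const * (Im p * wV p))"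
    by (simp add: mult_ac)
  have "(\<integral>\<^sup>+q. ennreal (\<bar>kerD q p\<bar> * wU q) \<partial>hmeasure) \<le> ennreal ((4 * cmod (vfield p)) * riesz_const * wV p)"
  proof (rule nn_integral_riesz_le[OF _ assms(2)])
    fix q assume q: "Im q > 0" "q \<noteq> \<i>" "q \<noteq> p"
    have "\<bar>kerD q p\<bar> * (wU q / (cmod (vfield q))\<^sup>2) \<le> cmod (vfield p) * (2 * Im q / (cmod (p - q) * cmod (p - cnj q))) * (2 / (cmod (q - \<i>) * sqrt (cmod (q - \<i>))))"
      using kerD_bound[OF q(1) assms(1)] q(3) unfolding wU_over_vfield[OF q(1,2)] by (intro mult_right_mono) auto
    also have "\<dots> = 4 * cmod (vfield p) / (cmod (q - \<i>) * sqrt (cmod (q - \<i>)) * cmod (q - p)) * (Im q / cmod (p - cnj q))"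
      by (simp add: norm_minus_commute mult_ac)
    also have "\<dots> \<le> 4 * cmod (vfield p) / (cmod (q - \<i>) * sqrt (cmod (q - \<i>)) * cmod (q - p)) * 1"
      using Im_le_cmod_cnj[OF q(1) assms(1)] by (intro mult_left_mono) auto
    finally show "\<bar>kerD q p\<bar> * wU q / (cmod (vfield q))\<^sup>2 \<le> 4 * cmod (vfield p) / (cmod (q - \<i>) * sqrt (cmod (q - \<i>)) * cmod (q - p))"
      by simp
  qed auto
  also have "\<dots> \<le> ennreal (4 * riesz_const * wU p)"
  proof (rule ennreal_leI)
    have "(4 * riesz_const * cmod (vfield p)) * wV p \<le> (4 * riesz_const * cmod (vfield p)) * wW p"
      using wV_le_wW[OF assms(1)] riesz_const_pos by (intro mult_left_mono) auto
    then show "4 * cmod (vfield p) * riesz_const * wV p \<le> 4 * riesz_const * wU p" by (simp add: wU_def mult_ac)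
  qed
  finally show "(\<integral>\<^sup>+q. ennreal (\<bar>kerD q p\<bar> * wU q) \<partial>hmeasure) \<le> ennreal (4 * riesz_const * wU p)" .
qed

text \<open>These are instances of the Riesz bound with the second singularity at the tip \<open>0\<close>.\<close>

lemma end_bounds:
  shows tipN_wW_bound: "(\<integral>\<^sup>+q. ennreal (\<bar>tipN q\<bar> * wW q) \<partial>hmeasure) \<le> ennreal (4 * riesz_const)"
    and tipD'_wV_bound: "(\<integral>\<^sup>+q. ennreal (\<bar>tipD' q\<bar> * wV q) \<partial>hmeasure) \<le> ennreal (4 * riesz_const)"
    and tipD'_Im_wV_bound: "(\<integral>\<^sup>+q. ennreal (\<bar>tipD' q\<bar> * (Im q * wV q)) \<partial>hmeasure) \<le> ennreal (4 * riesz_const)"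
    and tipD_wU_bound: "(\<integral>\<^sup>+q. ennreal (\<bar>tipD q\<bar> * wU q) \<partial>hmeasure) \<le> ennreal (4 * riesz_const)"
proof -
  have main: "(\<integral>\<^sup>+q. ennreal (f q) \<partial>hmeasure) \<le> ennreal (4 * riesz_const)"
    if f: "f \<in> borel_measurable borel"
      and le: "\<And>q. Im q > 0 \<Longrightarrow> q \<noteq> \<i> \<Longrightarrow> f q / (cmod (vfield q))\<^sup>2 \<le> 4 / (cmod (q - \<i>) * sqrt (cmod (q - \<i>)) * cmod q)" for f
  proof -
    have "(\<integral>\<^sup>+q. ennreal (f q) \<partial>hmeasure) \<le> ennreal (4 * riesz_const * wV 0)"
      using le by (intro nn_integral_riesz_le[OF f]) auto
    then show ?thesis by (simp add: wV_def)
  qed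
  show "(\<integral>\<^sup>+q. ennreal (\<bar>tipN q\<bar> * wW q) \<partial>hmeasure) \<le> ennreal (4 * riesz_const)"
  proof (rule main)
    fix q assume q: "Im q > 0" "q \<noteq> \<i>"
    have "\<bar>tipN q\<bar> * wW q / (cmod (vfield q))\<^sup>2 = (\<bar>tipN q\<bar> / cmod (vfield q)) * (2 / (cmod (q - \<i>) * sqrt (cmod (q - \<i>))))"
      unfolding wW_over_vfield[OF q, symmetric] by (simp add: power2_eq_square)
    also have "\<dots> \<le> (2 / cmod q) * (2 / (cmod (q - \<i>) * sqrt (cmod (q - \<i>))))"
      using abs_tipN_le_vfield[OF q] vfield_nonzero[OF q] by (intro mult_right_mono) (auto simp: field_simps)
    finally show "\<bar>tipN q\<bar> * wW q / (cmod (vfield q))\<^sup>2 \<le> 4 / (cmod (q - \<i>) * sqrt (cmod (q - \<i>)) * cmod q)"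
      by (simp add: mult_ac)
  qed auto
  have tipD'_main: "\<bar>tipD' q\<bar> * (X * wV q) / (cmod (vfield q))\<^sup>2 \<le> 4 / (cmod (q - \<i>) * sqrt (cmod (q - \<i>)) * cmod q)"
    if q: "Im q > 0" "q \<noteq> \<i>" and X: "0 \<le> X" "X \<le> cmod (q + \<i>)" for q X
  proof -
    note u = upper_bounds[OF q(1)]
    have "\<bar>tipD' q\<bar> * (X * wV q / (cmod (vfield q))\<^sup>2) \<le> (cmod (vfield q) / (cmod q)\<^sup>2) * (X * wV q / (cmod (vfield q))\<^sup>2)"
      using abs_tipD'_le X by (intro mult_right_mono) auto
    also have "\<dots> = X * wV q / ((cmod q)\<^sup>2 * cmod (vfield q))"
      using vfield_nonzero[OF q] by (simp add: power2_eq_square)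
    also have "\<dots> = 2 / (cmod (q - \<i>) * sqrt (cmod (q - \<i>)) * cmod q) * (X / cmod (q + \<i>))"
      using u q by (simp add: cmod_vfield wV_def power2_eq_square mult_ac)
    also have "\<dots> \<le> 2 / (cmod (q - \<i>) * sqrt (cmod (q - \<i>)) * cmod q) * 2"
    proof (rule mult_left_mono)
      have "X / cmod (q + \<i>) \<le> 1" using X u by (simp add: divide_le_eq_1)
      then show "X / cmod (q + \<i>) \<le> 2" by simp
    qed simp
    finally show ?thesis by simp
  qed
  show "(\<integral>\<^sup>+q. ennreal (\<bar>tipD' q\<bar> * wV q) \<partial>hmeasure) \<le> ennreal (4 * riesz_const)"
    by (rule main) (use tipD'_main[of _ 1] upper_bounds in auto)
  show "(\<integral>\<^sup>+q. ennreal (\<bar>tipD' q\<bar> * (Im q * wV q)) \<partial>hmeasure) \<le> ennreal (4 * riesz_const)"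
    by (rule main) (use tipD'_main upper_bounds in auto)
  show "(\<integral>\<^sup>+q. ennreal (\<bar>tipD q\<bar> * wU q) \<partial>hmeasure) \<le> ennreal (4 * riesz_const)"
  proof (rule main)
    fix q assume q: "Im q > 0" "q \<noteq> \<i>"
    have "\<bar>tipD q\<bar> * (wU q / (cmod (vfield q))\<^sup>2) \<le> 1 / cmod q * (4 / (cmod (q - \<i>) * sqrt (cmod (q - \<i>))))"
      unfolding wU_over_vfield[OF q] using abs_tipD by (intro mult_mono divide_right_mono) auto
    then show "\<bar>tipD q\<bar> * wU q / (cmod (vfield q))\<^sup>2 \<le> 4 / (cmod (q - \<i>) * sqrt (cmod (q - \<i>)) * cmod q)"
      by (simp add: mult_ac)
  qed auto
qed

section \<open>The moments: reflection and angular integration by parts\<close>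

lemma Fubini_nn_finite:
  fixes f :: "'a \<Rightarrow> 'a \<Rightarrow> real"
  assumes M: "sigma_finite_measure M" and f: "case_prod f \<in> borel_measurable (M \<Otimes>\<^sub>M M)"
    and fin: "(\<integral>\<^sup>+p. \<integral>\<^sup>+q. ennreal \<bar>f p q\<bar> \<partial>M \<partial>M) < \<infinity>"
  shows "(LINT p|M. LINT q|M. f p q) = (LINT q|M. LINT p|M. f p q)"
    and "AE q in M. integrable M (\<lambda>p. f p q)"
proof -
  interpret sigma_finite_measure M by fact
  interpret pair_sigma_finite M M ..
  have int: "integrable (M \<Otimes>\<^sub>M M) (case_prod f)"
  proof (rule integrableI_bounded)
    have "(\<integral>\<^sup>+x. ennreal (norm (case_prod f x)) \<partial>(M \<Otimes>\<^sub>M M)) = (\<integral>\<^sup>+p. \<integral>\<^sup>+q. ennreal \<bar>f p q\<bar> \<partial>M \<partial>M)"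
      using sigma_finite_measure.nn_integral_fst[OF M, where f = "\<lambda>x. ennreal (norm (case_prod f x))"] f by simp
    then show "(\<integral>\<^sup>+x. ennreal (norm (case_prod f x)) \<partial>(M \<Otimes>\<^sub>M M)) < \<infinity>" using fin by simp
  qed (rule f)
  show "(LINT p|M. LINT q|M. f p q) = (LINT q|M. LINT p|M. f p q)"
    using Fubini_integral[OF int] by simp
  show "AE q in M. integrable M (\<lambda>p. f p q)"
    using AE_integrable_snd[OF int] by simp
qed

lemma kernel_iter_const: "kernel_iter M (\<lambda>_. k) m b = (kernel_op M k ^^ m) b"
  by (induction m arbitrary: b) (simp_all add: funpow_swap1)

abbreviation opD :: "(complex \<Rightarrow> real) \<Rightarrow> complex \<Rightarrow> real" where
  "opD \<equiv> kernel_op hmeasure kerD"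

lemma measurable_opD_iter [measurable]:
  "b \<in> borel_measurable borel \<Longrightarrow> (opD ^^ m) b \<in> borel_measurable borel"
proof (induction m)
  case (Suc m)
  have "case_prod kerD \<in> borel_measurable (hmeasure \<Otimes>\<^sub>M hmeasure)" by measurable
  from measurable_kernel_op[OF sigma_finite_hmeasure this, of "(opD ^^ m) b"] Suc show ?case
    by (simp add: measurable_cong_sets[OF sets_hmeasure refl])
qed simp

text \<open>The moments measure the effect of repeated passages through the tip of the slit.\<close>

definition moment :: "nat \<Rightarrow> real" where
  "moment m = (LINT p|hmeasure. tipN p * (opD ^^ m) tipD p)"

lemma integral_reflect:
  "f \<in> borel_measurable borel \<Longrightarrow> (LINT p|hmeasure. f (- cnj p)) = (LINT p|hmeasure. f p :: real)"
  by (subst (2) hmeasure_reflect[symmetric], subst integral_distr) auto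

lemma reflect_kernels:
  "tipD (- cnj p) = tipD p" "tipN (- cnj p) = - tipN p" "kerD (- cnj p) (- cnj q) = - kerD p q"
proof -
  have inv: "1 / (- cnj z) = - cnj (1 / z)" for z by simp
  show "tipD (- cnj p) = tipD p" "tipN (- cnj p) = - tipN p"
    unfolding tipD_def tipN_def inv by (simp_all only: uminus_complex.simps cnj.simps minus_minus)
  have v: "vfield (- cnj q) = - cnj (vfield q)"
    by (simp add: vfield_def add_divide_distrib diff_divide_distrib)
  have "1 / (- cnj q - - cnj p) = - cnj (1 / (q - p))" "1 / (- cnj q - cnj (- cnj p)) = - cnj (1 / (q - cnj p))"
    using inv[of "q - p"] inv[of "q - cnj p"] by (simp_all add: minus_diff_commute)
  then have eq: "vfield (- cnj q) * (1 / (- cnj q - - cnj p) - 1 / (- cnj q - cnj (- cnj p)))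
      = cnj (vfield q * (1 / (q - p) - 1 / (q - cnj p)))"
    unfolding v by (simp add: algebra_simps)
  show "kerD (- cnj p) (- cnj q) = - kerD p q"
    unfolding kerD_def eq by (simp only: cnj.simps)
qed

lemma opD_iter_reflect: "(opD ^^ m) tipD (- cnj p) = (- 1) ^ m * (opD ^^ m) tipD p"
proof (induction m arbitrary: p)
  case (Suc m)
  have [measurable]: "kerD p \<in> borel_measurable borel" for p unfolding kerD_def[abs_def] by measurable
  have "(opD ^^ Suc m) tipD (- cnj p) = (LINT q|hmeasure. kerD (- cnj p) q * (opD ^^ m) tipD q)"
    by (simp add: kernel_op_def)
  also have "\<dots> = (LINT q|hmeasure. kerD (- cnj p) (- cnj q) * (opD ^^ m) tipD (- cnj q))"
    by (rule integral_reflect[symmetric]) measurable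
  also have "\<dots> = (LINT q|hmeasure. (- 1) ^ Suc m * (kerD p q * (opD ^^ m) tipD q))"
    unfolding reflect_kernels Suc.IH by (intro Bochner_Integration.integral_cong) auto
  finally show ?case by (simp only: integral_mult_right_zero funpow.simps o_def) (simp add: kernel_op_def)
qed (simp add: reflect_kernels)

text \<open>The reflection \<open>z \<mapsto> - cnj z\<close> fixes \<open>tipD\<close> and changes the signs of \<open>tipN\<close> and of \<open>kerD\<close>.\<close>

lemma moment_even: "even m \<Longrightarrow> moment m = 0"
proof -
  assume m: "even m"
  have "moment m = (LINT p|hmeasure. tipN (- cnj p) * (opD ^^ m) tipD (- cnj p))"
    unfolding moment_def by (rule integral_reflect[symmetric]) measurable
  also have "\<dots> = - moment m"
    unfolding reflect_kernels opD_iter_reflect moment_def using m by simp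
  finally show ?thesis by simp
qed

lemma dirichlet_cmult:
  assumes "dirichlet P f f'" shows "dirichlet P (\<lambda>z. f z * c) (\<lambda>z. f' z * c)"
  unfolding dirichlet_def
proof (intro conjI allI impI)
  show "finite P" using assms by (simp add: dirichlet_def)
next
  fix z assume "Im z = 0" "z \<notin> P"
  then show "isCont (\<lambda>z. f z * c) z" "f z * c = 0"
    using assms by (auto simp: dirichlet_def)
next
  fix z assume z: "Im z > 0" "z \<notin> P"
  obtain D where D: "(f has_derivative D) (at z)" "f' z = D (\<i> * vfield z)"
    using dirichlet_derivative[OF assms z] .
  show "\<exists>E. ((\<lambda>z. f z * c) has_derivative E) (at z) \<and> f' z * c = E (\<i> * vfield z)"
    using has_derivative_mult_left[OF D(1), of c] D(2) by (intro exI[of _ "\<lambda>h. D h * c"]) simp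
qed

lemma dirichlet_tipD: "dirichlet {0} tipD tipD'"
  unfolding dirichlet_def
proof (intro conjI allI impI)
  fix z :: complex assume "Im z = 0" "z \<notin> {0}"
  then show "isCont tipD z" "tipD z = 0"
    unfolding tipD_def[abs_def] by (auto intro!: continuous_intros simp: Im_divide complex_eq_iff)
next
  fix z assume z: "Im z > 0" "z \<notin> {0}"
  have "((\<lambda>p. 1 / p) has_derivative (\<lambda>h. - (1 / z\<^sup>2) * h)) (at z)"
    using z by (auto intro!: derivative_eq_intros simp: power2_eq_square field_simps)
  from bounded_linear.has_derivative[OF bounded_linear_Im this]
  show "\<exists>D. (tipD has_derivative D) (at z) \<and> tipD' z = D (\<i> * vfield z)"
    unfolding tipD_def[abs_def] tipD'_def
    by (intro exI conjI) (assumption, simp add: times_divide_eq_right[symmetric] del: times_divide_eq_right)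
qed simp

lemma has_derivative_ln_cmod:
  assumes "z \<noteq> a"
  shows "((\<lambda>z. ln (cmod (z - a))) has_derivative (\<lambda>h. Re (h / (z - a)))) (at z)"
proof -
  have n: "((\<lambda>z. cmod (z - a)) has_derivative (\<lambda>h. (z - a) \<bullet> h / cmod (z - a))) (at z)"
  proof -
    have "((\<lambda>z. z - a) has_derivative (\<lambda>h. h)) (at z)" by (auto intro!: derivative_eq_intros)
    moreover have "(norm has_derivative (\<lambda>h. h \<bullet> sgn (z - a))) (at (z - a))"
      using assms by (intro has_derivative_norm) simp
    ultimately have "((\<lambda>z. cmod (z - a)) has_derivative (\<lambda>h. h \<bullet> sgn (z - a))) (at z)"
      by (rule has_derivative_compose)
    moreover have "(\<lambda>h. h \<bullet> sgn (z - a)) = (\<lambda>h. (z - a) \<bullet> h / cmod (z - a))"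
      by (auto simp: sgn_div_norm inner_commute divide_inverse)
    ultimately show ?thesis by simp
  qed
  have "((\<lambda>z. ln (cmod (z - a))) has_derivative (\<lambda>h. inverse (cmod (z - a)) * ((z - a) \<bullet> h / cmod (z - a)))) (at z)"
    using assms by (auto intro!: derivative_eq_intros n simp: field_simps)
  moreover have "inverse (cmod (z - a)) * ((z - a) \<bullet> h / cmod (z - a)) = Re (h / (z - a))" for h
  proof -
    have "Re (h / (z - a)) = ((z - a) \<bullet> h) / (cmod (z - a))\<^sup>2"
      by (simp add: Re_divide inner_complex_def cmod_power2 algebra_simps)
    then show ?thesis by (simp add: power2_eq_square divide_inverse)
  qed
  ultimately show ?thesis by simp
qed

lemma green_real: "Im z = 0 \<Longrightarrow> green p z = 0"
proof -
  assume "Im z = 0"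
  then have "cmod (z - p) = cmod (z - cnj p)" by (simp add: cmod_def)
  then show ?thesis by (simp add: green_def)
qed

lemma dirichlet_green:
  assumes "Im p > 0" shows "dirichlet {p} (green p) (\<lambda>q. - kerD p q)"
  unfolding dirichlet_def
proof (intro conjI allI impI)
  fix z :: complex assume z: "Im z = 0" "z \<notin> {p}"
  then show "green p z = 0" by (simp add: green_real)
  have "z \<noteq> cnj p" using z assms by auto
  then have "((green p) has_derivative (\<lambda>h. Re (h / (z - p)) - Re (h / (z - cnj p)))) (at z)"
    unfolding green_def[abs_def] using z by (intro has_derivative_diff has_derivative_ln_cmod) auto
  then show "isCont (green p) z" by (rule has_derivative_continuous)
next
  fix z assume z: "Im z > 0" "z \<notin> {p}"
  have "z \<noteq> cnj p" using z assms by auto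
  then have "((green p) has_derivative (\<lambda>h. Re (h / (z - p)) - Re (h / (z - cnj p)))) (at z)"
    unfolding green_def[abs_def] using z by (intro has_derivative_diff has_derivative_ln_cmod) auto
  moreover have "- kerD p z = Re ((\<i> * vfield z) / (z - p)) - Re ((\<i> * vfield z) / (z - cnj p))"
  proof -
    have "\<i> * vfield z / w = \<i> * (vfield z * (1 / w))" for w by simp
    then show ?thesis
      by (simp only: kerD_def right_diff_distrib minus_complex.simps Re_i_times minus_diff_eq)
  qed
  ultimately show "\<exists>D. (green p has_derivative D) (at z) \<and> - kerD p z = D (\<i> * vfield z)" by blast
qed simp

lemma green_commute: "green p q = green q p"
proof -
  have "cmod (q - cnj p) = cmod (p - cnj q)"
    by (metis complex_cnj_cnj complex_cnj_diff complex_mod_cnj norm_minus_commute)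
  then show ?thesis by (simp add: green_def norm_minus_commute)
qed

lemma vfield_centre: "q \<noteq> \<i> \<Longrightarrow> q \<noteq> - \<i> \<Longrightarrow> q \<noteq> 0 \<Longrightarrow> vfield q / (q - \<i>) - vfield q / (q - cnj \<i>) = \<i> / q"
proof -
  assume q: "q \<noteq> \<i>" "q \<noteq> - \<i>" "q \<noteq> 0"
  then have n: "q - \<i> \<noteq> 0" "q + \<i> \<noteq> 0" by (auto simp: eq_neg_iff_add_eq_0)
  have "vfield q = (q - \<i>) * (q + \<i>) / (2 * q)" using q by (simp add: vfield_def field_simps power2_eq_square)
  moreover have "x * y / w / x = y / w" "y * x / w / x = y / w" if "x \<noteq> 0" for x y w :: complex
    using that by simp_all
  ultimately have "vfield q / (q - \<i>) = (q + \<i>) / (2 * q)" "vfield q / (q + \<i>) = (q - \<i>) / (2 * q)"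
    using n by metis+
  moreover have "q - cnj \<i> = q + \<i>" by simp
  ultimately have "vfield q / (q - \<i>) - vfield q / (q - cnj \<i>) = ((q + \<i>) - (q - \<i>)) / (2 * q)"
    by (simp only: diff_divide_distrib)
  also have "\<dots> = \<i> / q" using q(3) by simp
  finally show ?thesis .
qed

lemma kerD_centre: "q \<noteq> \<i> \<Longrightarrow> q \<noteq> - \<i> \<Longrightarrow> q \<noteq> 0 \<Longrightarrow> kerD \<i> q = tipN q"
proof -
  assume "q \<noteq> \<i>" "q \<noteq> - \<i>" "q \<noteq> 0"
  then have "vfield q * (1 / (q - \<i>) - 1 / (q - cnj \<i>)) = \<i> / q"
    using vfield_centre[of q] by (simp only: right_diff_distrib times_divide_eq_right mult_1_right simp_thms)
  also have "\<i> / q = \<i> * (1 / q)" by simp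
  finally show ?thesis unfolding kerD_def tipN_def by (simp only: Im_i_times)
qed

lemma dirichlet_pole: "dirichlet {\<i>} pole tipN"
proof -
  have d: "dirichlet {\<i>} (\<lambda>z. green \<i> z * - 1) (\<lambda>z. - kerD \<i> z * - 1)"
    by (intro dirichlet_cmult dirichlet_green) simp
  have e: "kerD \<i> z = tipN z" if "Im z > 0" "z \<noteq> \<i>" for z
    using that by (intro kerD_centre) auto
  show ?thesis using d e unfolding dirichlet_def pole_def[abs_def] by simp
qed

text \<open>Iterates of \<open>\<partial>\<^sub>A\<close> after Green's operator, applied to \<open>tipN\<close>; this operator is minus the transpose of
  \<open>opD\<close>.\<close>

primrec dual_iter :: "nat \<Rightarrow> complex \<Rightarrow> real" where
  "dual_iter 0 = tipN"
| "dual_iter (Suc j) = (\<lambda>p. LINT q|hmeasure. - kerD q p * dual_iter j q)"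

lemma measurable_dual [measurable]: "dual_iter j \<in> borel_measurable borel"
proof (induction j)
  case (Suc j)
  note [measurable] = Suc
  interpret sigma_finite_measure hmeasure by (rule sigma_finite_hmeasure)
  have "(\<lambda>p. LINT q|hmeasure. - kerD q p * dual_iter j q) \<in> borel_measurable hmeasure" by measurable
  then show ?case by (simp add: measurable_cong_sets[OF sets_hmeasure refl])
qed simp

lemma abs_dual_le:
  assumes "Im p > 0" "p \<noteq> \<i>"
  shows "\<bar>dual_iter j p\<bar> \<le> 2 * (4 * riesz_const) ^ j * wU p"
  using assms
proof (induction j arbitrary: p)
  case 0 then show ?case using abs_tipN_le by simp
next
  case (Suc j)
  define K where "K = 2 * (4 * riesz_const) ^ j"
  have K: "K \<ge> 0" using riesz_const_pos by (simp add: K_def)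
  have K': "K * (4 * riesz_const) = 2 * (4 * riesz_const) ^ Suc j" by (simp add: K_def)
  have [measurable]: "(\<lambda>q. kerD q p) \<in> borel_measurable borel" unfolding kerD_def by measurable
  have "ennreal \<bar>dual_iter (Suc j) p\<bar> = ennreal \<bar>kernel_op hmeasure (\<lambda>p q. - kerD q p) (dual_iter j) p\<bar>"
    by (simp add: kernel_op_def)
  also have "\<dots> \<le> (\<integral>\<^sup>+q. ennreal \<bar>- kerD q p\<bar> * ennreal \<bar>dual_iter j q\<bar> \<partial>hmeasure)"
    by (rule abs_kernel_op_le)
  also have "\<dots> \<le> (\<integral>\<^sup>+q. ennreal K * ennreal (\<bar>kerD q p\<bar> * wU q) \<partial>hmeasure)"
  proof (rule nn_integral_mono_AE, rule eventually_mono[OF AE_hmeasure_generic[of p]])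
    fix q assume q: "Im q > 0 \<and> q \<noteq> \<i> \<and> q \<noteq> p"
    have "\<bar>kerD q p\<bar> * \<bar>dual_iter j q\<bar> \<le> \<bar>kerD q p\<bar> * (K * wU q)"
      using q Suc.IH[of q] by (intro mult_left_mono) (auto simp: K_def)
    then show "ennreal \<bar>- kerD q p\<bar> * ennreal \<bar>dual_iter j q\<bar> \<le> ennreal K * ennreal (\<bar>kerD q p\<bar> * wU q)"
      using K by (simp add: mult_ac flip: ennreal_mult')
  qed
  also have "\<dots> = ennreal K * (\<integral>\<^sup>+q. ennreal (\<bar>kerD q p\<bar> * wU q) \<partial>hmeasure)"
    by (rule nn_integral_cmult) measurable
  also have "\<dots> \<le> ennreal K * ennreal (4 * riesz_const * wU p)"
    by (intro mult_left_mono kerD_kernel_bound Suc.prems) auto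
  also have "\<dots> = ennreal (2 * (4 * riesz_const) ^ Suc j * wU p)"
    unfolding K'[symmetric] using K by (simp add: mult.assoc flip: ennreal_mult')
  finally show ?case using riesz_const_pos by (subst (asm) ennreal_le_iff) auto
qed

lemma nn_integral_green_dual:
  assumes "Im p > 0" "p \<noteq> \<i>"
  shows "(\<integral>\<^sup>+q. ennreal \<bar>green p q * dual_iter j q\<bar> \<partial>hmeasure) \<le> ennreal (2 * (4 * riesz_const) ^ Suc j * (Im p * wV p))"
proof -
  define K where "K = 2 * (4 * riesz_const) ^ j"
  have K: "K \<ge> 0" using riesz_const_pos by (simp add: K_def)
  have K': "K * (4 * riesz_const) = 2 * (4 * riesz_const) ^ Suc j" by (simp add: K_def)
  have [measurable]: "green p \<in> borel_measurable borel" unfolding green_def[abs_def] by measurable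
  have "(\<integral>\<^sup>+q. ennreal \<bar>green p q * dual_iter j q\<bar> \<partial>hmeasure) \<le> (\<integral>\<^sup>+q. ennreal K * ennreal (\<bar>green p q\<bar> * wU q) \<partial>hmeasure)"
  proof (rule nn_integral_mono_AE, rule eventually_mono[OF AE_hmeasure_generic[of p]])
    fix q assume q: "Im q > 0 \<and> q \<noteq> \<i> \<and> q \<noteq> p"
    have "\<bar>green p q\<bar> * \<bar>dual_iter j q\<bar> \<le> \<bar>green p q\<bar> * (K * wU q)"
      using q abs_dual_le[of q j] by (intro mult_left_mono) (auto simp: K_def)
    then show "ennreal \<bar>green p q * dual_iter j q\<bar> \<le> ennreal K * ennreal (\<bar>green p q\<bar> * wU q)"
      using K by (simp add: mult_ac abs_mult flip: ennreal_mult')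
  qed
  also have "\<dots> = ennreal K * (\<integral>\<^sup>+q. ennreal (\<bar>green p q\<bar> * wU q) \<partial>hmeasure)"
    by (rule nn_integral_cmult) measurable
  also have "\<dots> \<le> ennreal K * ennreal (4 * riesz_const * (Im p * wV p))"
    by (intro mult_left_mono kerD_kernel_bound assms) auto
  also have "\<dots> = ennreal (2 * (4 * riesz_const) ^ Suc j * (Im p * wV p))"
    unfolding K'[symmetric] using K by (simp add: mult.assoc flip: ennreal_mult')
  finally show ?thesis .
qed

lemma nn_integral_real_bound:
  assumes "w \<in> borel_measurable borel" "\<And>q. Im q > 0 \<Longrightarrow> q \<noteq> \<i> \<Longrightarrow> q \<noteq> p \<Longrightarrow> (f q :: ennreal) \<le> ennreal K * ennreal (w q)"
    and "(\<integral>\<^sup>+q. ennreal (w q) \<partial>hmeasure) \<le> ennreal B"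
  shows "(\<integral>\<^sup>+q. f q \<partial>hmeasure) \<le> ennreal K * ennreal B"
proof -
  have "(\<integral>\<^sup>+q. f q \<partial>hmeasure) \<le> (\<integral>\<^sup>+q. ennreal K * ennreal (w q) \<partial>hmeasure)"
    using assms(2) by (intro nn_integral_mono_AE eventually_mono[OF AE_hmeasure_generic[of p]]) auto
  also have "\<dots> = ennreal K * (\<integral>\<^sup>+q. ennreal (w q) \<partial>hmeasure)"
    using assms(1) by (intro nn_integral_cmult) auto
  also have "\<dots> \<le> ennreal K * ennreal B" using assms(3) by (intro mult_left_mono) auto
  finally show ?thesis .
qed

lemma measurable_kernel_sections [measurable]:
  "kerD p \<in> borel_measurable borel" "(\<lambda>q. kerD q p) \<in> borel_measurable borel"
  "green p \<in> borel_measurable borel" "(\<lambda>q. green q p) \<in> borel_measurable borel"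
  unfolding kerD_def[abs_def] green_def[abs_def] by measurable

lemma green_dual_nn:
  fixes F :: "complex \<Rightarrow> real"
  assumes [measurable]: "F \<in> borel_measurable borel"
    and B: "(\<integral>\<^sup>+p. ennreal (\<bar>F p\<bar> * (Im p * wV p)) \<partial>hmeasure) \<le> ennreal B"
  shows "(\<integral>\<^sup>+p. \<integral>\<^sup>+q. ennreal \<bar>F p * (green p q * dual_iter j q)\<bar> \<partial>hmeasure \<partial>hmeasure) < \<infinity>"
proof -
  define K where "K = 2 * (4 * riesz_const) ^ Suc j"
  have K: "K \<ge> 0" using riesz_const_pos by (simp add: K_def)
  have "(\<integral>\<^sup>+p. \<integral>\<^sup>+q. ennreal \<bar>F p * (green p q * dual_iter j q)\<bar> \<partial>hmeasure \<partial>hmeasure) \<le> ennreal K * ennreal B"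
  proof (rule nn_integral_real_bound[OF _ _ B])
    fix p assume p: "Im p > 0" "p \<noteq> \<i>"
    have "(\<integral>\<^sup>+q. ennreal \<bar>F p * (green p q * dual_iter j q)\<bar> \<partial>hmeasure) = ennreal \<bar>F p\<bar> * (\<integral>\<^sup>+q. ennreal \<bar>green p q * dual_iter j q\<bar> \<partial>hmeasure)"
      by (subst nn_integral_cmult[symmetric]) (auto simp: abs_mult ennreal_mult')
    also have "\<dots> \<le> ennreal \<bar>F p\<bar> * ennreal (K * (Im p * wV p))"
      using nn_integral_green_dual[OF p, of j] by (intro mult_left_mono) (auto simp: K_def)
    also have "\<dots> = ennreal K * ennreal (\<bar>F p\<bar> * (Im p * wV p))"
      using K p by (simp add: mult_ac flip: ennreal_mult')
    finally show "(\<integral>\<^sup>+q. ennreal \<bar>F p * (green p q * dual_iter j q)\<bar> \<partial>hmeasure) \<le> ennreal K * ennreal (\<bar>F p\<bar> * (Im p * wV p))" .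
  qed measurable
  then show ?thesis by (rule order.strict_trans1) (simp add: ennreal_mult_less_top)
qed

lemma kerD_dual_nn:
  fixes F :: "complex \<Rightarrow> real"
  assumes [measurable]: "F \<in> borel_measurable borel"
    and B: "(\<integral>\<^sup>+p. ennreal (\<bar>F p\<bar> * wU p) \<partial>hmeasure) \<le> ennreal B"
  shows "(\<integral>\<^sup>+p. \<integral>\<^sup>+q. ennreal \<bar>F p * (- kerD q p * dual_iter j q)\<bar> \<partial>hmeasure \<partial>hmeasure) < \<infinity>"
proof -
  define K where "K = 2 * (4 * riesz_const) ^ j"
  have K: "K \<ge> 0" using riesz_const_pos by (simp add: K_def)
  have "(\<integral>\<^sup>+p. \<integral>\<^sup>+q. ennreal \<bar>F p * (- kerD q p * dual_iter j q)\<bar> \<partial>hmeasure \<partial>hmeasure) \<le> ennreal (K * (4 * riesz_const)) * ennreal B"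
  proof (rule nn_integral_real_bound[OF _ _ B])
    fix p assume p: "Im p > 0" "p \<noteq> \<i>"
    have "(\<integral>\<^sup>+q. ennreal \<bar>kerD q p * dual_iter j q\<bar> \<partial>hmeasure) \<le> ennreal K * ennreal (4 * riesz_const * wU p)"
    proof (rule nn_integral_real_bound[OF _ _ kerD_kernel_bound(4)[OF p]])
      fix q assume q: "Im q > 0" "q \<noteq> \<i>"
      have "\<bar>kerD q p\<bar> * \<bar>dual_iter j q\<bar> \<le> \<bar>kerD q p\<bar> * (K * wU q)"
        using abs_dual_le[OF q, of j] by (intro mult_left_mono) (auto simp: K_def)
      then show "ennreal \<bar>kerD q p * dual_iter j q\<bar> \<le> ennreal K * ennreal (\<bar>kerD q p\<bar> * wU q)"
        using K by (simp add: mult_ac abs_mult flip: ennreal_mult')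
    qed measurable
    then have "ennreal \<bar>F p\<bar> * (\<integral>\<^sup>+q. ennreal \<bar>kerD q p * dual_iter j q\<bar> \<partial>hmeasure) \<le> ennreal \<bar>F p\<bar> * (ennreal K * ennreal (4 * riesz_const * wU p))"
      by (rule mult_left_mono) simp
    moreover have "(\<integral>\<^sup>+q. ennreal \<bar>F p * (- kerD q p * dual_iter j q)\<bar> \<partial>hmeasure) = ennreal \<bar>F p\<bar> * (\<integral>\<^sup>+q. ennreal \<bar>kerD q p * dual_iter j q\<bar> \<partial>hmeasure)"
      by (subst nn_integral_cmult[symmetric]) (auto simp: abs_mult ennreal_mult')
    moreover have "ennreal \<bar>F p\<bar> * (ennreal K * ennreal (4 * riesz_const * wU p)) = ennreal (K * (4 * riesz_const)) * ennreal (\<bar>F p\<bar> * wU p)"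
      using K riesz_const_pos by (simp add: mult_ac flip: ennreal_mult')
    ultimately show "(\<integral>\<^sup>+q. ennreal \<bar>F p * (- kerD q p * dual_iter j q)\<bar> \<partial>hmeasure) \<le> ennreal (K * (4 * riesz_const)) * ennreal (\<bar>F p\<bar> * wU p)"
      by simp
  qed measurable
  then show ?thesis by (rule order.strict_trans1) (simp add: ennreal_mult_less_top)
qed

text \<open>Moves one derivative \<open>\<partial>\<^sub>A\<close> from \<open>F\<close> to the Green function.  For almost every \<open>q\<close> the integration by parts
  in \<open>p\<close> has finitely many singularities, and Fubini's theorem exchanges the order.\<close>

lemma green_by_parts:
  fixes F F' :: "complex \<Rightarrow> real"
  assumes F: "dirichlet P F F'" and [measurable]: "F \<in> borel_measurable borel" "F' \<in> borel_measurable borel"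
    and B: "(\<integral>\<^sup>+p. ennreal (\<bar>F' p\<bar> * (Im p * wV p)) \<partial>hmeasure) \<le> ennreal B"
           "(\<integral>\<^sup>+p. ennreal (\<bar>F p\<bar> * wU p) \<partial>hmeasure) \<le> ennreal B'"
  shows "(LINT p|hmeasure. F' p * (LINT q|hmeasure. green p q * dual_iter j q)) = - (LINT p|hmeasure. F p * dual_iter (Suc j) p)"
proof -
  interpret sigma_finite_measure hmeasure by (rule sigma_finite_hmeasure)
  let ?f1 = "\<lambda>p q. F' p * (green p q * dual_iter j q)" and ?f2 = "\<lambda>p q. F p * (- kerD q p * dual_iter j q)"
  have m1: "case_prod ?f1 \<in> borel_measurable (hmeasure \<Otimes>\<^sub>M hmeasure)" by measurable
  have m2: "case_prod ?f2 \<in> borel_measurable (hmeasure \<Otimes>\<^sub>M hmeasure)" by measurable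
  note F1 = Fubini_nn_finite[OF sigma_finite_hmeasure m1 green_dual_nn[OF _ B(1)]]
  note F2 = Fubini_nn_finite[OF sigma_finite_hmeasure m2 kerD_dual_nn[OF _ B(2)]]
  have "(LINT p|hmeasure. F' p * (LINT q|hmeasure. green p q * dual_iter j q)) = (LINT p|hmeasure. LINT q|hmeasure. ?f1 p q)"
    by simp
  also have "\<dots> = (LINT q|hmeasure. LINT p|hmeasure. ?f1 p q)" by (rule F1(1)) measurable
  also have "\<dots> = (LINT q|hmeasure. - (LINT p|hmeasure. ?f2 p q))"
  proof (rule integral_cong_AE)
    have "AE q in hmeasure. integrable hmeasure (\<lambda>p. ?f1 p q)" by (rule F1(2)) measurable
    moreover have "AE q in hmeasure. integrable hmeasure (\<lambda>p. ?f2 p q)" by (rule F2(2)) measurable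
    ultimately show "AE q in hmeasure. (LINT p|hmeasure. ?f1 p q) = - (LINT p|hmeasure. ?f2 p q)"
      using AE_hmeasure_generic[of \<i>]
    proof eventually_elim
      case (elim q)
      have "dirichlet {q} (\<lambda>p. green q p * dual_iter j q) (\<lambda>p. - kerD q p * dual_iter j q)"
        using elim by (intro dirichlet_cmult dirichlet_green) simp
      from dirichlet_mult[OF F this]
      have d: "dirichlet (P \<union> {q}) (\<lambda>p. F p * (green q p * dual_iter j q)) (\<lambda>p. ?f1 p q + ?f2 p q)"
        by (simp add: green_commute)
      have "(LINT p|hmeasure. ?f1 p q + ?f2 p q) = 0"
        using elim by (intro integral_dirichlet_derivative[OF d] Bochner_Integration.integrable_add) simp_all
      then show ?case
        using elim by (subst (asm) Bochner_Integration.integral_add) auto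
    qed
  qed (simp_all only: measurable_cong_sets[OF sets_hmeasure refl], measurable)
  also have "\<dots> = - (LINT q|hmeasure. LINT p|hmeasure. ?f2 p q)" by simp
  also have "(LINT q|hmeasure. LINT p|hmeasure. ?f2 p q) = (LINT p|hmeasure. LINT q|hmeasure. ?f2 p q)"
    by (rule F2(1)[symmetric]) measurable
  finally show ?thesis by simp
qed

text \<open>In \<open>G \<partial>\<^sub>A G \<partial>\<^sub>A \<dots> G \<partial>\<^sub>A \<delta>\<close> every \<open>\<partial>\<^sub>A\<close> is regrouped with the Green operator to its right, and the last
  one acts on \<open>\<delta>\<close>, giving \<open>tipN\<close>.  At the level of kernels each step is one integration by parts.\<close>

lemma opD_pole_eq_green_dual:
  assumes "Im r > 0" "r \<noteq> \<i>"
  shows "(opD ^^ Suc j) pole r = (LINT q|hmeasure. green r q * dual_iter j q)"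
  using assms
proof (induction j arbitrary: r)
  case 0
  have d: "dirichlet ({r} \<union> {\<i>}) (\<lambda>q. green r q * pole q) (\<lambda>q. - kerD r q * pole q + green r q * tipN q)"
    using 0 by (intro dirichlet_mult dirichlet_green dirichlet_pole)
  have i1: "integrable hmeasure (\<lambda>q. - kerD r q * pole q)"
  proof (rule integrableI_bounded)
    have "(\<integral>\<^sup>+q. ennreal (norm (- kerD r q * pole q)) \<partial>hmeasure) \<le> ennreal 3 * ennreal (4 * riesz_const * wV r)"
    proof (rule nn_integral_real_bound[OF _ _ kerD_kernel_bound(1)[OF 0]])
      fix q assume q: "Im q > 0" "q \<noteq> \<i>"
      have "\<bar>kerD r q\<bar> * \<bar>pole q\<bar> \<le> \<bar>kerD r q\<bar> * (3 * wW q)"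
        using abs_pole_le[OF q] wV_le_wW[OF q(1)] by (intro mult_left_mono) auto
      then show "ennreal (norm (- kerD r q * pole q)) \<le> ennreal 3 * ennreal (\<bar>kerD r q\<bar> * wW q)"
        by (simp add: abs_mult mult_ac flip: ennreal_mult' ennreal_numeral)
    qed measurable
    then show "(\<integral>\<^sup>+q. ennreal (norm (- kerD r q * pole q)) \<partial>hmeasure) < \<infinity>"
      by (rule order.strict_trans1) (simp add: ennreal_mult_less_top)
  qed measurable
  have i2: "integrable hmeasure (\<lambda>q. green r q * tipN q)"
  proof (rule integrableI_bounded)
    show "(\<integral>\<^sup>+q. ennreal (norm (green r q * tipN q)) \<partial>hmeasure) < \<infinity>"
      using nn_integral_green_dual[OF 0, of 0] by (auto intro: order.strict_trans1)
  qed measurable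
  have "(LINT q|hmeasure. - kerD r q * pole q + green r q * tipN q) = 0"
    by (intro integral_dirichlet_derivative[OF d] Bochner_Integration.integrable_add i1 i2)
  then show ?case using i1 i2 by (simp add: kernel_op_def Bochner_Integration.integral_add)
next
  case (Suc j)
  have "(opD ^^ Suc (Suc j)) pole r = (LINT p|hmeasure. kerD r p * (opD ^^ Suc j) pole p)"
    by (simp add: kernel_op_def)
  also have "\<dots> = (LINT p|hmeasure. kerD r p * (LINT q|hmeasure. green p q * dual_iter j q))"
  proof (rule integral_cong_AE)
    show "AE p in hmeasure. kerD r p * (opD ^^ Suc j) pole p = kerD r p * (LINT q|hmeasure. green p q * dual_iter j q)"
      using AE_hmeasure_generic[of \<i>] by (rule eventually_mono) (use Suc.IH in auto)
    interpret sigma_finite_measure hmeasure by (rule sigma_finite_hmeasure)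
    show "(\<lambda>p. kerD r p * (opD ^^ Suc j) pole p) \<in> borel_measurable hmeasure"
      "(\<lambda>p. kerD r p * (LINT q|hmeasure. green p q * dual_iter j q)) \<in> borel_measurable hmeasure"
      by (simp_all only: measurable_cong_sets[OF sets_hmeasure refl]) measurable
  qed
  also have "\<dots> = - (LINT p|hmeasure. - kerD r p * (LINT q|hmeasure. green p q * dual_iter j q))" by simp
  also have "\<dots> = (LINT p|hmeasure. green r p * dual_iter (Suc j) p)"
    using kerD_kernel_bound(2,3)[OF Suc.prems]
    by (subst green_by_parts[OF dirichlet_green[OF Suc.prems(1)]]) auto
  finally show ?case .
qed

lemma tipD'_opD_pole:
  "(LINT p|hmeasure. tipD' p * (opD ^^ m) pole p) = - (LINT p|hmeasure. tipD p * dual_iter m p)"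
proof (cases m)
  case 0
  have d: "dirichlet ({0} \<union> {\<i>}) (\<lambda>q. tipD q * pole q) (\<lambda>q. tipD' q * pole q + tipD q * tipN q)"
    by (intro dirichlet_mult dirichlet_tipD dirichlet_pole)
  have i1: "integrable hmeasure (\<lambda>q. tipD' q * pole q)"
  proof (rule integrableI_bounded)
    have "(\<integral>\<^sup>+q. ennreal (norm (tipD' q * pole q)) \<partial>hmeasure) \<le> ennreal 3 * ennreal (4 * riesz_const)"
    proof (rule nn_integral_real_bound[OF _ _ tipD'_wV_bound])
      fix q assume q: "Im q > 0" "q \<noteq> \<i>"
      have "\<bar>tipD' q\<bar> * \<bar>pole q\<bar> \<le> \<bar>tipD' q\<bar> * (3 * wV q)"
        using abs_pole_le[OF q] by (intro mult_left_mono) auto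
      then show "ennreal (norm (tipD' q * pole q)) \<le> ennreal 3 * ennreal (\<bar>tipD' q\<bar> * wV q)"
        by (simp add: abs_mult mult_ac flip: ennreal_mult' ennreal_numeral)
    qed measurable
    then show "(\<integral>\<^sup>+q. ennreal (norm (tipD' q * pole q)) \<partial>hmeasure) < \<infinity>"
      by (rule order.strict_trans1) (simp add: ennreal_mult_less_top)
  qed measurable
  have i2: "integrable hmeasure (\<lambda>q. tipD q * tipN q)"
  proof (rule integrableI_bounded)
    have "(\<integral>\<^sup>+q. ennreal (norm (tipD q * tipN q)) \<partial>hmeasure) \<le> ennreal 2 * ennreal (4 * riesz_const)"
    proof (rule nn_integral_real_bound[OF _ _ tipD_wU_bound])
      fix q assume q: "Im q > 0" "q \<noteq> \<i>"
      have "\<bar>tipD q\<bar> * \<bar>tipN q\<bar> \<le> \<bar>tipD q\<bar> * (2 * wU q)"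
        using abs_tipN_le[OF q] by (intro mult_left_mono) auto
      then show "ennreal (norm (tipD q * tipN q)) \<le> ennreal 2 * ennreal (\<bar>tipD q\<bar> * wU q)"
        by (simp add: abs_mult mult_ac flip: ennreal_mult' ennreal_numeral)
    qed measurable
    then show "(\<integral>\<^sup>+q. ennreal (norm (tipD q * tipN q)) \<partial>hmeasure) < \<infinity>"
      by (rule order.strict_trans1) (simp add: ennreal_mult_less_top)
  qed measurable
  have "(LINT q|hmeasure. tipD' q * pole q + tipD q * tipN q) = 0"
    by (intro integral_dirichlet_derivative[OF d] Bochner_Integration.integrable_add i1 i2)
  then show ?thesis using i1 i2 0 by (simp add: Bochner_Integration.integral_add)
next
  case (Suc j)
  have "(LINT p|hmeasure. tipD' p * (opD ^^ Suc j) pole p) = (LINT p|hmeasure. tipD' p * (LINT q|hmeasure. green p q * dual_iter j q))"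
  proof (rule integral_cong_AE)
    show "AE p in hmeasure. tipD' p * (opD ^^ Suc j) pole p = tipD' p * (LINT q|hmeasure. green p q * dual_iter j q)"
      using AE_hmeasure_generic[of \<i>] by (rule eventually_mono) (use opD_pole_eq_green_dual in auto)
    interpret sigma_finite_measure hmeasure by (rule sigma_finite_hmeasure)
    show "(\<lambda>p. tipD' p * (opD ^^ Suc j) pole p) \<in> borel_measurable hmeasure"
      "(\<lambda>p. tipD' p * (LINT q|hmeasure. green p q * dual_iter j q)) \<in> borel_measurable hmeasure"
      by (simp_all only: measurable_cong_sets[OF sets_hmeasure refl]) measurable
  qed
  also have "\<dots> = - (LINT p|hmeasure. tipD p * dual_iter (Suc j) p)"
    using tipD'_Im_wV_bound tipD_wU_bound by (intro green_by_parts[OF dirichlet_tipD]) auto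
  finally show ?thesis using Suc by simp
qed

text \<open>Absolute values are iterated separately: the weights \<open>wU\<close> and \<open>wW\<close> are not dual to each other near the
  centre, so the pairing of the iterates is controlled by Tonelli's theorem instead.\<close>

primrec nnDual :: "nat \<Rightarrow> complex \<Rightarrow> ennreal" where
  "nnDual 0 = (\<lambda>p. ennreal \<bar>tipN p\<bar>)"
| "nnDual (Suc j) = (\<lambda>p. \<integral>\<^sup>+q. ennreal \<bar>kerD q p\<bar> * nnDual j q \<partial>hmeasure)"

primrec nnIter :: "nat \<Rightarrow> complex \<Rightarrow> ennreal" where
  "nnIter 0 = (\<lambda>p. ennreal \<bar>tipD p\<bar>)"
| "nnIter (Suc j) = (\<lambda>p. \<integral>\<^sup>+q. ennreal \<bar>kerD p q\<bar> * nnIter j q \<partial>hmeasure)"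

lemma measurable_nnDual [measurable]: "nnDual j \<in> borel_measurable borel"
proof (induction j)
  case (Suc j)
  note [measurable] = Suc
  interpret sigma_finite_measure hmeasure by (rule sigma_finite_hmeasure)
  have "nnDual (Suc j) \<in> borel_measurable hmeasure" by simp
  then show ?case by (simp only: measurable_cong_sets[OF sets_hmeasure refl])
qed simp

lemma measurable_nnIter [measurable]: "nnIter j \<in> borel_measurable borel"
proof (induction j)
  case (Suc j)
  note [measurable] = Suc
  interpret sigma_finite_measure hmeasure by (rule sigma_finite_hmeasure)
  have "nnIter (Suc j) \<in> borel_measurable hmeasure" by simp
  then show ?case by (simp only: measurable_cong_sets[OF sets_hmeasure refl])
qed simp

lemma abs_dual_le_nn: "ennreal \<bar>dual_iter j p\<bar> \<le> nnDual j p"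
proof (induction j arbitrary: p)
  case (Suc j)
  have "ennreal \<bar>dual_iter (Suc j) p\<bar> = ennreal \<bar>kernel_op hmeasure (\<lambda>p q. - kerD q p) (dual_iter j) p\<bar>"
    by (simp add: kernel_op_def)
  also have "\<dots> \<le> (\<integral>\<^sup>+q. ennreal \<bar>- kerD q p\<bar> * ennreal \<bar>dual_iter j q\<bar> \<partial>hmeasure)" by (rule abs_kernel_op_le)
  also have "\<dots> \<le> nnDual (Suc j) p" using Suc by (auto intro!: nn_integral_mono mult_left_mono)
  finally show ?case .
qed simp

lemma abs_opD_le_nn: "ennreal \<bar>(opD ^^ j) tipD p\<bar> \<le> nnIter j p"
proof (induction j arbitrary: p)
  case (Suc j)
  have "ennreal \<bar>(opD ^^ Suc j) tipD p\<bar> \<le> (\<integral>\<^sup>+q. ennreal \<bar>kerD p q\<bar> * ennreal \<bar>(opD ^^ j) tipD q\<bar> \<partial>hmeasure)"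
    by (simp add: abs_kernel_op_le)
  also have "\<dots> \<le> nnIter (Suc j) p" using Suc by (auto intro!: nn_integral_mono mult_left_mono)
  finally show ?case .
qed simp

lemma nnDual_nnIter_shift:
  "(\<integral>\<^sup>+p. nnDual (Suc j) p * nnIter i p \<partial>hmeasure) = (\<integral>\<^sup>+q. nnDual j q * nnIter (Suc i) q \<partial>hmeasure)"
proof -
  interpret sigma_finite_measure hmeasure by (rule sigma_finite_hmeasure)
  interpret pair_sigma_finite hmeasure hmeasure ..
  have "(\<integral>\<^sup>+p. nnDual (Suc j) p * nnIter i p \<partial>hmeasure)
     = (\<integral>\<^sup>+p. \<integral>\<^sup>+q. ennreal \<bar>kerD q p\<bar> * nnDual j q * nnIter i p \<partial>hmeasure \<partial>hmeasure)"
    by (simp add: nn_integral_multc)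
  also have "\<dots> = (\<integral>\<^sup>+q. \<integral>\<^sup>+p. ennreal \<bar>kerD q p\<bar> * nnDual j q * nnIter i p \<partial>hmeasure \<partial>hmeasure)"
    by (rule Fubini') measurable
  also have "\<dots> = (\<integral>\<^sup>+q. nnDual j q * nnIter (Suc i) q \<partial>hmeasure)"
    by (simp add: nn_integral_cmult[symmetric] mult_ac)
  finally show ?thesis .
qed

lemma nnIter_le:
  assumes "Im p > 0" "p \<noteq> \<i>" shows "nnIter i p \<le> ennreal ((4 * riesz_const) ^ i * wW p)"
  using assms
proof (induction i arbitrary: p)
  case 0 then show ?case using abs_tipD_le by (simp add: ennreal_leI)
next
  case (Suc i)
  define K where "K = (4 * riesz_const) ^ i"
  have K: "K \<ge> 0" using riesz_const_pos by (simp add: K_def)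
  have "nnIter (Suc i) p \<le> ennreal K * ennreal (4 * riesz_const * wV p)"
    unfolding nnIter.simps
  proof (rule nn_integral_real_bound[OF _ _ kerD_kernel_bound(1)[OF Suc.prems]])
    fix q assume q: "Im q > 0" "q \<noteq> \<i>"
    have "ennreal \<bar>kerD p q\<bar> * nnIter i q \<le> ennreal \<bar>kerD p q\<bar> * ennreal (K * wW q)"
      using Suc.IH[OF q] by (intro mult_left_mono) (auto simp: K_def)
    then show "ennreal \<bar>kerD p q\<bar> * nnIter i q \<le> ennreal K * ennreal (\<bar>kerD p q\<bar> * wW q)"
      using K by (simp add: mult_ac flip: ennreal_mult')
  qed measurable
  also have "\<dots> = ennreal ((4 * riesz_const) ^ Suc i * wV p)"
    unfolding power_Suc2 K_def[symmetric] using K by (simp add: mult.assoc flip: ennreal_mult')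
  also have "\<dots> \<le> ennreal ((4 * riesz_const) ^ Suc i * wW p)"
    using riesz_const_pos wV_le_wW[OF Suc.prems(1)] by (intro ennreal_leI mult_left_mono) auto
  finally show ?case .
qed

text \<open>By Tonelli's theorem the pairing depends on \<open>i + j\<close> only, and for \<open>j = 0\<close> the weights suffice.\<close>

lemma nnDual_nnIter_finite: "(\<integral>\<^sup>+p. nnDual j p * nnIter i p \<partial>hmeasure) < \<infinity>"
proof (induction j arbitrary: i)
  case 0
  define K where "K = (4 * riesz_const) ^ i"
  have K: "K \<ge> 0" using riesz_const_pos by (simp add: K_def)
  have "(\<integral>\<^sup>+p. nnDual 0 p * nnIter i p \<partial>hmeasure) \<le> ennreal K * ennreal (4 * riesz_const)"
  proof (rule nn_integral_real_bound[OF _ _ tipN_wW_bound])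
    fix q assume q: "Im q > 0" "q \<noteq> \<i>"
    have "ennreal \<bar>tipN q\<bar> * nnIter i q \<le> ennreal \<bar>tipN q\<bar> * ennreal (K * wW q)"
      using nnIter_le[OF q, of i] by (intro mult_left_mono) (auto simp: K_def)
    then show "nnDual 0 q * nnIter i q \<le> ennreal K * ennreal (\<bar>tipN q\<bar> * wW q)"
      using K by (simp add: mult_ac flip: ennreal_mult')
  qed measurable
  then show ?case by (rule order.strict_trans1) (simp add: ennreal_mult_less_top)
qed (simp only: nnDual_nnIter_shift)

lemma dual_shift:
  "(LINT p|hmeasure. (opD ^^ i) tipD p * dual_iter (Suc j) p) = - (LINT q|hmeasure. (opD ^^ Suc i) tipD q * dual_iter j q)"
proof -
  let ?f = "\<lambda>p q. (opD ^^ i) tipD p * (- kerD q p * dual_iter j q)"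
  have m: "case_prod ?f \<in> borel_measurable (hmeasure \<Otimes>\<^sub>M hmeasure)" by measurable
  have "(\<integral>\<^sup>+p. \<integral>\<^sup>+q. ennreal \<bar>?f p q\<bar> \<partial>hmeasure \<partial>hmeasure)
     \<le> (\<integral>\<^sup>+p. \<integral>\<^sup>+q. nnIter i p * (ennreal \<bar>kerD q p\<bar> * nnDual j q) \<partial>hmeasure \<partial>hmeasure)"
    using abs_opD_le_nn abs_dual_le_nn
    by (auto intro!: nn_integral_mono mult_mono simp: abs_mult ennreal_mult')
  also have "\<dots> = (\<integral>\<^sup>+p. nnDual (Suc j) p * nnIter i p \<partial>hmeasure)"
    by (simp add: nn_integral_cmult mult.commute)
  finally have fin: "(\<integral>\<^sup>+p. \<integral>\<^sup>+q. ennreal \<bar>?f p q\<bar> \<partial>hmeasure \<partial>hmeasure) < \<infinity>"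
    using nnDual_nnIter_finite by (rule order.strict_trans1)
  have "(LINT p|hmeasure. (opD ^^ i) tipD p * dual_iter (Suc j) p) = (LINT p|hmeasure. LINT q|hmeasure. ?f p q)"
    by simp
  also have "\<dots> = (LINT q|hmeasure. LINT p|hmeasure. ?f p q)"
    by (rule Fubini_nn_finite[OF sigma_finite_hmeasure m fin])
  also have "\<dots> = (LINT q|hmeasure. - ((opD ^^ Suc i) tipD q * dual_iter j q))"
  proof (rule Bochner_Integration.integral_cong[OF refl])
    fix q
    have "(LINT p|hmeasure. ?f p q) = (LINT p|hmeasure. - dual_iter j q * (kerD q p * (opD ^^ i) tipD p))"
      by (rule Bochner_Integration.integral_cong) auto
    then show "(LINT p|hmeasure. ?f p q) = - ((opD ^^ Suc i) tipD q * dual_iter j q)"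
      by (simp only: integral_mult_right_zero) (simp add: kernel_op_def)
  qed
  finally show ?thesis by simp
qed

lemma tipD'_moment:
  "(LINT p|hmeasure. tipD' p * (opD ^^ m) pole p) = - ((- 1) ^ m * moment m)"
proof -
  have "(LINT p|hmeasure. (opD ^^ i) tipD p * dual_iter j p) = (- 1) ^ j * moment (i + j)" for i j
  proof (induction j arbitrary: i)
    case 0 then show ?case by (simp add: moment_def mult.commute)
  next
    case (Suc j)
    show ?case unfolding dual_shift Suc.IH by simp
  qed
  from this[of 0 m] show ?thesis unfolding tipD'_opD_pole by simp
qed

section \<open>Differentiation along the flow\<close>

lemma flow_tipN:
  assumes "Im z > 0" "Re z \<noteq> 0"
  shows "((\<lambda>t. tipN (flow t z)) has_real_derivative tipD' (flow t z)) (at t)"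
proof -
  have "((\<lambda>z. 1 / z) has_field_derivative - (1 / (flow t z)\<^sup>2)) (at (flow t z))"
    using flow_eq(2)[OF assms, of t] by (auto intro!: derivative_eq_intros simp: power2_eq_square)
  from field_vector_diff_chain_at[OF flow_eq(4)[OF assms] this]
  have "((\<lambda>t. 1 / flow t z) has_vector_derivative vfield (flow t z) * - (1 / (flow t z)\<^sup>2)) (at t)"
    by (simp add: o_def)
  from bounded_linear.has_vector_derivative[OF bounded_linear_Re this]
  show ?thesis by (simp add: tipN_def[abs_def] tipD'_def has_real_derivative_iff_has_vector_derivative)
qed

lemma flow_pole:
  assumes "Im z > 0" "Re z \<noteq> 0"
  shows "((\<lambda>t. pole (flow t z)) has_real_derivative tipD (flow t z)) (at t)"
proof -
  let ?w = "flow t z"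
  have n: "?w \<noteq> \<i>" "?w \<noteq> - \<i>" "?w \<noteq> 0" using flow_eq(1-3)[OF assms, of t] by auto
  have ln: "((\<lambda>t. ln (cmod (flow t z - a))) has_derivative (\<lambda>h. Re ((h *\<^sub>R vfield ?w) / (?w - a)))) (at t)" if "?w \<noteq> a" for a
    using has_derivative_compose[OF flow_eq(4)[OF assms, of t, unfolded has_vector_derivative_def] has_derivative_ln_cmod[OF that]] .
  have "((\<lambda>t. pole (flow t z)) has_derivative
      (\<lambda>h. - (Re ((h *\<^sub>R vfield ?w) / (?w - \<i>)) - Re ((h *\<^sub>R vfield ?w) / (?w - cnj \<i>))))) (at t)"
    unfolding pole_def green_def using n by (intro has_derivative_minus has_derivative_diff ln) auto
  moreover have "- (Re ((h *\<^sub>R vfield ?w) / (?w - \<i>)) - Re ((h *\<^sub>R vfield ?w) / (?w - cnj \<i>))) = tipD ?w * h" for h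
  proof -
    have "Re ((h *\<^sub>R vfield ?w) / (?w - \<i>)) - Re ((h *\<^sub>R vfield ?w) / (?w - cnj \<i>))
       = h * Re (vfield ?w / (?w - \<i>) - vfield ?w / (?w - cnj \<i>))"
      by (simp add: right_diff_distrib scaleR_conv_of_real times_divide_eq_right[symmetric] del: times_divide_eq_right)
    also have "\<dots> = h * Re (\<i> * (1 / ?w))" unfolding vfield_centre[OF n] by simp
    finally show ?thesis by (simp only: Re_i_times tipD_def) simp
  qed
  ultimately show ?thesis by (simp add: has_field_derivative_def)
qed

text \<open>The difference quotient of \<open>vfield\<close> is explicit, so the singularity on the diagonal cancels.\<close>

lemma vfield_quotient:
  assumes "q \<noteq> 0" "a \<noteq> 0" "q \<noteq> a"
  shows "(1 - 1 / q\<^sup>2) / 2 * (1 / (q - a)) - (vfield q - vfield a) / (q - a)\<^sup>2 = 1 / (2 * a * q\<^sup>2)"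
proof -
  have A: "vfield q - vfield a = (q - a) * ((1 - 1 / (q * a)) / 2)"
    using assms by (simp add: vfield_def field_simps)
  have B: "(d * x) / d\<^sup>2 = x * (1 / d)" for d x :: complex
    by (simp add: power2_eq_square)
  have "(vfield q - vfield a) / (q - a)\<^sup>2 = ((1 - 1 / (q * a)) / 2) * (1 / (q - a))"
    unfolding A by (rule B)
  then have "(1 - 1 / q\<^sup>2) / 2 * (1 / (q - a)) - (vfield q - vfield a) / (q - a)\<^sup>2
     = ((1 / (q * a) - 1 / q\<^sup>2) / 2) * (1 / (q - a))"
    by (simp add: algebra_simps diff_divide_distrib)
  also have "1 / (q * a) - 1 / q\<^sup>2 = (q - a) / (a * q\<^sup>2)"
    using assms by (simp add: field_simps power2_eq_square)
  finally show ?thesis using assms by simp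
qed

text \<open>Moving both points together, the kernel changes only because the tip stays in place: this is Hadamard's
  variation of the Green function, of rank one.\<close>

lemma flow_kerD:
  assumes p: "Im p > 0" "Re p \<noteq> 0" and q: "Im q > 0" "Re q \<noteq> 0" and pq: "p \<noteq> q"
  shows "((\<lambda>t. kerD (flow t p) (flow t q)) has_real_derivative - (tipD (flow t p) * tipD' (flow t q))) (at t)"
proof -
  define a b where "a = flow t p" and "b = flow t q"
  have a: "Im a > 0" "a \<noteq> 0" and b: "Im b > 0" "b \<noteq> 0"
    using flow_eq[OF p] flow_eq[OF q] by (auto simp: a_def b_def)
  have ab: "b \<noteq> a" "b \<noteq> cnj a"
    using flow_inj[OF p q pq, of t] a b by (auto simp: a_def b_def)
  have va: "((\<lambda>t. flow t p) has_vector_derivative vfield a) (at t)"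
    and vb: "((\<lambda>t. flow t q) has_vector_derivative vfield b) (at t)"
    using flow_eq(4)[OF p] flow_eq(4)[OF q] by (simp_all add: a_def b_def)
  have vca: "((\<lambda>t. cnj (flow t p)) has_vector_derivative vfield (cnj a)) (at t)"
    using bounded_linear.has_vector_derivative[OF bounded_linear_cnj va] by (simp add: vfield_def)
  have quot: "((\<lambda>t. 1 / (flow t q - f t)) has_vector_derivative - ((vfield b - vfield (f t)) / (b - f t)\<^sup>2)) (at t)"
    if "(f has_vector_derivative vfield (f t)) (at t)" "b \<noteq> f t" for f
  proof -
    have "((\<lambda>t. flow t q - f t) has_vector_derivative vfield b - vfield (f t)) (at t)"
      using vb that(1) by (rule has_vector_derivative_diff)
    moreover have "((\<lambda>z. 1 / z) has_field_derivative - (1 / (b - f t)\<^sup>2)) (at (b - f t))"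
      using that by (auto intro!: derivative_eq_intros simp: power2_eq_square)
    ultimately show ?thesis
      using field_vector_diff_chain_at[of "\<lambda>t. flow t q - f t" "vfield b - vfield (f t)" t "\<lambda>z. 1 / z" "- (1 / (b - f t)\<^sup>2)"]
      by (simp add: o_def b_def)
  qed
  have vv: "((\<lambda>t. vfield (flow t q)) has_vector_derivative vfield b * ((1 - 1 / b\<^sup>2) / 2)) (at t)"
  proof -
    have "(vfield has_field_derivative (1 - 1 / b\<^sup>2) / 2) (at b)"
      unfolding vfield_def[abs_def] using b by (auto intro!: derivative_eq_intros simp: power2_eq_square)
    then show ?thesis
      using field_vector_diff_chain_at[OF vb, of vfield "(1 - 1 / b\<^sup>2) / 2"] by (simp add: o_def b_def)
  qed
  let ?D = "vfield b * (- ((vfield b - vfield a) / (b - a)\<^sup>2) - - ((vfield b - vfield (cnj a)) / (b - cnj a)\<^sup>2))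
      + vfield b * ((1 - 1 / b\<^sup>2) / 2) * (1 / (b - a) - 1 / (b - cnj a))"
  have "((\<lambda>t. vfield (flow t q) * (1 / (flow t q - flow t p) - 1 / (flow t q - cnj (flow t p)))) has_vector_derivative ?D) (at t)"
    using has_vector_derivative_mult[OF vv has_vector_derivative_diff[OF quot[of "\<lambda>t. flow t p"] quot[of "\<lambda>t. cnj (flow t p)"]]]
      va vca ab by (simp add: a_def[symmetric] b_def[symmetric])
  from bounded_linear.has_vector_derivative[OF bounded_linear_Im this]
  have "((\<lambda>t. kerD (flow t p) (flow t q)) has_vector_derivative Im ?D) (at t)"
    by (simp add: kerD_def)
  moreover have "Im ?D = - (tipD a * tipD' b)"
  proof -
    have "?D = vfield b * (((1 - 1 / b\<^sup>2) / 2 * (1 / (b - a)) - (vfield b - vfield a) / (b - a)\<^sup>2)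
        - ((1 - 1 / b\<^sup>2) / 2 * (1 / (b - cnj a)) - (vfield b - vfield (cnj a)) / (b - cnj a)\<^sup>2))"
    proof -
      have "v * (- u - - u') + v * k * (x - y) = v * ((k * x - u) - (k * y - u'))" for v u u' k x y :: complex
        by (simp add: algebra_simps)
      then show ?thesis .
    qed
    also have "\<dots> = vfield b * (1 / (2 * a * b\<^sup>2) - 1 / (2 * cnj a * b\<^sup>2))"
      using a b ab by (subst (1 2) vfield_quotient) auto
    also have "\<dots> = (vfield b / b\<^sup>2) * ((1 / a - cnj (1 / a)) / 2)"
      using a b by (simp add: field_simps)
    also have "(1 / a - cnj (1 / a)) / 2 = \<i> * of_real (tipD a)"
      unfolding complex_diff_cnj tipD_def by simp
    finally have "?D = \<i> * (vfield b / b\<^sup>2) * of_real (tipD a)" by (simp add: mult_ac)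
    moreover have "Im (\<i> * w * of_real r) = Re w * r" for w r by simp
    ultimately have "Im ?D = Re (vfield b / b\<^sup>2) * tipD a" by (simp only:)
    then show ?thesis by (simp add: tipD'_def)
  qed
  ultimately show ?thesis by (simp add: a_def b_def has_real_derivative_iff_has_vector_derivative)
qed

abbreviation hprod :: "nat \<Rightarrow> (nat \<Rightarrow> complex) measure" where
  "hprod m \<equiv> PiM {..m} (\<lambda>_. hmeasure)"

definition flow_all :: "nat \<Rightarrow> real \<Rightarrow> (nat \<Rightarrow> complex) \<Rightarrow> nat \<Rightarrow> complex" where
  "flow_all m t x = (\<lambda>i\<in>{..m}. flow t (x i))"

lemma flow_all_preserves: "distr (hprod m) (hprod m) (flow_all m t) = hprod m"
proof -
  have [measurable]: "flow t \<in> borel_measurable borel" unfolding flow_def by measurable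
  have "distr hmeasure hmeasure (flow t) = distr hmeasure borel (flow t)"
    by (rule distr_cong) auto
  then show ?thesis unfolding flow_all_def[abs_def]
    by (intro distr_PiM_componentwise sigma_finite_hmeasure)
       (auto simp: distr_hmeasure_flow measurable_cong_sets[OF sets_hmeasure sets_hmeasure])
qed

text \<open>The integral of \<open>F\<close> does not change when the flow transports all points, and by Fubini this
  change is the integral of \<open>F'\<close>.\<close>

lemma integral_flow_derivative:
  fixes F F' :: "(nat \<Rightarrow> complex) \<Rightarrow> real"
  assumes F: "integrable (hprod m) F" and F': "integrable (hprod m) F'"
    and der: "AE x in hprod m. \<forall>t. ((\<lambda>t. F (flow_all m t x)) has_real_derivative F' (flow_all m t x)) (at t)"
  shows "integral\<^sup>L (hprod m) F' = 0"
proof -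
  interpret product_sigma_finite "\<lambda>_::nat. hmeasure"
    by (simp add: product_sigma_finite_def sigma_finite_hmeasure)
  interpret N: sigma_finite_measure "hprod m" by (rule sigma_finite) simp
  interpret pair_sigma_finite lborel "hprod m" ..
  have [measurable]: "F \<in> borel_measurable (hprod m)" "F' \<in> borel_measurable (hprod m)"
    using F F' by auto
  have fm: "(\<lambda>x. flow_all m (fst x) (snd x)) \<in> lborel \<Otimes>\<^sub>M hprod m \<rightarrow>\<^sub>M hprod m"
    unfolding flow_all_def
  proof (rule measurable_restrict)
    fix i assume "i \<in> {..m}"
    then have "(\<lambda>x. (fst x, snd x i)) \<in> lborel \<Otimes>\<^sub>M hprod m \<rightarrow>\<^sub>M borel \<Otimes>\<^sub>M borel"
      by (intro measurable_Pair) (auto intro!: measurable_compose[OF measurable_snd]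
          simp: measurable_cong_sets[OF refl sets_hmeasure, symmetric])
    from measurable_compose[OF this measurable_flow]
    show "(\<lambda>x. flow (fst x) (snd x i)) \<in> lborel \<Otimes>\<^sub>M hprod m \<rightarrow>\<^sub>M hmeasure"
      by (simp add: measurable_cong_sets[OF refl sets_hmeasure])
  qed
  have fm1 [measurable]: "flow_all m t \<in> hprod m \<rightarrow>\<^sub>M hprod m" for t
    using measurable_compose[OF measurable_Pair1' fm, of t] by simp
  have inv_int: "(LINT x|hprod m. G (flow_all m t x)) = integral\<^sup>L (hprod m) G"
    if [measurable]: "G \<in> borel_measurable (hprod m)" for G :: "_ \<Rightarrow> real" and t
    using integral_distr[OF fm1 that, of t] by (simp add: flow_all_preserves)
  have inv_integrable: "integrable (hprod m) (\<lambda>x. G (flow_all m t x))"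
    if "integrable (hprod m) G" for G :: "_ \<Rightarrow> real" and t
    using integrable_distr_eq[OF fm1, of G t] that by (simp add: flow_all_preserves)
  define H where "H = (\<lambda>(t, x). indicator {0..1} t * F' (flow_all m t x))"
  have Hm: "H \<in> borel_measurable (lborel \<Otimes>\<^sub>M hprod m)"
    unfolding H_def split_beta' using measurable_compose[OF fm, of F'] by measurable
  have H: "integrable (lborel \<Otimes>\<^sub>M hprod m) H"
  proof (rule integrableI_bounded[OF Hm])
    have "(\<integral>\<^sup>+x. ennreal (norm (H x)) \<partial>(lborel \<Otimes>\<^sub>M hprod m))
       = (\<integral>\<^sup>+t. \<integral>\<^sup>+x. ennreal (indicator {0..1} t) * ennreal \<bar>F' (flow_all m t x)\<bar> \<partial>hprod m \<partial>lborel)"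
      using N.nn_integral_fst[where f = "\<lambda>x. ennreal (norm (H x))" ] Hm
      by (simp add: H_def abs_mult ennreal_mult')
    also have "\<dots> = (\<integral>\<^sup>+t. ennreal (indicator {0..1::real} t) * (\<integral>\<^sup>+x. ennreal \<bar>F' x\<bar> \<partial>hprod m) \<partial>lborel)"
    proof (rule nn_integral_cong)
      fix t
      have "(\<integral>\<^sup>+x. ennreal \<bar>F' (flow_all m t x)\<bar> \<partial>hprod m) = (\<integral>\<^sup>+x. ennreal \<bar>F' x\<bar> \<partial>hprod m)"
        using nn_integral_distr[OF fm1, of "\<lambda>x. ennreal \<bar>F' x\<bar>" t] by (simp add: flow_all_preserves)
      then show "(\<integral>\<^sup>+x. ennreal (indicator {0..1} t) * ennreal \<bar>F' (flow_all m t x)\<bar> \<partial>hprod m)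
         = ennreal (indicator {0..1} t) * (\<integral>\<^sup>+x. ennreal \<bar>F' x\<bar> \<partial>hprod m)"
        by (subst nn_integral_cmult) auto
    qed
    also have "\<dots> = (\<integral>\<^sup>+x. ennreal \<bar>F' x\<bar> \<partial>hprod m)"
      by (simp add: nn_integral_multc ennreal_indicator)
    also have "\<dots> < \<infinity>" using F' by (simp add: integrable_iff_bounded)
    finally show "(\<integral>\<^sup>+x. ennreal (norm (H x)) \<partial>(lborel \<Otimes>\<^sub>M hprod m)) < \<infinity>" .
  qed
  have "AE x in hprod m. \<forall>i\<in>{..m}. Im (x i) > 0 \<and> Re (x i) \<noteq> 0"
  proof (rule AE_finite_allI)
    show "finite {..m}" by simp
    fix i assume "i \<in> {..m}"
    then show "AE x in hprod m. Im (x i) > 0 \<and> Re (x i) \<noteq> 0"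
      using AE_lborel_Re_ne_0 by (intro AE_PiM_coordinate sigma_finite_hmeasure AE_hmeasure_conj) auto
  qed
  then have zero: "AE x in hprod m. flow_all m 0 x = x"
    using AE_space[of "hprod m"]
    by eventually_elim (auto simp: flow_all_def flow_eq space_PiM PiE_iff extensional_def fun_eq_iff)
  have "AE x in hprod m. integrable lborel (\<lambda>t. H (t, x))"
    using AE_integrable_snd[of "\<lambda>t x. H (t, x)"] H by simp
  then have line: "AE x in hprod m. (LINT t|lborel. H (t, x)) = F (flow_all m 1 x) - F x"
    using der zero
  proof eventually_elim
    case (elim x)
    have "((\<lambda>t. F' (flow_all m t x)) has_integral F (flow_all m 1 x) - F (flow_all m 0 x)) {0..1}"
      using elim(2) by (intro fundamental_theorem_of_calculus)
        (auto simp: has_real_derivative_iff_has_vector_derivative intro: has_vector_derivative_at_within)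
    then have "((\<lambda>t. F' (flow_all m t x) * indicator {0..1} t) has_integral F (flow_all m 1 x) - F x) UNIV"
      unfolding has_integral_indicator_UNIV elim(3) .
    moreover have "(\<lambda>t. H (t, x)) = (\<lambda>t. F' (flow_all m t x) * indicator {0..1} t)"
      by (auto simp: H_def)
    ultimately show ?case
      using has_integral_integral_lborel[OF elim(1)] has_integral_unique by metis
  qed
  have "integral\<^sup>L (hprod m) F' = (LINT t|lborel. indicator {0..1::real} t * integral\<^sup>L (hprod m) F')"
    by simp
  also have "\<dots> = (LINT t|lborel. LINT x|hprod m. H (t, x))"
    by (simp add: H_def inv_int)
  also have "\<dots> = (LINT x|hprod m. LINT t|lborel. H (t, x))"
    using Fubini_integral[of "\<lambda>t x. H (t, x)"] H by simp
  also have "\<dots> = (LINT x|hprod m. F (flow_all m 1 x) - F x)"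
    using line Hm F by (intro integral_cong_AE) auto
  also have "\<dots> = 0"
    using inv_integrable[OF F, of 1] F by (simp add: inv_int)
  finally show ?thesis .
qed

section \<open>Vanishing of the moments\<close>

lemma kernel_iter_cong: "(\<And>i. i < m \<Longrightarrow> k i = k' i) \<Longrightarrow> kernel_iter M k m b = kernel_iter M k' m b"
  by (induction m arbitrary: b) simp_all

lemma kernel_iter_add: "kernel_iter M k (j + r) b = kernel_iter M k j (kernel_iter M (\<lambda>i. k (j + i)) r b)"
  by (induction r arbitrary: b) simp_all

lemma kernel_op_scale: "kernel_op M k (\<lambda>p. c * b p) = (\<lambda>p. c * kernel_op M k b p)"
proof
  fix p
  have "kernel_op M k (\<lambda>p. c * b p) p = (LINT q|M. c * (k p q * b q))"
    unfolding kernel_op_def by (rule Bochner_Integration.integral_cong) auto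
  then show "kernel_op M k (\<lambda>p. c * b p) p = c * kernel_op M k b p" by (simp add: kernel_op_def)
qed

lemma opD_iter_scale: "(opD ^^ m) (\<lambda>p. c * b p) = (\<lambda>p. c * (opD ^^ m) b p)"
  by (induction m) (simp_all add: kernel_op_scale)

lemma integral_chain_hmeasure:
  fixes \<omega> :: "nat \<Rightarrow> complex \<Rightarrow> real"
  assumes a: "a \<in> borel_measurable borel" and b: "b \<in> borel_measurable borel"
    and k: "\<And>j. j < m \<Longrightarrow> case_prod (k j) \<in> borel_measurable (borel \<Otimes>\<^sub>M borel)"
    and \<omega>: "\<And>j. \<omega> j \<in> borel_measurable borel" "\<And>j p. \<omega> j p \<ge> 0" and K: "K \<ge> 0" "B \<ge> 0"
    and kw: "\<And>j p. j < m \<Longrightarrow> Im p > 0 \<Longrightarrow> p \<noteq> \<i> \<Longrightarrow>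
        (\<integral>\<^sup>+q. ennreal (\<bar>k j p q\<bar> * \<omega> (Suc j) q) \<partial>hmeasure) \<le> ennreal (K * \<omega> j p)"
    and bw: "\<And>q. Im q > 0 \<Longrightarrow> q \<noteq> \<i> \<Longrightarrow> \<bar>b q\<bar> \<le> B * \<omega> m q"
    and aw: "(\<integral>\<^sup>+p. ennreal (\<bar>a p\<bar> * \<omega> 0 p) \<partial>hmeasure) \<le> ennreal A"
  shows "integrable (hprod m) (chain a k m b)"
    and "integral\<^sup>L (hprod m) (chain a k m b) = (LINT p|hmeasure. a p * kernel_iter hmeasure k m b p)"
proof -
  define w where "w j p = ennreal (B * K ^ (m - j)) * ennreal (\<omega> j p)" for j p
  have "integrable (hprod m) (chain a k m b) \<and>
    integral\<^sup>L (hprod m) (chain a k m b) = (LINT p|hmeasure. a p * kernel_iter hmeasure k m b p)"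
  proof (rule integral_chain[where w = w, OF sigma_finite_hmeasure])
    fix j assume j: "j < m"
    have mj: "m - j = Suc (m - Suc j)" using j by simp
    show "AE p in hmeasure. (\<integral>\<^sup>+q. ennreal \<bar>k j p q\<bar> * w (Suc j) q \<partial>hmeasure) \<le> w j p"
      using AE_hmeasure_generic[of \<i>]
    proof eventually_elim
      case (elim p)
      have [measurable]: "k j p \<in> borel_measurable borel"
        using measurable_Pair2[OF k[OF j], of p] by simp
      note \<omega>(1)[measurable]
      have "(\<integral>\<^sup>+q. ennreal \<bar>k j p q\<bar> * w (Suc j) q \<partial>hmeasure)
         = (\<integral>\<^sup>+q. ennreal (B * K ^ (m - Suc j)) * ennreal (\<bar>k j p q\<bar> * \<omega> (Suc j) q) \<partial>hmeasure)"
        using \<omega>(2) by (intro nn_integral_cong) (simp add: w_def ennreal_mult' mult_ac)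
      also have "\<dots> = ennreal (B * K ^ (m - Suc j)) * (\<integral>\<^sup>+q. ennreal (\<bar>k j p q\<bar> * \<omega> (Suc j) q) \<partial>hmeasure)"
        by (rule nn_integral_cmult) measurable
      also have "\<dots> \<le> ennreal (B * K ^ (m - Suc j)) * ennreal (K * \<omega> j p)"
        using elim j by (intro mult_left_mono kw) auto
      also have "\<dots> = w j p"
        unfolding w_def mj power_Suc2 using K \<omega>(2) by (simp add: mult.assoc flip: ennreal_mult')
      finally show ?case .
    qed
    show "case_prod (k j) \<in> borel_measurable (hmeasure \<Otimes>\<^sub>M hmeasure)"
      using k[OF j] by (simp add: measurable_cong_sets[OF sets_pair_measure_cong[OF sets_hmeasure sets_hmeasure] refl])
  next
    show "AE q in hmeasure. ennreal \<bar>b q\<bar> \<le> w m q"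
      using AE_hmeasure_generic[of \<i>] by (rule eventually_mono)
        (use bw K in \<open>auto simp: w_def ennreal_leI simp flip: ennreal_mult'\<close>)
    note \<omega>(1)[measurable] a[measurable]
    have "(\<integral>\<^sup>+p. ennreal \<bar>a p\<bar> * w 0 p \<partial>hmeasure) = (\<integral>\<^sup>+p. ennreal (B * K ^ m) * ennreal (\<bar>a p\<bar> * \<omega> 0 p) \<partial>hmeasure)"
      using \<omega>(2) by (intro nn_integral_cong) (simp add: w_def ennreal_mult' mult_ac)
    also have "\<dots> = ennreal (B * K ^ m) * (\<integral>\<^sup>+p. ennreal (\<bar>a p\<bar> * \<omega> 0 p) \<partial>hmeasure)"
      by (rule nn_integral_cmult) measurable
    also have "\<dots> \<le> ennreal (B * K ^ m) * ennreal A" using aw by (rule mult_left_mono) simp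
    also have "\<dots> < \<infinity>" by (simp add: ennreal_mult_less_top)
    finally show "(\<integral>\<^sup>+p. ennreal \<bar>a p\<bar> * w 0 p \<partial>hmeasure) < \<infinity>" .
  qed (use a b in \<open>simp_all add: measurable_cong_sets[OF sets_hmeasure refl]\<close>)
  then show "integrable (hprod m) (chain a k m b)"
    "integral\<^sup>L (hprod m) (chain a k m b) = (LINT p|hmeasure. a p * kernel_iter hmeasure k m b p)" by auto
qed

lemma kerD_kernel_bound_wV:
  assumes "Im p > 0" "p \<noteq> \<i>"
  shows "(\<integral>\<^sup>+q. ennreal (\<bar>kerD p q\<bar> * wV q) \<partial>hmeasure) \<le> ennreal (4 * riesz_const * wV p)"
    and "(\<integral>\<^sup>+q. ennreal (\<bar>kerD p q\<bar> * wW q) \<partial>hmeasure) \<le> ennreal (4 * riesz_const * wW p)"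
proof -
  have "(\<integral>\<^sup>+q. ennreal (\<bar>kerD p q\<bar> * wV q) \<partial>hmeasure) \<le> (\<integral>\<^sup>+q. ennreal (\<bar>kerD p q\<bar> * wW q) \<partial>hmeasure)"
    using AE_hmeasure_generic[of \<i>] by (intro nn_integral_mono_AE)
      (auto elim!: eventually_mono intro!: ennreal_leI mult_left_mono wV_le_wW)
  then show "(\<integral>\<^sup>+q. ennreal (\<bar>kerD p q\<bar> * wV q) \<partial>hmeasure) \<le> ennreal (4 * riesz_const * wV p)"
    using kerD_kernel_bound(1)[OF assms] by (rule order_trans)
  show "(\<integral>\<^sup>+q. ennreal (\<bar>kerD p q\<bar> * wW q) \<partial>hmeasure) \<le> ennreal (4 * riesz_const * wW p)"
    using kerD_kernel_bound(1)[OF assms] wV_le_wW[OF assms(1)] riesz_const_pos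
    by (elim order_trans) (intro ennreal_leI mult_left_mono, auto)
qed

text \<open>The total \<open>B\<close>-derivative of \<open>kerD\<close>.\<close>

definition kerR :: "complex \<Rightarrow> complex \<Rightarrow> real" where
  "kerR p q = - (tipD p * tipD' q)"

lemma measurable_kerR [measurable]: "case_prod kerR \<in> borel_measurable (borel \<Otimes>\<^sub>M borel)"
  unfolding kerR_def split_beta' by measurable

lemma kerR_bound:
  assumes "Im p > 0" "p \<noteq> \<i>"
  shows "(\<integral>\<^sup>+q. ennreal (\<bar>kerR p q\<bar> * wV q) \<partial>hmeasure) \<le> ennreal (4 * riesz_const * wW p)"
proof -
  have "(\<integral>\<^sup>+q. ennreal (\<bar>kerR p q\<bar> * wV q) \<partial>hmeasure) = (\<integral>\<^sup>+q. ennreal \<bar>tipD p\<bar> * ennreal (\<bar>tipD' q\<bar> * wV q) \<partial>hmeasure)"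
    by (intro nn_integral_cong) (simp add: kerR_def abs_mult mult.assoc ennreal_mult')
  also have "\<dots> = ennreal \<bar>tipD p\<bar> * (\<integral>\<^sup>+q. ennreal (\<bar>tipD' q\<bar> * wV q) \<partial>hmeasure)"
    by (rule nn_integral_cmult) measurable
  also have "\<dots> \<le> ennreal (wW p) * ennreal (4 * riesz_const)"
    using abs_tipD_le[OF assms] tipD'_wV_bound by (intro mult_mono ennreal_leI) auto
  also have "\<dots> = ennreal (4 * riesz_const * wW p)" by (simp add: mult.commute flip: ennreal_mult')
  finally show ?thesis .
qed

lemma has_real_derivative_prod:
  fixes f :: "nat \<Rightarrow> real \<Rightarrow> real"
  assumes "\<And>i. i < m \<Longrightarrow> (f i has_real_derivative f' i) (at t)"
  shows "((\<lambda>t. \<Prod>i<m. f i t) has_real_derivative (\<Sum>j<m. \<Prod>i<m. if i = j then f' i else f i t)) (at t)"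
  using assms
proof (induction m)
  case (Suc m)
  have "((\<lambda>t. (\<Prod>i<m. f i t) * f m t) has_real_derivative
     (\<Sum>j<m. \<Prod>i<m. if i = j then f' i else f i t) * f m t + f' m * (\<Prod>i<m. f i t)) (at t)"
    using Suc by (intro DERIV_mult) auto
  moreover have "(\<Prod>i<m. if i = m then f' i else f i t) = (\<Prod>i<m. f i t)" by (rule prod.cong) auto
  moreover have "(\<Sum>j<m. \<Prod>i<Suc m. if i = j then f' i else f i t) = (\<Sum>j<m. \<Prod>i<m. if i = j then f' i else f i t) * f m t"
    by (simp add: sum_distrib_right)
  ultimately show ?case by (simp add: mult.commute)
qed simp

lemma chain_flow_derivative:
  assumes good: "\<And>i. i \<le> m \<Longrightarrow> Im (x i) > 0 \<and> Re (x i) \<noteq> 0" and dist: "\<And>i. i < m \<Longrightarrow> x i \<noteq> x (Suc i)"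
  shows "((\<lambda>t. chain tipN (\<lambda>_. kerD) m pole (flow_all m t x)) has_real_derivative
     (chain tipD' (\<lambda>_. kerD) m pole (flow_all m t x)
       + (\<Sum>j<m. chain tipN (\<lambda>i. if i = j then kerR else kerD) m pole (flow_all m t x))
       + chain tipN (\<lambda>_. kerD) m tipD (flow_all m t x))) (at t)"
proof -
  let ?k = "\<lambda>i t. kerD (flow t (x i)) (flow t (x (Suc i)))"
  let ?r = "\<lambda>i. kerR (flow t (x i)) (flow t (x (Suc i)))"
  have fl: "chain a k m b (flow_all m t x) = a (flow t (x 0)) * (\<Prod>j<m. k j (flow t (x j)) (flow t (x (Suc j)))) * b (flow t (x m))" for a b k t
    by (simp add: chain_def flow_all_def)
  have N: "((\<lambda>t. tipN (flow t (x 0))) has_real_derivative tipD' (flow t (x 0))) (at t)"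
    using good[of 0] by (intro flow_tipN) auto
  have P: "((\<lambda>t. pole (flow t (x m))) has_real_derivative tipD (flow t (x m))) (at t)"
    using good[of m] by (intro flow_pole) auto
  have K: "((\<lambda>t. \<Prod>i<m. ?k i t) has_real_derivative (\<Sum>j<m. \<Prod>i<m. if i = j then ?r i else ?k i t)) (at t)"
    unfolding kerR_def using good dist by (intro has_real_derivative_prod flow_kerD) auto
  have D: "(\<Prod>i<m. if i = j then ?r i else ?k i t) = (\<Prod>i<m. (if i = j then kerR else kerD) (flow t (x i)) (flow t (x (Suc i))))" for j
    by (intro prod.cong) auto
  show ?thesis
    unfolding fl
    by (rule DERIV_cong[OF DERIV_mult[OF DERIV_mult[OF N K] P]])
       (simp add: D algebra_simps sum_distrib_left sum_distrib_right)
qed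

text \<open>The \<open>j\<close>-th term of the total derivative contributes \<open>- moment j * d\<close> for some \<open>d\<close>, which vanishes by
  induction.  The two end terms contribute \<open>tipD'_moment\<close> and \<open>moment m\<close>, and these are equal for odd \<open>m\<close>.\<close>

lemma moment_eq_0: "moment m = 0"
proof (induction m rule: less_induct)
  case (less m)
  show ?case
  proof (cases "even m")
    case True then show ?thesis by (rule moment_even)
  next
    case odd: False
    let ?k = "\<lambda>_::nat. kerD" and ?kR = "\<lambda>j (i::nat). if i = j then kerR else kerD"
    have pole3: "\<bar>pole q\<bar> \<le> 3 * wW q" "\<bar>pole q\<bar> \<le> 3 * wV q" if "Im q > 0" "q \<noteq> \<i>" for q
      using abs_pole_le[OF that] wV_le_wW[OF that(1)] by linarith+
    note C = riesz_const_pos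
    have F: "integrable (hprod m) (chain tipN ?k m pole)"
      by (rule integral_chain_hmeasure(1)[where \<omega> = "\<lambda>_. wW" and B = 3 and K = "4 * riesz_const", OF _ _ _ _ _ _ _ kerD_kernel_bound_wV(2) pole3(1) tipN_wW_bound])
         (use C in auto)
    have F1: "integrable (hprod m) (chain tipD' ?k m pole)"
        "integral\<^sup>L (hprod m) (chain tipD' ?k m pole) = (LINT p|hmeasure. tipD' p * kernel_iter hmeasure ?k m pole p)"
      by (rule integral_chain_hmeasure[where \<omega> = "\<lambda>_. wV" and B = 3 and K = "4 * riesz_const", OF _ _ _ _ _ _ _ kerD_kernel_bound_wV(1) pole3(2) tipD'_wV_bound];
         use C in auto)+
    have F3: "integrable (hprod m) (chain tipN ?k m tipD)"
        "integral\<^sup>L (hprod m) (chain tipN ?k m tipD) = (LINT p|hmeasure. tipN p * kernel_iter hmeasure ?k m tipD p)"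
      by (rule integral_chain_hmeasure[where \<omega> = "\<lambda>_. wW" and B = 1 and K = "4 * riesz_const", OF _ _ _ _ _ _ _ kerD_kernel_bound_wV(2) _ tipN_wW_bound];
         use C abs_tipD_le in auto)+
    have F2: "integrable (hprod m) (chain tipN (?kR j) m pole)"
        "integral\<^sup>L (hprod m) (chain tipN (?kR j) m pole) = (LINT p|hmeasure. tipN p * kernel_iter hmeasure (?kR j) m pole p)"
      if "j < m" for j
    proof -
      \<comment> \<open>Right of the rank-one kernel the smaller weight is required, left of it only the larger one is available.\<close>
      define \<omega> where "\<omega> i = (if i \<le> j then wW else wV)" for i
      have *: "(\<integral>\<^sup>+q. ennreal (\<bar>?kR j i p q\<bar> * \<omega> (Suc i) q) \<partial>hmeasure) \<le> ennreal (4 * riesz_const * \<omega> i p)"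
        if "Im p > 0" "p \<noteq> \<i>" for i p
        using kerR_bound[OF that] kerD_kernel_bound_wV[OF that] by (auto simp: \<omega>_def)
      have w0: "(\<integral>\<^sup>+p. ennreal (\<bar>tipN p\<bar> * \<omega> 0 p) \<partial>hmeasure) \<le> ennreal (4 * riesz_const)"
        using tipN_wW_bound by (simp add: \<omega>_def)
      have wm: "\<bar>pole q\<bar> \<le> 3 * \<omega> m q" if "Im q > 0" "q \<noteq> \<i>" for q
        using pole3[OF that] by (simp add: \<omega>_def)
      show "integrable (hprod m) (chain tipN (?kR j) m pole)"
        "integral\<^sup>L (hprod m) (chain tipN (?kR j) m pole) = (LINT p|hmeasure. tipN p * kernel_iter hmeasure (?kR j) m pole p)"
        by (rule integral_chain_hmeasure[where \<omega> = \<omega> and B = 3 and K = "4 * riesz_const", OF _ _ _ _ _ _ _ * wm w0];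
          use C in \<open>auto simp: \<omega>_def\<close>)+
    qed
    have F2_zero: "integral\<^sup>L (hprod m) (chain tipN (?kR j) m pole) = 0" if j: "j < m" for j
    proof -
      define r where "r = m - Suc j"
      have m: "m = Suc j + r" using j by (simp add: r_def)
      have "kernel_iter hmeasure (?kR j) m pole = kernel_iter hmeasure (?kR j) j (kernel_op hmeasure kerR (kernel_iter hmeasure ?k r pole))"
        unfolding m kernel_iter_add
        using kernel_iter_cong[of r "\<lambda>i. ?kR j (Suc j + i)" ?k] by simp
      also have "\<dots> = (opD ^^ j) (kernel_op hmeasure kerR (kernel_iter hmeasure ?k r pole))"
        using kernel_iter_cong[of j "?kR j" ?k] by (simp add: kernel_iter_const)
      also have "kernel_op hmeasure kerR b = (\<lambda>p. - (LINT q|hmeasure. tipD' q * b q) * tipD p)" for b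
      proof
        fix p
        have "kernel_op hmeasure kerR b p = (LINT q|hmeasure. - tipD p * (tipD' q * b q))"
          unfolding kernel_op_def kerR_def by (rule Bochner_Integration.integral_cong) auto
        then show "kernel_op hmeasure kerR b p = - (LINT q|hmeasure. tipD' q * b q) * tipD p"
          by (simp only: integral_mult_right_zero) simp
      qed
      finally obtain c where c: "kernel_iter hmeasure (?kR j) m pole = (\<lambda>p. c * (opD ^^ j) tipD p)"
        unfolding opD_iter_scale by blast
      have "integral\<^sup>L (hprod m) (chain tipN (?kR j) m pole) = (LINT p|hmeasure. c * (tipN p * (opD ^^ j) tipD p))"
        unfolding F2(2)[OF j] c by (rule Bochner_Integration.integral_cong) auto
      then show ?thesis using less.IH[OF j] by (simp add: moment_def)
    qed
    define F' where "F' x = chain tipD' ?k m pole x + (\<Sum>j<m. chain tipN (?kR j) m pole x) + chain tipN ?k m tipD x" for x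
    have F'i: "integrable (hprod m) F'"
      unfolding F'_def using F1 F2 F3 by (intro Bochner_Integration.integrable_add Bochner_Integration.integrable_sum) auto
    have g: "AE x in hprod m. \<forall>i\<in>{..m}. Im (x i) > 0 \<and> Re (x i) \<noteq> 0"
    proof (rule AE_finite_allI)
      fix i assume "i \<in> {..m}"
      then show "AE x in hprod m. Im (x i) > 0 \<and> Re (x i) \<noteq> 0"
        using AE_lborel_Re_ne_0 by (intro AE_PiM_coordinate sigma_finite_hmeasure AE_hmeasure_conj) auto
    qed simp
    have d: "AE x in hprod m. \<forall>i\<in>{..<m}. x i \<noteq> x (Suc i)"
    proof (rule AE_finite_allI)
      fix i assume "i \<in> {..<m}"
      moreover have "AE y in hmeasure. y \<noteq> c" for c
        using AE_hmeasure_generic[of c] by (rule eventually_mono) auto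
      ultimately show "AE x in hprod m. x i \<noteq> x (Suc i)"
        by (intro AE_PiM_distinct sigma_finite_hmeasure) auto
    qed simp
    have "integral\<^sup>L (hprod m) F' = 0"
    proof (rule integral_flow_derivative[OF F F'i])
      show "AE x in hprod m. \<forall>t. ((\<lambda>t. chain tipN ?k m pole (flow_all m t x)) has_real_derivative F' (flow_all m t x)) (at t)"
        using g d
      proof eventually_elim
        case (elim x)
        then show ?case unfolding F'_def by (intro allI chain_flow_derivative) auto
      qed
    qed
    moreover have "integral\<^sup>L (hprod m) F' = (LINT p|hmeasure. tipD' p * (opD ^^ m) pole p) + moment m"
    proof -
      have S: "integrable (hprod m) (\<lambda>x. \<Sum>j<m. chain tipN (?kR j) m pole x)"
        using F2(1) by (intro Bochner_Integration.integrable_sum) auto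
      have S0: "(LINT x|hprod m. (\<Sum>j<m. chain tipN (?kR j) m pole x)) = 0"
        using F2(1) F2_zero by (subst Bochner_Integration.integral_sum) auto
      show ?thesis
        unfolding F'_def[abs_def]
          Bochner_Integration.integral_add[OF Bochner_Integration.integrable_add[OF F1(1) S] F3(1)]
          Bochner_Integration.integral_add[OF F1(1) S] S0 F1(2) F3(2)
        by (simp add: kernel_iter_const moment_def)
    qed
    ultimately show ?thesis using odd by (simp add: tipD'_moment)
  qed
qed

section \<open>Comparison of the Neumann and Dirichlet traces\<close>

text \<open>The Neumann kernel, see \<open>kerN_neumann\<close>.  With this definition the rank-one defect is exact at all
  points, also on the diagonal.\<close>

definition kerN :: "complex \<Rightarrow> complex \<Rightarrow> real" where
  "kerN p q = kerD p q + tipD p * tipN q"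

lemma measurable_kerN [measurable]: "case_prod kerN \<in> borel_measurable (borel \<Otimes>\<^sub>M borel)"
proof -
  have "(\<lambda>x. case_prod kerD x + tipD (fst x) * tipN (snd x)) \<in> borel_measurable (borel \<Otimes>\<^sub>M borel)"
    by measurable
  then show ?thesis by (simp add: kerN_def split_beta')
qed

lemma kerN_bound:
  assumes "Im p > 0" "p \<noteq> \<i>"
  shows "(\<integral>\<^sup>+q. ennreal (\<bar>kerN p q\<bar> * wW q) \<partial>hmeasure) \<le> ennreal (8 * riesz_const * wW p)"
proof -
  have "(\<integral>\<^sup>+q. ennreal (\<bar>kerN p q\<bar> * wW q) \<partial>hmeasure)
      \<le> (\<integral>\<^sup>+q. ennreal (\<bar>kerD p q\<bar> * wW q) + ennreal \<bar>tipD p\<bar> * ennreal (\<bar>tipN q\<bar> * wW q) \<partial>hmeasure)"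
  proof (rule nn_integral_mono)
    fix q
    have "\<bar>kerN p q\<bar> * wW q \<le> (\<bar>kerD p q\<bar> + \<bar>tipD p\<bar> * \<bar>tipN q\<bar>) * wW q"
      unfolding kerN_def abs_mult[symmetric] by (intro mult_right_mono abs_triangle_ineq) simp
    then have "ennreal (\<bar>kerN p q\<bar> * wW q) \<le> ennreal (\<bar>kerD p q\<bar> * wW q + \<bar>tipD p\<bar> * (\<bar>tipN q\<bar> * wW q))"
      by (intro ennreal_leI) (simp add: algebra_simps)
    then show "ennreal (\<bar>kerN p q\<bar> * wW q) \<le> ennreal (\<bar>kerD p q\<bar> * wW q) + ennreal \<bar>tipD p\<bar> * ennreal (\<bar>tipN q\<bar> * wW q)"
      by (simp add: ennreal_mult')
  qed
  also have "\<dots> = (\<integral>\<^sup>+q. ennreal (\<bar>kerD p q\<bar> * wW q) \<partial>hmeasure) + ennreal \<bar>tipD p\<bar> * (\<integral>\<^sup>+q. ennreal (\<bar>tipN q\<bar> * wW q) \<partial>hmeasure)"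
    by (subst nn_integral_add) (auto simp: nn_integral_cmult)
  also have "\<dots> \<le> ennreal (4 * riesz_const * wW p) + ennreal (wW p) * ennreal (4 * riesz_const)"
    using kerD_kernel_bound_wV(2)[OF assms] abs_tipD_le[OF assms] tipN_wW_bound
    by (intro add_mono mult_mono ennreal_leI) auto
  also have "\<dots> = ennreal (8 * riesz_const * wW p)"
  proof -
    have "ennreal (x * y) + ennreal y * ennreal x = ennreal (2 * x * y)" if "x \<ge> 0" "y \<ge> 0" for x y
      using that by (simp add: mult.commute flip: ennreal_mult' ennreal_plus)
    from this[of "4 * riesz_const" "wW p"] show ?thesis using riesz_const_pos by simp
  qed
  finally show ?thesis .
qed

lemma measurable_kerN_iter: "(kernel_op hmeasure kerN ^^ i) tipD \<in> borel_measurable borel"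
proof (induction i)
  case (Suc i)
  have "case_prod kerN \<in> borel_measurable (hmeasure \<Otimes>\<^sub>M hmeasure)" by measurable
  from measurable_kernel_op[OF sigma_finite_hmeasure this, of "(kernel_op hmeasure kerN ^^ i) tipD"] Suc show ?case
    by (simp add: measurable_cong_sets[OF sets_hmeasure refl])
qed simp

text \<open>The defect contributes \<open>moment i * tipD\<close> in each step.\<close>

lemma kernel_iter_kerN:
  assumes "Im p > 0" "p \<noteq> \<i>"
  shows "(kernel_op hmeasure kerN ^^ i) tipD p = (opD ^^ i) tipD p"
  using assms
proof (induction i arbitrary: p)
  case (Suc i)
  let ?E = "(opD ^^ i) tipD"
  have "(kernel_op hmeasure kerN ^^ Suc i) tipD p = (LINT q|hmeasure. kerN p q * (kernel_op hmeasure kerN ^^ i) tipD q)"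
    by (simp add: kernel_op_def)
  also have "\<dots> = (LINT q|hmeasure. kerD p q * ?E q + tipD p * (tipN q * ?E q))"
  proof (rule integral_cong_AE)
    have [measurable]: "kerN p \<in> borel_measurable borel" using measurable_Pair2[OF measurable_kerN, of p] by simp
    note [measurable] = measurable_kerN_iter
    show "(\<lambda>q. kerN p q * (kernel_op hmeasure kerN ^^ i) tipD q) \<in> borel_measurable hmeasure"
      "(\<lambda>q. kerD p q * ?E q + tipD p * (tipN q * ?E q)) \<in> borel_measurable hmeasure"
      by (simp_all only: measurable_cong_sets[OF sets_hmeasure refl]) measurable
    show "AE q in hmeasure. kerN p q * (kernel_op hmeasure kerN ^^ i) tipD q = kerD p q * ?E q + tipD p * (tipN q * ?E q)"
      using AE_hmeasure_generic[of \<i>] by (rule eventually_mono) (use Suc.IH in \<open>auto simp: kerN_def[of p] algebra_simps\<close>)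
  qed
  also have "\<dots> = opD ?E p + tipD p * moment i"
  proof -
    have "integrable hmeasure (\<lambda>q. kerD p q * ?E q)"
    proof (rule integrableI_bounded)
      have "(\<integral>\<^sup>+q. ennreal (norm (kerD p q * ?E q)) \<partial>hmeasure) \<le> nnIter (Suc i) p"
        using abs_opD_le_nn by (auto intro!: nn_integral_mono mult_left_mono simp: abs_mult ennreal_mult')
      also have "\<dots> < \<infinity>" using nnIter_le[OF Suc.prems, of "Suc i"] by (rule order.strict_trans1) simp
      finally show "(\<integral>\<^sup>+q. ennreal (norm (kerD p q * ?E q)) \<partial>hmeasure) < \<infinity>" .
    qed measurable
    moreover have "integrable hmeasure (\<lambda>q. tipN q * ?E q)"
    proof (rule integrableI_bounded)
      have "(\<integral>\<^sup>+q. ennreal (norm (tipN q * ?E q)) \<partial>hmeasure) \<le> (\<integral>\<^sup>+q. nnDual 0 q * nnIter i q \<partial>hmeasure)"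
        using abs_opD_le_nn by (auto intro!: nn_integral_mono mult_left_mono simp: abs_mult ennreal_mult')
      then show "(\<integral>\<^sup>+q. ennreal (norm (tipN q * ?E q)) \<partial>hmeasure) < \<infinity>"
        using nnDual_nnIter_finite by (rule order.strict_trans1)
    qed measurable
    ultimately show ?thesis
      by (subst Bochner_Integration.integral_add) (auto simp: kernel_op_def moment_def)
  qed
  finally show ?case by (simp add: moment_eq_0)
qed simp

lemma mixed_chain:
  fixes a m :: nat
  assumes "a \<le> m"
  defines "k \<equiv> \<lambda>i. if i < a then kerD else kerN"
  shows "integrable (hprod m) (chain tipN k m tipD)" "integral\<^sup>L (hprod m) (chain tipN k m tipD) = 0"
proof -
  have kw: "(\<integral>\<^sup>+q. ennreal (\<bar>k i p q\<bar> * wW q) \<partial>hmeasure) \<le> ennreal (8 * riesz_const * wW p)"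
    if "Im p > 0" "p \<noteq> \<i>" for i p
  proof -
    have "ennreal (4 * riesz_const * wW p) \<le> ennreal (8 * riesz_const * wW p)"
      using riesz_const_pos by (intro ennreal_leI mult_right_mono) auto
    then show ?thesis
      using kerN_bound[OF that] order_trans[OF kerD_kernel_bound_wV(2)[OF that]] by (auto simp: k_def)
  qed
  have int: "integrable (hprod m) (chain tipN k m tipD)"
        "integral\<^sup>L (hprod m) (chain tipN k m tipD) = (LINT p|hmeasure. tipN p * kernel_iter hmeasure k m tipD p)"
    by (rule integral_chain_hmeasure[where \<omega> = "\<lambda>_. wW" and B = 1 and K = "8 * riesz_const", OF _ _ _ _ _ _ _ kw _ tipN_wW_bound];
         use riesz_const_pos abs_tipD_le in \<open>auto simp: k_def\<close>)+
  show "integrable (hprod m) (chain tipN k m tipD)" by (rule int)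
  define r where "r = m - a"
  have m: "m = a + r" using assms by (simp add: r_def)
  have op_cong: "opD b = opD b'" if "\<And>p. Im p > 0 \<Longrightarrow> p \<noteq> \<i> \<Longrightarrow> b p = b' p"
      "b \<in> borel_measurable borel" "b' \<in> borel_measurable borel" for b b'
  proof
    fix p
    note that(2,3)[measurable]
    show "opD b p = opD b' p" unfolding kernel_op_def
    proof (rule integral_cong_AE)
      show "AE q in hmeasure. kerD p q * b q = kerD p q * b' q"
        using AE_hmeasure_generic[of \<i>] by (rule eventually_mono) (use that(1) in auto)
    qed measurable
  qed
  have "kernel_iter hmeasure k m tipD p = (opD ^^ m) tipD p" if "Im p > 0" "p \<noteq> \<i>" for p
  proof -
    have "kernel_iter hmeasure k m tipD = (opD ^^ a) ((kernel_op hmeasure kerN ^^ r) tipD)"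
      unfolding m kernel_iter_add
      using kernel_iter_cong[of a k "\<lambda>_. kerD"] kernel_iter_cong[of r "\<lambda>i. k (a + i)" "\<lambda>_. kerN"]
      by (simp add: k_def kernel_iter_const)
    moreover have "(opD ^^ a) ((kernel_op hmeasure kerN ^^ r) tipD) p = (opD ^^ a) ((opD ^^ r) tipD) p"
    proof (cases a)
      case 0
      then show ?thesis using kernel_iter_kerN[OF that] by simp
    next
      case (Suc a')
      have "opD ((kernel_op hmeasure kerN ^^ r) tipD) = opD ((opD ^^ r) tipD)"
        by (rule op_cong[OF kernel_iter_kerN measurable_kerN_iter]) auto
      then show ?thesis unfolding Suc funpow_Suc_right by simp
    qed
    ultimately show ?thesis unfolding m funpow_add by simp
  qed
  note eq = this
  have "(LINT p|hmeasure. tipN p * kernel_iter hmeasure k m tipD p) = moment m"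
    unfolding moment_def
  proof (rule integral_cong_AE)
    show "AE p in hmeasure. tipN p * kernel_iter hmeasure k m tipD p = tipN p * (opD ^^ m) tipD p"
      using AE_hmeasure_generic[of \<i>] by (rule eventually_mono) (use eq in auto)
    have "kernel_iter hmeasure k m tipD = (opD ^^ a) ((kernel_op hmeasure kerN ^^ r) tipD)"
      unfolding m kernel_iter_add
      using kernel_iter_cong[of a k "\<lambda>_. kerD"] kernel_iter_cong[of r "\<lambda>i. k (a + i)" "\<lambda>_. kerN"]
      by (simp add: k_def kernel_iter_const)
    then have [measurable]: "kernel_iter hmeasure k m tipD \<in> borel_measurable borel"
      using measurable_kerN_iter measurable_opD_iter by simp
    show "(\<lambda>p. tipN p * kernel_iter hmeasure k m tipD p) \<in> borel_measurable hmeasure"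
      "(\<lambda>p. tipN p * (opD ^^ m) tipD p) \<in> borel_measurable hmeasure"
      by (simp_all only: measurable_cong_sets[OF sets_hmeasure refl]) measurable
  qed
  then show "integral\<^sup>L (hprod m) (chain tipN k m tipD) = 0" using int(2) by (simp add: moment_eq_0)
qed

lemma prod_diff_telescope:
  fixes N D :: "nat \<Rightarrow> real"
  shows "(\<Prod>i<n. N i) - (\<Prod>i<n. D i) = (\<Sum>j<n. \<Prod>i<n. if i < j then N i else if i = j then N i - D i else D i)"
proof (induction n)
  case (Suc n)
  have "(\<Prod>i<n. if i < n then N i else if i = n then N i - D i else D i) = (\<Prod>i<n. N i)"
    by (rule prod.cong) auto
  then have "(\<Sum>j<Suc n. \<Prod>i<Suc n. if i < j then N i else if i = j then N i - D i else D i)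
     = (\<Sum>j<n. \<Prod>i<n. if i < j then N i else if i = j then N i - D i else D i) * D n + (\<Prod>i<n. N i) * (N n - D n)"
    by (simp add: sum_distrib_right)
  then show ?case using Suc.IH by (simp add: algebra_simps)
qed simp

lemma rotation_bij:
  assumes "j < n"
  shows "bij_betw (\<lambda>i. (i + Suc j) mod n) {..<n} {..<n}"
proof -
  have "inj_on (\<lambda>i. (i + Suc j) mod n) {..<n}"
  proof (rule inj_onI)
    fix x y assume xy: "x \<in> {..<n}" "y \<in> {..<n}" "(x + Suc j) mod n = (y + Suc j) mod n"
    then have "[x + Suc j = y + Suc j] (mod n)" by (simp add: cong_def)
    then have "[x = y] (mod n)" by (simp only: cong_add_rcancel_nat)
    then show "x = y" using xy by (simp add: cong_def)
  qed
  moreover have "(\<lambda>i. (i + Suc j) mod n) ` {..<n} \<subseteq> {..<n}" using assms by auto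
  ultimately show ?thesis by (simp add: bij_betw_def endo_inj_surj)
qed

text \<open>A rank-one factor cuts the cycle open at the edge \<open>j\<close>; the resulting chain starts at the vertex after
  the cut.  Its edges that precede \<open>j\<close> in the original numbering come last.\<close>

lemma cyclic_term_eq_chain:
  fixes n j :: nat
  assumes j: "j < n"
  defines "k \<equiv> \<lambda>i. if i < n - Suc j then kerD else kerN"
  shows "(\<Prod>i<n. if i < j then kerN (x i) (x (Suc i mod n)) else if i = j then tipD (x i) * tipN (x (Suc i mod n))
       else kerD (x i) (x (Suc i mod n))) = chain tipN k (n - 1) tipD (\<lambda>i\<in>{..n - 1}. x ((i + Suc j) mod n))"
    (is "prod ?g {..<n} = _")
proof -
  let ?\<pi> = "\<lambda>i. (i + Suc j) mod n"
  obtain m where n: "n = Suc m" using j by (cases n) auto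
  have "m + Suc j = j + n" by (simp add: n)
  then have last: "?\<pi> m = j" using j by (simp only: mod_add_self2 mod_less)
  have step: "?\<pi> (Suc i) = Suc (?\<pi> i) mod n" for i by (simp add: mod_Suc_eq)
  have "prod ?g {..<n} = (\<Prod>i<n. ?g (?\<pi> i))"
    by (rule prod.reindex_bij_betw[OF rotation_bij[OF j], symmetric])
  also have "\<dots> = (\<Prod>i<m. ?g (?\<pi> i)) * ?g j"
    unfolding n prod.lessThan_Suc using last by (simp only: n)
  also have "(\<Prod>i<m. ?g (?\<pi> i)) = (\<Prod>i<m. k i (x (?\<pi> i)) (x (?\<pi> (Suc i))))"
  proof (rule prod.cong[OF refl])
    fix i assume "i \<in> {..<m}"
    then have i: "i < m" by simp
    show "?g (?\<pi> i) = k i (x (?\<pi> i)) (x (?\<pi> (Suc i)))"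
    proof (cases "i + Suc j < n")
      case True
      then have "?\<pi> i = i + Suc j" by simp
      then show ?thesis unfolding step using True by (auto simp: k_def)
    next
      case False
      then have "?\<pi> i = i + Suc j - n" using i j n by (simp add: mod_if)
      then have "?\<pi> i < j" using i n False by linarith
      moreover have "\<not> i < n - Suc j" using False by simp
      ultimately show ?thesis unfolding step k_def by (simp only: if_True if_False)
    qed
  qed
  also have "?g j = tipD (x (?\<pi> m)) * tipN (x (?\<pi> 0))" using last by simp
  finally show ?thesis by (simp add: chain_def n mult_ac)
qed

lemma cyclic_trace_difference:
  assumes n: "n > 0"
  shows "(LINT x|PiM {..<n} (\<lambda>_. hmeasure).
     (\<Prod>i<n. kerN (x i) (x (Suc i mod n))) - (\<Prod>i<n. kerD (x i) (x (Suc i mod n)))) = 0"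
proof -
  let ?M = "PiM {..<n} (\<lambda>_. hmeasure)"
  let ?y = "\<lambda>j x. \<lambda>i\<in>{..n - 1}. x ((i + Suc j) mod n)"
  let ?k = "\<lambda>j i. if i < n - Suc j then kerD else kerN"
  have eq: "{..n - 1} = {..<n}" using n by auto
  have pres: "distr ?M (hprod (n - 1)) (?y j) = hprod (n - 1)" if "j < n" for j
    unfolding eq using rotation_bij[OF that] by (intro distr_PiM_reindex_bij sigma_finite_hmeasure) auto
  have meas: "?y j \<in> ?M \<rightarrow>\<^sub>M hprod (n - 1)" if "j < n" for j
    using n by (intro measurable_restrict measurable_component_singleton) auto
  have c: "integrable ?M (\<lambda>x. chain tipN (?k j) (n - 1) tipD (?y j x)) \<and> (LINT x|?M. chain tipN (?k j) (n - 1) tipD (?y j x)) = 0" if j: "j < n" for j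
  proof -
    note mc = mixed_chain[of "n - Suc j" "n - 1"]
    have le: "n - Suc j \<le> n - 1" by simp
    show ?thesis
      using integrable_distr_eq[OF meas[OF j], of "chain tipN (?k j) (n - 1) tipD"]
        integral_distr[OF meas[OF j], of "chain tipN (?k j) (n - 1) tipD"] mc[OF le]
      unfolding pres[OF j] by auto
  qed
  have "(\<Prod>i<n. kerN (x i) (x (Suc i mod n))) - (\<Prod>i<n. kerD (x i) (x (Suc i mod n)))
     = (\<Sum>j<n. chain tipN (?k j) (n - 1) tipD (?y j x))" for x
    unfolding prod_diff_telescope
  proof (rule sum.cong[OF refl])
    fix j assume "j \<in> {..<n}"
    then have "j < n" by simp
    then show "(\<Prod>i<n. if i < j then kerN (x i) (x (Suc i mod n)) else if i = j then kerN (x i) (x (Suc i mod n)) - kerD (x i) (x (Suc i mod n))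
       else kerD (x i) (x (Suc i mod n))) = chain tipN (?k j) (n - 1) tipD (?y j x)"
      by (subst cyclic_term_eq_chain[symmetric]) (auto simp: kerN_def intro!: prod.cong)
  qed
  then have "(LINT x|?M. (\<Prod>i<n. kerN (x i) (x (Suc i mod n))) - (\<Prod>i<n. kerD (x i) (x (Suc i mod n))))
     = (LINT x|?M. (\<Sum>j<n. chain tipN (?k j) (n - 1) tipD (?y j x)))" by simp
  also have "\<dots> = 0" using c by (subst Bochner_Integration.integral_sum) auto
  finally show ?thesis .
qed

section \<open>Determinants of cyclic block matrices\<close>

text \<open>The expression that defines \<open>wedge\<close>, with the values of the forms on the frame as entries.\<close>

definition leibniz :: "nat \<Rightarrow> (nat \<Rightarrow> nat \<Rightarrow> real) \<Rightarrow> real" where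
  "leibniz N B = (\<Sum>\<sigma> | \<sigma> permutes {..<N}. of_int (sign \<sigma>) * (\<Prod>a<N. B a (\<sigma> a)))"

lemma leibniz_eq_det: "leibniz N B = Determinant.det (Matrix.mat N N (\<lambda>(a, b). B a b))"
proof -
  have "(\<Prod>a<N. B a (\<sigma> a)) = (\<Prod>a<N. Matrix.mat N N (\<lambda>(a, b). B a b) $$ (a, \<sigma> a))"
    if "\<sigma> permutes {..<N}" for \<sigma>
  proof (rule prod.cong[OF refl])
    fix a assume "a \<in> {..<N}"
    then have "\<sigma> a < N" "a < N" using permutes_in_image[OF that, of a] by simp_all
    then show "B a (\<sigma> a) = Matrix.mat N N (\<lambda>(a, b). B a b) $$ (a, \<sigma> a)" by simp
  qed
  then show ?thesis
    unfolding leibniz_def by (subst det_def'[of _ N]) (simp_all add: atLeast0LessThan)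
qed

text \<open>Subtracting multiples of the even columns from the following odd columns is multiplication by a
  unipotent upper triangular matrix.\<close>

lemma leibniz_column_operation:
  assumes N: "N = 2 * n"
  shows "leibniz N (\<lambda>a b. if odd b then B a b - t (b div 2) * B a (b - 1) else B a b) = leibniz N B"
proof -
  define Q where "Q = Matrix.mat N N (\<lambda>(c, b). if c = b then 1 else if odd b \<and> Suc c = b then - t (b div 2) else 0 :: real)"
  define A where "A = Matrix.mat N N (\<lambda>(a, b). B a b)"
  have Q: "Q \<in> carrier_mat N N" and A: "A \<in> carrier_mat N N" by (simp_all add: Q_def A_def)
  have "Determinant.det Q = prod_list (diag_mat Q)"
    using Q by (intro det_upper_triangular[of _ N] upper_triangularI) (auto simp: Q_def)
  also have "diag_mat Q = map (\<lambda>_. 1) [0..<N]"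
    by (auto simp: diag_mat_def Q_def)
  also have "prod_list \<dots> = (1::real)" by (simp add: map_replicate_const)
  finally have detQ: "Determinant.det Q = 1" .
  have "A * Q = Matrix.mat N N (\<lambda>(a, b). if odd b then B a b - t (b div 2) * B a (b - 1) else B a b)"
  proof (rule eq_matI)
    fix a b assume "a < dim_row (Matrix.mat N N (\<lambda>(a, b). if odd b then B a b - t (b div 2) * B a (b - 1) else B a b))"
      "b < dim_col (Matrix.mat N N (\<lambda>(a, b). if odd b then B a b - t (b div 2) * B a (b - 1) else B a b))"
    then have ab: "a < N" "b < N" by simp_all
    have "(A * Q) $$ (a, b) = (\<Sum>c\<in>{0..<N}. B a c * (if c = b then 1 else if odd b \<and> Suc c = b then - t (b div 2) else 0))"
      using ab by (simp add: A_def Q_def times_mat_def scalar_prod_def)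
    also have "\<dots> = (\<Sum>c\<in>{0..<N}. (if c = b then B a c else 0) + (if c = b - 1 then (if odd b then - t (b div 2) * B a c else 0) else 0))"
    proof (rule sum.cong[OF refl])
      fix c
      have "Suc c = b \<longleftrightarrow> c = b - 1 \<and> c \<noteq> b" if "odd b" using that by (cases b) auto
      moreover have "c = b - 1 \<Longrightarrow> odd b \<Longrightarrow> c \<noteq> b" by (cases b) auto
      ultimately show "B a c * (if c = b then 1 else if odd b \<and> Suc c = b then - t (b div 2) else 0)
         = (if c = b then B a c else 0) + (if c = b - 1 then (if odd b then - t (b div 2) * B a c else 0) else 0)"
        by (cases "odd b"; cases "c = b"; cases "c = b - 1") simp_all
    qed
    also have "\<dots> = B a b + (if odd b then - t (b div 2) * B a (b - 1) else 0)"
      using ab less_imp_diff_less[OF ab(2), of 1] by (simp add: sum.distrib sum.delta)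
    finally show "(A * Q) $$ (a, b) = Matrix.mat N N (\<lambda>(a, b). if odd b then B a b - t (b div 2) * B a (b - 1) else B a b) $$ (a, b)"
      using ab by simp
  qed (simp_all add: A_def Q_def)
  then show ?thesis
    using det_mult[OF A Q] detQ by (simp add: leibniz_eq_det A_def)
qed

text \<open>The cycle \<open>1 \<mapsto> 3 \<mapsto> \<dots> \<mapsto> 2m+1 \<mapsto> 1\<close>, built from transpositions to make its sign
  evident.\<close>

fun odd_cycle :: "nat \<Rightarrow> nat \<Rightarrow> nat" where
  "odd_cycle 0 = id"
| "odd_cycle (Suc m) = odd_cycle m \<circ> Transposition.transpose (2 * m + 1) (2 * m + 3)"

lemma odd_cycle_even: "odd_cycle m (2 * i) = 2 * i"
proof (induction m)
  case (Suc m)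
  have "Transposition.transpose (2 * m + 1) (2 * m + 3) (2 * i) = 2 * i" by (rule transpose_apply_other) presburger+
  then show ?case using Suc by simp
qed simp

lemma odd_cycle_odd: "odd_cycle m (2 * i + 1) = (if i < m then 2 * i + 3 else if i = m then 1 else 2 * i + 1)"
proof (induction m arbitrary: i)
  case (Suc m)
  consider "i = m" | "i = Suc m" | "i \<noteq> m" "i \<noteq> Suc m" by blast
  then show ?case
  proof cases
    case 1
    then show ?thesis using Suc.IH[of "Suc m"] by (simp add: eval_nat_numeral)
  next
    case 2
    then have e: "2 * i + 1 = 2 * m + 3" by simp
    have "odd_cycle (Suc m) (2 * i + 1) = odd_cycle m (2 * m + 1)"
      by (simp only: e odd_cycle.simps o_apply transpose_apply_second)
    then show ?thesis using Suc.IH[of m] 2 by simp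
  next
    case 3
    then have "Transposition.transpose (2 * m + 1) (2 * m + 3) (2 * i + 1) = 2 * i + 1"
      by (intro transpose_apply_other) auto
    then show ?thesis using Suc.IH[of i] 3 by auto
  qed
qed simp

lemma odd_cycle_permutes: "odd_cycle m permutes {..<2 * Suc m}"
proof (induction m)
  case (Suc m)
  have "odd_cycle m permutes {..<2 * Suc (Suc m)}" using Suc by (rule permutes_subset) auto
  moreover have "Transposition.transpose (2 * m + 1) (2 * m + 3) permutes {..<2 * Suc (Suc m)}"
    by (rule permutes_swap_id) auto
  ultimately show ?case unfolding odd_cycle.simps by (rule permutes_compose[rotated])
next
  case 0
  show ?case unfolding odd_cycle.simps by (rule permutes_id)
qed

lemma sign_odd_cycle: "sign (odd_cycle m) = (- 1) ^ m"
proof (induction m)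
  case (Suc m)
  have "permutation (odd_cycle m)" using odd_cycle_permutes by (rule permutes_imp_permutation[rotated]) simp
  then have "sign (odd_cycle (Suc m)) = sign (odd_cycle m) * sign (Transposition.transpose (2 * m + 1) (2 * m + 3))"
    unfolding odd_cycle.simps by (intro sign_compose permutation_swap_id)
  then show ?case using Suc by (simp add: sign_swap_id del: odd_cycle.simps)
qed (simp add: sign_id)

text \<open>The even rows force the even indices to be fixed.  If one odd index is moved to its successor,
  injectivity forces the successor to move as well, and so on around the cycle.\<close>

lemma two_nonzero_permutations:
  fixes B :: "nat \<Rightarrow> nat \<Rightarrow> real"
  assumes n: "n \<ge> 2"
    and even: "\<And>i b. i < n \<Longrightarrow> b < 2 * n \<Longrightarrow> b \<noteq> 2 * i \<Longrightarrow> B (2 * i) b = 0"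
    and odd: "\<And>i l. i < n \<Longrightarrow> l < n \<Longrightarrow> l \<noteq> i \<Longrightarrow> l \<noteq> Suc i mod n \<Longrightarrow> B (2 * i + 1) (2 * l + 1) = 0"
    and \<sigma>: "\<sigma> permutes {..<2 * n}" and nz: "(\<Prod>a<2 * n. B a (\<sigma> a)) \<noteq> 0"
  shows "\<sigma> = id \<or> \<sigma> = odd_cycle (n - 1)"
proof -
  have nz': "B a (\<sigma> a) \<noteq> 0" if "a < 2 * n" for a using nz that by simp
  have lt: "\<sigma> a < 2 * n" if "a < 2 * n" for a using permutes_in_image[OF \<sigma>, of a] that by simp
  have inj: "\<sigma> a = \<sigma> b \<Longrightarrow> a = b" for a b using permutes_inj[OF \<sigma>] by (simp add: inj_eq)
  have ev: "\<sigma> (2 * i) = 2 * i" if "i < n" for i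
    using even[OF that lt[of "2 * i"]] nz'[of "2 * i"] that by auto
  have od: "\<sigma> (2 * i + 1) = 2 * i + 1 \<or> \<sigma> (2 * i + 1) = 2 * (Suc i mod n) + 1" if i: "i < n" for i
  proof -
    have "odd (\<sigma> (2 * i + 1))"
    proof
      assume "even (\<sigma> (2 * i + 1))"
      then obtain l where l: "\<sigma> (2 * i + 1) = 2 * l" by (elim evenE)
      then have "l < n" using lt[of "2 * i + 1"] i by simp
      then have "\<sigma> (2 * l) = \<sigma> (2 * i + 1)" using ev l by simp
      then show False using inj[of "2 * l" "2 * i + 1"] by presburger
    qed
    then obtain l where l: "\<sigma> (2 * i + 1) = 2 * l + 1" by (elim oddE)
    then have "l < n" using lt[of "2 * i + 1"] i by simp
    then show ?thesis using odd[OF i, of l] nz'[of "2 * i + 1"] i l by auto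
  qed
  have out: "\<sigma> a = a" if "a \<ge> 2 * n" for a using permutes_not_in[OF \<sigma>, of a] that by simp
  show ?thesis
  proof (cases "\<forall>i<n. \<sigma> (2 * i + 1) = 2 * i + 1")
    case True
    have "\<sigma> a = a" for a
    proof (cases "a < 2 * n")
      case lt: True
      show ?thesis
      proof (cases "even a")
        case True then show ?thesis using ev lt by (auto elim!: evenE)
      next
        case False then show ?thesis using \<open>\<forall>i<n. _\<close> lt by (auto elim!: oddE)
      qed
    qed (simp add: out)
    then show ?thesis by auto
  next
    case False
    then obtain i0 where i0: "i0 < n" "\<sigma> (2 * i0 + 1) = 2 * (Suc i0 mod n) + 1" "Suc i0 mod n \<noteq> i0"
      using od by metis
    have nx_ne: "Suc i mod n \<noteq> i" if "i < n" for i
      using that n by (cases "Suc i = n") auto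
    have moved: "\<sigma> (2 * ((i0 + r) mod n) + 1) = 2 * (Suc (i0 + r) mod n) + 1" for r
    proof (induction r)
      case 0 then show ?case using i0 by simp
    next
      case (Suc r)
      let ?i = "(i0 + Suc r) mod n"
      have i: "?i < n" using n by simp
      have "(i0 + r) mod n \<noteq> ?i"
        using nx_ne[of "(i0 + r) mod n"] n by (simp add: mod_Suc_eq)
      then have "\<sigma> (2 * ?i + 1) \<noteq> 2 * ?i + 1"
        using Suc inj[of "2 * ((i0 + r) mod n) + 1" "2 * ?i + 1"] by auto
      then show ?case using od[OF i] by (simp add: mod_Suc_eq)
    qed
    have mv: "\<sigma> (2 * i + 1) = 2 * (Suc i mod n) + 1" if "i < n" for i
    proof -
      \<comment> \<open>The vertex \<open>i\<close> is reached from \<open>i0\<close> after \<open>i + n - i0\<close> steps around the cycle.\<close>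
      have "(i0 + (i + n - i0)) mod n = i" using that i0 by simp
      moreover have "Suc (i0 + (i + n - i0)) = Suc i + n" using i0 by simp
      then have "Suc (i0 + (i + n - i0)) mod n = Suc i mod n" by (simp only: mod_add_self2)
      ultimately show ?thesis using moved[of "i + n - i0"] by simp
    qed
    have "\<sigma> a = odd_cycle (n - 1) a" for a
    proof (cases "a < 2 * n")
      case lt: True
      show ?thesis
      proof (cases "even a")
        case True then show ?thesis using ev lt by (auto elim!: evenE simp: odd_cycle_even)
      next
        case False
        then obtain i where i: "a = 2 * i + 1" by (elim oddE)
        then have "i < n" using lt by simp
        then show ?thesis unfolding i mv[OF \<open>i < n\<close>] odd_cycle_odd by (auto simp: mod_Suc)
      qed
    next
      case False
      moreover have "odd_cycle (n - 1) permutes {..<2 * n}" using odd_cycle_permutes[of "n - 1"] n by simp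
      ultimately show ?thesis using out[of a] permutes_not_in[of "odd_cycle (n - 1)" "{..<2 * n}" a] by simp
    qed
    then show ?thesis by auto
  qed
qed

lemma prod_even_odd: "(\<Prod>a<2 * n. f a) = (\<Prod>i<n. f (2 * i)) * (\<Prod>i<n. f (2 * i + 1))"
  for f :: "nat \<Rightarrow> real"
  by (induction n) (simp_all add: mult_ac)

text \<open>For even \<open>n\<close> the cycle is an odd permutation, which produces the minus sign.\<close>

lemma leibniz_two_terms:
  assumes n: "n \<ge> 2" "even n"
    and ev: "\<And>i b. i < n \<Longrightarrow> b < 2 * n \<Longrightarrow> b \<noteq> 2 * i \<Longrightarrow> B (2 * i) b = 0"
    and od: "\<And>i l. i < n \<Longrightarrow> l < n \<Longrightarrow> l \<noteq> i \<Longrightarrow> l \<noteq> Suc i mod n \<Longrightarrow> B (2 * i + 1) (2 * l + 1) = 0"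
  shows "leibniz (2 * n) B = (\<Prod>i<n. B (2 * i) (2 * i)) *
     ((\<Prod>i<n. B (2 * i + 1) (2 * i + 1)) - (\<Prod>i<n. B (2 * i + 1) (2 * (Suc i mod n) + 1)))"
proof -
  let ?\<tau> = "odd_cycle (n - 1)"
  let ?t = "\<lambda>\<sigma>. of_int (sign \<sigma>) * (\<Prod>a<2 * n. B a (\<sigma> a))"
  have \<tau>: "?\<tau> permutes {..<2 * n}" using odd_cycle_permutes[of "n - 1"] n by simp
  have "odd_cycle (n - 1) (2 * 0 + 1) \<noteq> 2 * 0 + 1" unfolding odd_cycle_odd using n by simp
  then have ne: "?\<tau> \<noteq> id" by (metis id_apply)
  have "leibniz (2 * n) B = (\<Sum>\<sigma>\<in>{id, ?\<tau>}. ?t \<sigma>)"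
    unfolding leibniz_def
  proof (rule sum.mono_neutral_right)
    show "\<forall>\<sigma>\<in>{\<sigma>. \<sigma> permutes {..<2 * n}} - {id, ?\<tau>}. ?t \<sigma> = 0"
    proof
      fix \<sigma> assume s: "\<sigma> \<in> {\<sigma>. \<sigma> permutes {..<2 * n}} - {id, ?\<tau>}"
      show "?t \<sigma> = 0"
      proof (rule ccontr)
        assume "?t \<sigma> \<noteq> 0"
        then have "(\<Prod>a<2 * n. B a (\<sigma> a)) \<noteq> 0" by simp
        with s two_nonzero_permutations[of n B \<sigma>, OF n(1) ev od] show False by auto
      qed
    qed
  qed (use \<tau> in \<open>auto simp: permutes_id finite_permutations\<close>)
  also have "\<dots> = ?t id + ?t ?\<tau>" using ne by simp
  also have "?t id = (\<Prod>i<n. B (2 * i) (2 * i)) * (\<Prod>i<n. B (2 * i + 1) (2 * i + 1))"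
    by (simp add: prod_even_odd)
  also have "?t ?\<tau> = - ((\<Prod>i<n. B (2 * i) (2 * i)) * (\<Prod>i<n. B (2 * i + 1) (2 * (Suc i mod n) + 1)))"
  proof -
    have "sign ?\<tau> = - 1" using n by (simp add: sign_odd_cycle)
    moreover have "?\<tau> (2 * i + 1) = 2 * (Suc i mod n) + 1" if "i < n" for i
      unfolding odd_cycle_odd using that by (auto simp: mod_Suc)
    ultimately show ?thesis by (simp add: prod_even_odd odd_cycle_even del: One_nat_def Suc_eq_plus1 add_Suc_right)
  qed
  finally show ?thesis by (simp add: algebra_simps)
qed

section \<open>The wheel form in terms of the kernels\<close>

text \<open>The right-hand side is \<open>\<partial>\<^sub>A\<^sub>,\<^sub>p\<close> of the Neumann Green function \<open>ln |p - q| + ln |p - cnj q|\<close>.  In the difference to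
  \<open>kerD\<close> only difference quotients of \<open>vfield\<close> remain, and these are products of a function of
  \<open>p\<close> with a function of \<open>q\<close>.\<close>

lemma kerN_neumann:
  assumes "Im p > 0" "Im q > 0" "p \<noteq> q"
  shows "kerN p q = - Im (vfield p * (1 / (p - q) + 1 / (p - cnj q)))"
proof -
  have n: "p \<noteq> 0" "q \<noteq> 0" "p - q \<noteq> 0" "p - cnj q \<noteq> 0" "cnj q \<noteq> 0"
    using assms by (auto simp: complex_eq_iff)
  have quot: "(vfield p - vfield w) / (p - w) = (1 - 1 / p * (1 / w)) / 2" if "w \<noteq> 0" "p - w \<noteq> 0" for w
  proof -
    have "vfield p - vfield w = (p - w) * ((1 - 1 / p * (1 / w)) / 2)"
      using that n by (simp add: vfield_def field_simps)
    then show ?thesis using that by simp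
  qed
  have c: "vfield (cnj q) = cnj (vfield q)" by (simp add: vfield_def)
  have e: "vfield q / (q - p) = - (vfield q / (p - q))"
    by (metis minus_diff_eq minus_divide_right)
  have "kerD p q = Im (vfield q / (q - p)) - Im (vfield q / (q - cnj p))"
    by (simp add: kerD_def right_diff_distrib)
  also have "Im (vfield q / (q - p)) = - Im (vfield q / (p - q))" unfolding e by simp
  also have "Im (vfield q / (q - cnj p)) = - Im (cnj (vfield q / (q - cnj p)))"
    by (simp only: cnj.simps minus_minus)
  also have "cnj (vfield q / (q - cnj p)) = - (vfield (cnj q) / (p - cnj q))"
    using minus_divide_right[of "vfield (cnj q)" "p - cnj q"] by (simp add: c)
  finally have D: "kerD p q = - Im (vfield q / (p - q)) - Im (vfield (cnj q) / (p - cnj q))" by simp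
  have "- Im (vfield p * (1 / (p - q) + 1 / (p - cnj q))) - kerD p q
     = - Im ((vfield p - vfield q) / (p - q) + (vfield p - vfield (cnj q)) / (p - cnj q))"
    unfolding D by (simp add: distrib_left diff_divide_distrib)
  also have "\<dots> = - Im ((1 - 1 / p * (1 / q)) / 2 + (1 - 1 / p * (1 / cnj q)) / 2)"
    using n by (subst (1 2) quot) auto
  also have "\<dots> = Im (1 / p * ((1 / q + cnj (1 / q)) / 2))"
  proof -
    have "(1 - a * b) / 2 + (1 - a * b') / 2 = 1 - a * ((b + b') / 2)" for a b b' :: complex
      by (simp add: field_simps)
    then have "- Im ((1 - a * b) / 2 + (1 - a * b') / 2) = Im (a * ((b + b') / 2))" for a b b' :: complex
      by (simp only: minus_complex.simps one_complex.simps)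
    moreover have "1 / cnj q = cnj (1 / q)" by simp
    ultimately show ?thesis by (simp only:)
  qed
  also have "(1 / q + cnj (1 / q)) / 2 = of_real (tipN q)"
    unfolding complex_add_cnj tipN_def by simp
  also have "Im (1 / p * of_real (tipN q)) = tipD p * tipN q"
  proof -
    have "Im (w * of_real r) = Im w * r" for w r by simp
    then show ?thesis unfolding tipD_def .
  qed
  finally show ?thesis by (simp add: kerN_def)
qed

text \<open>For \<open>dA = Im (du / c)\<close> and \<open>df = Im (\<beta> du)\<close> this is the coefficient of \<open>dA \<and> df\<close>.\<close>

lemma bracket_identity:
  fixes c \<beta> :: complex
  assumes "c \<noteq> 0"
  shows "Im (1 / c) * Im (\<i> * \<beta>) - Im (\<i> * (1 / c)) * Im \<beta> = - Im (c * \<beta>) / (cmod c)\<^sup>2"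
proof -
  have "1 / c = cnj c / of_real ((cmod c)\<^sup>2)"
    using complex_div_cnj[of 1 c] by simp
  then have RI: "Re (1 / c) = Re c / (cmod c)\<^sup>2" "Im (1 / c) = - Im c / (cmod c)\<^sup>2"
    by (simp_all add: Re_divide_of_real Im_divide_of_real)
  have gen: "Im w * Im (\<i> * \<beta>) - Im (\<i> * w) * Im \<beta> = Im w * Re \<beta> - Re w * Im \<beta>" for w by simp
  show ?thesis unfolding gen unfolding RI by (simp add: diff_divide_distrib add_divide_distrib)
qed

lemma Im_inverse_vfield_ne_0:
  assumes "Im p > 0" "cmod p \<noteq> 1"
  shows "Im (1 / vfield p) \<noteq> 0"
proof
  assume "Im (1 / vfield p) = 0"
  then have "Im (vfield p) = 0"
    by (metis Im_complex_of_real complex_is_Real_iff divide_divide_eq_right Reals_1 Reals_divide div_by_0 mult_1 zero_complex.simps(2) div_by_1)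
  moreover have "Im (1 / p) = - Im p / (cmod p)\<^sup>2" by (simp add: Im_divide cmod_power2)
  ultimately have "Im p * (1 - 1 / (cmod p)\<^sup>2) = 0" by (simp add: vfield_def algebra_simps)
  then have "1 / (cmod p)\<^sup>2 = 1" using assms(1) by simp
  then have "(cmod p)\<^sup>2 = 1" by simp
  then show False using assms(2) by (simp add: abs_square_eq_1)
qed

lemma nth_concat_map_pair:
  "i < n \<Longrightarrow> concat (map (\<lambda>j. [f j, g j]) [m..<m + n]) ! (2 * i) = f (m + i)"
  "i < n \<Longrightarrow> concat (map (\<lambda>j. [f j, g j]) [m..<m + n]) ! (2 * i + 1) = g (m + i)"
  "length (concat (map (\<lambda>j. [f j, g j]) [m..<m + n])) = 2 * n"
proof -
  have "length (concat (map (\<lambda>j. [f j, g j]) [m..<m + n])) = 2 * n \<and>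
    (\<forall>i<n. concat (map (\<lambda>j. [f j, g j]) [m..<m + n]) ! (2 * i) = f (m + i) \<and>
     concat (map (\<lambda>j. [f j, g j]) [m..<m + n]) ! (2 * i + 1) = g (m + i))" for n
  proof (induction n)
    case (Suc n)
    then show ?case by (auto simp: nth_append less_Suc_eq)
  qed simp
  then show "i < n \<Longrightarrow> concat (map (\<lambda>j. [f j, g j]) [m..<m + n]) ! (2 * i) = f (m + i)"
  "i < n \<Longrightarrow> concat (map (\<lambda>j. [f j, g j]) [m..<m + n]) ! (2 * i + 1) = g (m + i)"
  "length (concat (map (\<lambda>j. [f j, g j]) [m..<m + n])) = 2 * n" by auto
qed

text \<open>The column operation in the block of \<open>z\<^sub>i\<close> makes the coordinate vectors adapted to \<open>dA\<^sub>i\<close>: it replaces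
  \<open>\<partial>\<^sub>y\<close> by a vector annihilated by \<open>dA\<^sub>i\<close>.  It divides by \<open>\<partial>\<^sub>x A\<^sub>i\<close>, which is
  why the unit circle, where this derivative vanishes, is excluded.\<close>

lemma wheel_density_eq:
  assumes k: "k \<ge> 1" and z: "\<And>i. i \<in> {1..2 * k} \<Longrightarrow> Im (z i) > 0 \<and> z i \<noteq> \<i> \<and> cmod (z i) \<noteq> 1"
    and inj: "inj_on z {1..2 * k}"
  defines "n \<equiv> 2 * k" and "p \<equiv> \<lambda>i. z (Suc i)"
  shows "wheel_density k z = (\<Prod>i<n. 1 / (cmod (vfield (p i)))\<^sup>2) *
     ((\<Prod>i<n. kerN (p i) (p (Suc i mod n))) - (\<Prod>i<n. kerD (p i) (p (Suc i mod n))))"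
proof -
  have n: "n \<ge> 2" "even n" using k by (auto simp: n_def)
  let ?nx = "\<lambda>i. Suc i mod n"
  let ?z = "z(0 := \<i>)"
  have nx: "?nx i < n" "?nx i \<noteq> i" if "i < n" for i using that n by (auto simp: mod_Suc)
  have P: "Im (p i) > 0" "p i \<noteq> \<i>" "cmod (p i) \<noteq> 1" if "i < n" for i
    using z[of "Suc i"] that by (auto simp: p_def n_def)
  have pne: "p i \<noteq> p (?nx i)" if "i < n" for i
    using inj_onD[OF inj, of "Suc i" "Suc (?nx i)"] nx[OF that] that by (auto simp: p_def n_def)
  have c0: "vfield (p i) \<noteq> 0" if "i < n" for i using vfield_nonzero[of "p i"] P[OF that] by auto
  have rim: "rim_next k (Suc i) = Suc (?nx i)" if "i < n" for i
    using that by (auto simp: rim_next_def n_def mod_Suc)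
  have edges: "wheel_edges k = concat (map (\<lambda>j. [(j, 0), (j, rim_next k j)]) [1..<1 + n])"
    by (simp add: wheel_edges_def n_def)
  define M where "M a b = edge_form (wheel_edges k ! a) ?z (coord_frame b)" for a b
  have len: "length (wheel_edges k) = 2 * n" unfolding edges by (rule nth_concat_map_pair)
  have wd: "wheel_density k z = leibniz (2 * n) M"
    unfolding wheel_density_def wedge_def leibniz_def M_def length_map len
    by (intro sum.cong refl arg_cong2[where f = "(*)"] prod.cong) (simp add: len)
  define e :: "nat \<Rightarrow> complex" where "e b = (if even b then 1 else \<i>)" for b
  have frame: "coord_frame b (Suc i) = (if b div 2 = i then e b else 0)" "coord_frame b 0 = 0" for b i
    by (auto simp: coord_frame_def e_def)
  have upper: "p i \<in> upper_half_plane" "\<i> \<in> upper_half_plane" if "i < n" for i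
    using P[OF that] by (simp_all add: upper_half_plane_def)
  have Mev: "M (2 * i) b = (if b div 2 = i then Im (e b * (1 / vfield (p i))) else 0)" if i: "i < n" for i b
  proof -
    have "wheel_edges k ! (2 * i) = (Suc i, 0)"
      unfolding edges using nth_concat_map_pair(1)[OF i, of "\<lambda>j. (j, 0)" "\<lambda>j. (j, rim_next k j)" 1] by simp
    then have "M (2 * i) b = d_harmonic_angle (p i) \<i> (coord_frame b (Suc i), 0)"
      by (simp add: M_def edge_form_def p_def frame(2))
    also have "\<dots> = Im (- coord_frame b (Suc i) / (\<i> - p i) + cnj (coord_frame b (Suc i)) / (\<i> - cnj (p i)))"
      using d_harmonic_angle_eq[OF upper(1)[OF i] upper(2)[OF i] P(2)[OF i]] by simp
    also have "\<dots> = (if b div 2 = i then Im (e b * (1 / vfield (p i))) else 0)"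
    proof -
      have "Im (- u / (\<i> - p i) + cnj u / (\<i> - cnj (p i))) = Im (u * (1 / vfield (p i)))" for u
      proof -
        have nn: "p i - \<i> \<noteq> 0" "p i + \<i> \<noteq> 0" "p i \<noteq> 0" using P[OF i] upper_bounds[OF P(1)[OF i]] by auto
        have "cnj (cnj u / (\<i> - cnj (p i))) = - (u / (p i + \<i>))"
          using minus_divide_right[of u "p i + \<i>"] by simp
        then have "Im (cnj u / (\<i> - cnj (p i))) = Im (u / (p i + \<i>))"
          by (metis cnj.simps(2) minus_minus uminus_complex.simps(2))
        moreover have "- u / (\<i> - p i) = u / (p i - \<i>)"
          by (metis minus_divide_divide minus_diff_eq)
        ultimately have "Im (- u / (\<i> - p i) + cnj u / (\<i> - cnj (p i))) = Im (u / (p i - \<i>) + u / (p i + \<i>))" by simp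
        also have "u / (p i - \<i>) + u / (p i + \<i>) = u * (2 * p i / ((p i - \<i>) * (p i + \<i>)))"
          using nn by (simp add: divide_simps) (simp add: algebra_simps)
        also have "2 * p i / ((p i - \<i>) * (p i + \<i>)) = 1 / vfield (p i)"
        proof -
          have "vfield (p i) = (p i - \<i>) * (p i + \<i>) / (2 * p i)"
            using nn by (simp add: vfield_def field_simps power2_eq_square)
          then show ?thesis by simp
        qed
        finally show ?thesis .
      qed
      then show ?thesis by (simp add: frame(1))
    qed
    finally show ?thesis .
  qed
  define \<beta> where "\<beta> i = 1 / (p i - p (?nx i)) + 1 / (p i - cnj (p (?nx i)))" for i
  define \<gamma> where "\<gamma> i = 1 / (p (?nx i) - p i) - 1 / (p (?nx i) - cnj (p i))" for i
  have Mod: "M (2 * i + 1) b = (if b div 2 = i then Im (e b * \<beta> i) else if b div 2 = ?nx i then Im (e b * \<gamma> i) else 0)"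
    if i: "i < n" for i b
  proof -
    have "wheel_edges k ! (2 * i + 1) = (Suc i, Suc (?nx i))"
      unfolding edges using nth_concat_map_pair(2)[OF i, of "\<lambda>j. (j, 0)" "\<lambda>j. (j, rim_next k j)" 1] rim[OF i] by simp
    then have "M (2 * i + 1) b = d_harmonic_angle (p i) (p (?nx i)) (coord_frame b (Suc i), coord_frame b (Suc (?nx i)))"
      by (simp add: M_def edge_form_def p_def)
    also have "\<dots> = (\<lambda>(u, v). Im ((v - u) / (p (?nx i) - p i) - (v - cnj u) / (p (?nx i) - cnj (p i)))) (coord_frame b (Suc i), coord_frame b (Suc (?nx i)))"
      by (subst d_harmonic_angle_eq[OF upper(1)[OF i] upper(1)[OF nx(1)[OF i]] pne[OF i]]) simp
    also have "\<dots> = (if b div 2 = i then Im (e b * \<beta> i) else if b div 2 = ?nx i then Im (e b * \<gamma> i) else 0)"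
    proof -
      have "Im (- u / (p (?nx i) - p i) + cnj u / (p (?nx i) - cnj (p i))) = Im (u * \<beta> i)" for u
      proof -
        have "cnj (cnj u / (p (?nx i) - cnj (p i))) = - (u / (p i - cnj (p (?nx i))))"
          using minus_divide_right[of u "p i - cnj (p (?nx i))"] by simp
        then have "Im (cnj u / (p (?nx i) - cnj (p i))) = Im (u / (p i - cnj (p (?nx i))))"
          by (metis cnj.simps(2) minus_minus uminus_complex.simps(2))
        moreover have "- u / (p (?nx i) - p i) = u / (p i - p (?nx i))"
          by (metis minus_divide_divide minus_diff_eq)
        ultimately show ?thesis by (simp add: \<beta>_def distrib_left)
      qed
      moreover have "Im (v / (p (?nx i) - p i) - v / (p (?nx i) - cnj (p i))) = Im (v * \<gamma> i)" for v
        by (simp add: \<gamma>_def right_diff_distrib)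
      ultimately show ?thesis using nx(2)[OF i] by (auto simp: frame(1))
    qed
    finally show ?thesis .
  qed
  define \<alpha> where "\<alpha> i = Im (1 / vfield (p i))" for i
  define t where "t i = Im (\<i> * (1 / vfield (p i))) / \<alpha> i" for i
  have \<alpha>0: "\<alpha> i \<noteq> 0" if "i < n" for i unfolding \<alpha>_def using P[OF that] by (intro Im_inverse_vfield_ne_0)
  define B where "B a b = (if odd b then M a b - t (b div 2) * M a (b - 1) else M a b)" for a b
  have "leibniz (2 * n) M = leibniz (2 * n) B"
    unfolding B_def by (rule leibniz_column_operation[symmetric]) simp
  also have "\<dots> = (\<Prod>i<n. B (2 * i) (2 * i)) *
     ((\<Prod>i<n. B (2 * i + 1) (2 * i + 1)) - (\<Prod>i<n. B (2 * i + 1) (2 * ?nx i + 1)))"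
  proof (rule leibniz_two_terms[OF n])
    fix i b assume i: "i < n" and b: "b < 2 * n" "b \<noteq> 2 * i"
    show "B (2 * i) b = 0"
    proof (cases "odd b")
      case True
      then obtain l where l: "b = 2 * l + 1" by (elim oddE)
      show ?thesis unfolding B_def Mev[OF i] l using \<alpha>0[OF i] by (simp add: e_def t_def \<alpha>_def)
    next
      case False
      then have "even b" by simp
      then obtain l where "b = 2 * l" by (elim evenE)
      then show ?thesis using b i by (simp add: B_def Mev)
    qed
  next
    fix i l assume "i < n" "l < n" "l \<noteq> i" "l \<noteq> ?nx i"
    then show "B (2 * i + 1) (2 * l + 1) = 0" unfolding B_def Mod[OF \<open>i < n\<close>] by simp
  qed
  also have "(\<Prod>i<n. B (2 * i) (2 * i)) = (\<Prod>i<n. \<alpha> i)"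
    by (intro prod.cong refl) (simp add: B_def Mev e_def \<alpha>_def)
  also have "(\<Prod>i<n. \<alpha> i) * ((\<Prod>i<n. B (2 * i + 1) (2 * i + 1)) - (\<Prod>i<n. B (2 * i + 1) (2 * ?nx i + 1)))
     = (\<Prod>i<n. \<alpha> i * B (2 * i + 1) (2 * i + 1)) - (\<Prod>i<n. \<alpha> (?nx i) * B (2 * i + 1) (2 * ?nx i + 1))"
  proof -
    have "(\<Prod>i<n. \<alpha> (?nx i)) = (\<Prod>i<n. \<alpha> i)"
      using prod.reindex_bij_betw[OF rotation_bij[of 0 n], of \<alpha>] n by simp
    then show ?thesis by (simp add: prod.distrib right_diff_distrib)
  qed
  also have "(\<Prod>i<n. \<alpha> i * B (2 * i + 1) (2 * i + 1)) = (\<Prod>i<n. 1 / (cmod (vfield (p i)))\<^sup>2 * kerN (p i) (p (?nx i)))"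
  proof (rule prod.cong[OF refl])
    fix i assume "i \<in> {..<n}"
    then have i: "i < n" by simp
    have "\<alpha> i * B (2 * i + 1) (2 * i + 1) = \<alpha> i * Im (\<i> * \<beta> i) - Im (\<i> * (1 / vfield (p i))) * Im (\<beta> i)"
      unfolding B_def Mod[OF i] using \<alpha>0[OF i] by (simp add: e_def t_def right_diff_distrib)
    also have "\<dots> = - Im (vfield (p i) * \<beta> i) / (cmod (vfield (p i)))\<^sup>2"
      unfolding \<alpha>_def by (rule bracket_identity[OF c0[OF i]])
    also have "- Im (vfield (p i) * \<beta> i) = kerN (p i) (p (?nx i))"
      unfolding \<beta>_def using P(1) i nx pne by (intro kerN_neumann[symmetric]) auto
    finally show "\<alpha> i * B (2 * i + 1) (2 * i + 1) = 1 / (cmod (vfield (p i)))\<^sup>2 * kerN (p i) (p (?nx i))" by simp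
  qed
  also have "(\<Prod>i<n. \<alpha> (?nx i) * B (2 * i + 1) (2 * ?nx i + 1)) = (\<Prod>i<n. - (1 / (cmod (vfield (p (?nx i))))\<^sup>2 * kerD (p i) (p (?nx i))))"
  proof (rule prod.cong[OF refl])
    fix i assume "i \<in> {..<n}"
    then have i: "i < n" by simp
    note j = nx[OF i]
    have "\<alpha> (?nx i) * B (2 * i + 1) (2 * ?nx i + 1) = \<alpha> (?nx i) * Im (\<i> * \<gamma> i) - Im (\<i> * (1 / vfield (p (?nx i)))) * Im (\<gamma> i)"
      unfolding B_def Mod[OF i] using \<alpha>0[OF j(1)] j(2) by (simp add: e_def t_def right_diff_distrib)
    also have "\<dots> = - Im (vfield (p (?nx i)) * \<gamma> i) / (cmod (vfield (p (?nx i))))\<^sup>2"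
      unfolding \<alpha>_def by (rule bracket_identity[OF c0[OF j(1)]])
    also have "Im (vfield (p (?nx i)) * \<gamma> i) = kerD (p i) (p (?nx i))"
      unfolding \<gamma>_def kerD_def ..
    finally show "\<alpha> (?nx i) * B (2 * i + 1) (2 * ?nx i + 1) = - (1 / (cmod (vfield (p (?nx i))))\<^sup>2 * kerD (p i) (p (?nx i)))" by simp
  qed
  also have "\<dots> = (\<Prod>i<n. 1 / (cmod (vfield (p i)))\<^sup>2) * (\<Prod>i<n. kerD (p i) (p (?nx i)))"
  proof -
    have "(\<Prod>i<n. 1 / (cmod (vfield (p (?nx i))))\<^sup>2) = (\<Prod>i<n. 1 / (cmod (vfield (p i)))\<^sup>2)"
      using prod.reindex_bij_betw[OF rotation_bij[of 0 n], of "\<lambda>i. 1 / (cmod (vfield (p i)))\<^sup>2"] n by simp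
    moreover have "(\<Prod>i<n. - f i) = (\<Prod>i<n. f i)" for f :: "nat \<Rightarrow> real"
      using n(2) by (simp add: prod_uminus)
    ultimately show ?thesis by (simp only: prod.distrib)
  qed
  also have "(\<Prod>i<n. 1 / (cmod (vfield (p i)))\<^sup>2 * kerN (p i) (p (?nx i))) = (\<Prod>i<n. 1 / (cmod (vfield (p i)))\<^sup>2) * (\<Prod>i<n. kerN (p i) (p (?nx i)))"
    by (rule prod.distrib)
  finally show ?thesis unfolding wd by (simp only: right_diff_distrib)
qed

section \<open>The wheel integral\<close>

lemma AE_generic_lborel: "AE y in lborel. y \<noteq> \<i> \<and> cmod y \<noteq> 1"
proof -
  have "AE y in lborel. y \<notin> sphere (0::complex) 1"
    by (intro AE_lborel_not_in_negligible negligible_sphere) simp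
  with AE_lborel_singleton[of \<i>] show ?thesis by eventually_elim auto
qed

text \<open>Up to null sets the configuration space is the full product of half-planes, and the factor
  \<open>\<Prod> 1/|vfield|\<^sup>2\<close> of the density turns Lebesgue measure into the product of \<open>hmeasure\<close>.\<close>

lemma wheel_integral_eq_0:
  assumes k: "k \<ge> 1"
  shows "(LINT z:config_space (2 * k) | (\<Pi>\<^sub>M j\<in>{1..2 * k}. lborel). wheel_density k z) = 0"
proof -
  define n where "n = 2 * k"
  let ?L = "\<Pi>\<^sub>M j\<in>{1..n}. (lborel :: complex measure)"
  let ?H = "\<Pi>\<^sub>M j\<in>{1..n}. hmeasure"
  define \<rho> where "\<rho> z = indicator {z. Im z > 0} z / (cmod (vfield z))\<^sup>2" for z
  define f where "f p = (\<Prod>i<n. kerN (p i) (p (Suc i mod n))) - (\<Prod>i<n. kerD (p i) (p (Suc i mod n)))" for p :: "nat \<Rightarrow> complex"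
  define sh where "sh z = (\<lambda>i\<in>{..<n}. z (Suc i))" for z :: "nat \<Rightarrow> complex"
  have n: "n > 0" using k by (simp add: n_def)
  have fm: "f \<in> borel_measurable (PiM {..<n} (\<lambda>_. hmeasure))"
    unfolding f_def using n
    by (intro borel_measurable_diff borel_measurable_prod measurable_pair_component) auto
  have \<rho>m: "\<rho> \<in> borel_measurable borel" unfolding \<rho>_def by measurable
  have dens: "?H = density ?L (\<lambda>z. ennreal (\<Prod>i\<in>{1..n}. \<rho> (z i)))"
  proof -
    have "?H = density ?L (\<lambda>z. \<Prod>i\<in>{1..n}. ennreal (\<rho> (z i)))"
      using sigma_finite_hmeasure \<rho>m unfolding hmeasure_def \<rho>_def[symmetric]
      by (intro PiM_density sigma_finite_lborel) auto
    also have "(\<lambda>z. \<Prod>i\<in>{1..n}. ennreal (\<rho> (z i))) = (\<lambda>z. ennreal (\<Prod>i\<in>{1..n}. \<rho> (z i)))"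
      by (intro ext prod_ennreal) (simp add: \<rho>_def)
    finally show ?thesis .
  qed
  have bij: "bij_betw Suc {..<n} {1..n}"
    by (intro bij_betwI[where g = "\<lambda>i. i - 1"]) auto
  have shm: "sh \<in> ?H \<rightarrow>\<^sub>M PiM {..<n} (\<lambda>_. hmeasure)"
    unfolding sh_def by (intro measurable_restrict measurable_component_singleton) auto
  have d: "distr ?H (PiM {..<n} (\<lambda>_. hmeasure)) sh = PiM {..<n} (\<lambda>_. hmeasure)"
    unfolding sh_def by (rule distr_PiM_reindex_bij[OF sigma_finite_hmeasure _ bij]) simp
  have sets: "sets ?L = sets ?H" by (intro sets_PiM_cong) auto
  have fsh: "(\<lambda>z. f (sh z)) \<in> borel_measurable ?L"
    using measurable_compose[OF shm fm] measurable_cong_sets[OF sets refl] by blast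
  have \<rho>prod: "(\<lambda>z. \<Prod>i\<in>{1..n}. \<rho> (z i)) \<in> borel_measurable ?L"
    using \<rho>m by (intro borel_measurable_prod measurable_compose[OF measurable_component_singleton]) auto
  have "0 = (LINT x|PiM {..<n} (\<lambda>_. hmeasure). f x)"
    unfolding f_def using cyclic_trace_difference[OF n] by simp
  also have "\<dots> = (LINT z|?H. f (sh z))"
    using integral_distr[OF shm fm] unfolding d .
  also have "\<dots> = (LINT z|?L. (\<Prod>i\<in>{1..n}. \<rho> (z i)) *\<^sub>R f (sh z))"
    unfolding dens using fsh \<rho>prod by (intro integral_density AE_I2) (auto simp: \<rho>_def intro!: prod_nonneg)
  finally have zero: "(LINT z|?L. (\<Prod>i\<in>{1..n}. \<rho> (z i)) *\<^sub>R f (sh z)) = 0" ..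
  have "(LINT z:config_space n|?L. wheel_density k z) = 0"
  proof -
    let ?g = "\<lambda>z. (\<Prod>i\<in>{1..n}. \<rho> (z i)) *\<^sub>R f (sh z)"
    let ?w = "\<lambda>z. indicator (config_space n) z *\<^sub>R wheel_density k z"
    have ae1: "AE z in ?L. \<forall>i\<in>{1..n}. z i \<noteq> \<i> \<and> cmod (z i) \<noteq> 1"
      by (intro AE_finite_allI AE_PiM_coordinate AE_generic_lborel sigma_finite_lborel) auto
    have ae2: "AE z in ?L. \<forall>i\<in>{1..n}. \<forall>j\<in>{1..n} - {i}. z i \<noteq> z j"
      by (intro AE_finite_allI AE_PiM_distinct AE_lborel_singleton sigma_finite_lborel) auto
    have ae: "AE z in ?L. ?g z = ?w z"
      using ae1 ae2 AE_space[of ?L]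
    proof eventually_elim
      case (elim z)
      have inj: "inj_on z {1..n}" using elim(2) by (auto simp: inj_on_def)
      have ext: "z \<in> extensional {1..n}" using elim(3) by (simp add: space_PiM PiE_iff)
      show ?case
      proof (cases "\<forall>i\<in>{1..n}. Im (z i) > 0")
        case True
        have "z \<in> config_space n"
          using True elim(1) inj ext by (auto simp: config_space_def upper_half_plane_def PiE_iff)
        moreover have "wheel_density k z = (\<Prod>i<n. 1 / (cmod (vfield (z (Suc i))))\<^sup>2) *
     ((\<Prod>i<n. kerN (z (Suc i)) (z (Suc (Suc i mod n)))) - (\<Prod>i<n. kerD (z (Suc i)) (z (Suc (Suc i mod n)))))"
          using wheel_density_eq[OF k, of z] True elim(1) inj by (simp add: n_def)
        moreover have "(\<Prod>i\<in>{1..n}. \<rho> (z i)) = (\<Prod>i<n. 1 / (cmod (vfield (z (Suc i))))\<^sup>2)"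
          using True prod.reindex_bij_betw[OF bij, of "\<lambda>i. \<rho> (z i)", symmetric]
          by (auto simp: \<rho>_def intro!: prod.cong)
        moreover have "f (sh z) = (\<Prod>i<n. kerN (z (Suc i)) (z (Suc (Suc i mod n)))) - (\<Prod>i<n. kerD (z (Suc i)) (z (Suc (Suc i mod n))))"
          using n unfolding f_def sh_def by (auto intro!: arg_cong2[where f = "(-)"] prod.cong)
        ultimately show ?thesis by simp
      next
        case False
        then obtain i where i: "i \<in> {1..n}" "\<not> Im (z i) > 0" by blast
        then have "(\<Prod>i\<in>{1..n}. \<rho> (z i)) = 0" by (intro prod_zero bexI[of _ i]) (auto simp: \<rho>_def)
        moreover have "z \<notin> config_space n"
          using i by (auto simp: config_space_def upper_half_plane_def PiE_iff)
        ultimately show ?thesis by simp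
      qed
    qed
    show ?thesis
    proof (cases "?w \<in> borel_measurable ?L")
      case True
      have "(LINT z|?L. ?w z) = (LINT z|?L. ?g z)"
        using fsh \<rho>prod ae True by (intro integral_cong_AE) auto
      then show ?thesis unfolding set_lebesgue_integral_def zero .
    next
      case False
      \<comment> \<open>Here the Bochner integral is zero by convention.\<close>
      then have "\<not> integrable ?L ?w" by auto
      then show ?thesis unfolding set_lebesgue_integral_def by (rule not_integrable_integral_eq)
    qed
  qed
  then show ?thesis by (simp add: n_def)
qed

theorem mainTheorem1:
  fixes k :: nat and c :: real
  assumes "k \<ge> 1" and "c \<noteq> 0"
  shows "wheel_integral c k = 0"
  using wheel_integral_eq_0[OF assms(1)] by (simp add: wheel_integral_def)

end
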